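(* Let $E_1\subseteq E_2\subseteq\cdots$ be an ascending sequence of Hausdorff locally convex spaces which does not become stationary, such that each $E_n$ is a vector subspace of $E_{n+1}$ and $E_{n+1}$ induces the given topology on $E_n$. Let $E:=\bigcup_{n\in\mathbb N}E_n$, equipped with the locally convex direct limit topology. (a) If each $E_n$ is infinite-dimensional and metrizable, then $E\neq\varinjlim E_n$ as a topological space. (b) If each $E_n$ is an infinite-dimensional nuclear Fréchet space, then $E\neq\varinjlim E_n$ as a $C^r$-manifold, for each $r\in\mathbb N_0\cup\{\infty\}$. Furthermore, $E$ is smoothly regular.
   Context: Locally convex spaces are real here. The locally convex direct limit topology on $E$ is the finest locally convex vector topology making all inclusion maps $E_n\to E$ continuous. For Hausdorff real locally convex spaces $F_1,F_2$, $U\subseteq F_1$ open and $r\in\mathbb N_0\cup\{\infty\}$, a map $f\colon U\to F_2$ is $C^r$ if it is continuous and, for all $k\in\mathbb N$ with $k\le r$, the iterated directional derivatives $d^kf(x,y_1,\dots,y_k)=D_{y_1}\cdots D_{y_k}f(x)$ exist for all arguments and define a continuous map $d^kf\colon U\times F_1^k\to F_2$. $C^r$-manifolds are real, Hausdorff, and modelled on Hausdorff locally convex spaces. $E=\varinjlim E_n$ in a category means that $E$ with the inclusion maps is a direct limit cone: each compatible sequence of morphisms $E_n\to Y$ factors through a unique morphism $E\to Y$. "As a topological space": topological spaces and continuous maps; "as a $C^r$-manifold": $C^r$-manifolds and $C^r$-maps. A Hausdorff real locally convex space $E$ is smoothly regular if for each $0$-neighbourhood $U\subseteq E$ there is a $C^\infty$-function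 $f\colon E\to\mathbb R$ with $f(0)=1$ and $f|_{E\setminus U}=0$. *)

theory Defs
  imports "HOL-Analysis.Analysis" "HOL-Library.Extended_Nat"
begin

text \<open>
  A topological vector space is a topology on a vector subspace (its topspace) of an
  ambient real vector space; the ambient type itself carries no topology.
\<close>

definition lc_space :: "'a::real_vector topology \<Rightarrow> bool" where
  "lc_space T \<longleftrightarrow>
     subspace (topspace T) \<and>
     continuous_map (prod_topology T T) T (\<lambda>(x, y). x + y) \<and>
     continuous_map (prod_topology euclideanreal T) T (\<lambda>(c, x). c *\<^sub>R x) \<and>
     (\<forall>U. openin T U \<and> 0 \<in> U \<longrightarrow> (\<exists>V. openin T V \<and> 0 \<in> V \<and> convex V \<and> V \<subseteq> U))"

definition hausdorff_lcs :: "'a::real_vector topology \<Rightarrow> bool" where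
  "hausdorff_lcs T \<longleftrightarrow> lc_space T \<and> Hausdorff_space T"

definition infinite_dimensional :: "'a::real_vector set \<Rightarrow> bool" where
  "infinite_dimensional V \<longleftrightarrow> \<not> (\<exists>B. finite B \<and> V \<subseteq> span B)"

definition lc_topology_on_union ::
    "(nat \<Rightarrow> 'a::real_vector topology) \<Rightarrow> 'a topology \<Rightarrow> bool" where
  "lc_topology_on_union T S \<longleftrightarrow>
     topspace S = (\<Union>n. topspace (T n)) \<and> lc_space S \<and>
     (\<forall>n. continuous_map (T n) S (\<lambda>x. x))"

definition lc_direct_limit_topology ::
    "(nat \<Rightarrow> 'a::real_vector topology) \<Rightarrow> 'a topology \<Rightarrow> bool" where
  "lc_direct_limit_topology T S \<longleftrightarrow>
     lc_topology_on_union T S \<and>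
     (\<forall>S'. lc_topology_on_union T S' \<longrightarrow> (\<forall>U. openin S' U \<longrightarrow> openin S U))"

definition frechet_space :: "'a::real_vector topology \<Rightarrow> bool" where
  "frechet_space T \<longleftrightarrow>
     hausdorff_lcs T \<and>
     (\<exists>d. Metric_space (topspace T) d \<and>
          Metric_space.mtopology (topspace T) d = T \<and>
          Metric_space.mcomplete (topspace T) d \<and>
          (\<forall>x\<in>topspace T. \<forall>y\<in>topspace T. \<forall>z\<in>topspace T. d (x + z) (y + z) = d x y))"

definition continuous_seminorm :: "'a::real_vector topology \<Rightarrow> ('a \<Rightarrow> real) \<Rightarrow> bool" where
  "continuous_seminorm T p \<longleftrightarrow>
     (\<forall>x\<in>topspace T. \<forall>y\<in>topspace T. p (x + y) \<le> p x + p y) \<and>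
     (\<forall>c. \<forall>x\<in>topspace T. p (c *\<^sub>R x) = \<bar>c\<bar> * p x) \<and>
     continuous_map T euclideanreal p"

definition linear_functional_on :: "'a::real_vector set \<Rightarrow> ('a \<Rightarrow> real) \<Rightarrow> bool" where
  "linear_functional_on V l \<longleftrightarrow>
     (\<forall>x\<in>V. \<forall>y\<in>V. l (x + y) = l x + l y) \<and> (\<forall>c. \<forall>x\<in>V. l (c *\<^sub>R x) = c * l x)"

text \<open>
  The local Banach space \<open>V\<^sub>p\<close> is the Hausdorff completion of \<open>(V, p)\<close>. Its elements are
  represented by \<open>p\<close>-Cauchy sequences in \<open>V\<close>; \<open>x \<in> V\<close> corresponds to the constant
  sequence, and the norm of the class of \<open>z\<close> is the limit of \<open>p (z m)\<close>.
\<close>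

definition seminorm_Cauchy :: "'a::real_vector set \<Rightarrow> ('a \<Rightarrow> real) \<Rightarrow> (nat \<Rightarrow> 'a) \<Rightarrow> bool" where
  "seminorm_Cauchy V p z \<longleftrightarrow>
     range z \<subseteq> V \<and> (\<forall>e>0. \<exists>M. \<forall>i\<ge>M. \<forall>j\<ge>M. p (z i - z j) < e)"

definition completion_norm :: "('a::real_vector \<Rightarrow> real) \<Rightarrow> (nat \<Rightarrow> 'a) \<Rightarrow> real" where
  "completion_norm p z = lim (\<lambda>m. p (z m))"

text \<open>
  The canonical map \<open>V\<^sub>q \<rightarrow> V\<^sub>p\<close> (for \<open>p \<le> q\<close>) is nuclear: it is \<open>\<Sum>n. \<lambda>\<^sub>n l\<^sub>n(\<cdot>) y\<^sub>n\<close> with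
  \<open>(\<lambda>\<^sub>n)\<close> absolutely summable, \<open>l\<^sub>n\<close> in the unit ball of the dual of \<open>V\<^sub>q\<close> and \<open>y\<^sub>n\<close> in the
  unit ball of \<open>V\<^sub>p\<close>. Functionals on \<open>V\<^sub>q\<close> are the \<open>q\<close>-bounded ones on \<open>V\<close>, and since both
  sides are continuous it suffices to state the identity on the dense image of \<open>V\<close>.
\<close>

definition nuclear_canonical_map ::
    "'a::real_vector set \<Rightarrow> ('a \<Rightarrow> real) \<Rightarrow> ('a \<Rightarrow> real) \<Rightarrow> bool" where
  "nuclear_canonical_map V q p \<longleftrightarrow>
     (\<exists>(c :: nat \<Rightarrow> real) l y.
        summable (\<lambda>n. \<bar>c n\<bar>) \<and>
        (\<forall>n. linear_functional_on V (l n) \<and> (\<forall>x\<in>V. \<bar>l n x\<bar> \<le> q x)) \<and>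
        (\<forall>n. seminorm_Cauchy V p (y n) \<and> completion_norm p (y n) \<le> 1) \<and>
        (\<forall>x\<in>V. (\<lambda>N. completion_norm p (\<lambda>m. x - (\<Sum>n<N. (c n * l n x) *\<^sub>R y n m)))
                  \<longlonglongrightarrow> 0))"

definition nuclear_space :: "'a::real_vector topology \<Rightarrow> bool" where
  "nuclear_space T \<longleftrightarrow>
     hausdorff_lcs T \<and>
     (\<forall>p. continuous_seminorm T p \<longrightarrow>
        (\<exists>q. continuous_seminorm T q \<and> (\<forall>x\<in>topspace T. p x \<le> q x) \<and>
             nuclear_canonical_map (topspace T) q p))"

definition has_dir_deriv ::
    "'b::real_vector topology \<Rightarrow> ('a::real_vector \<Rightarrow> 'b) \<Rightarrow> 'a \<Rightarrow> 'a \<Rightarrow> 'b \<Rightarrow> bool" where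
  "has_dir_deriv T2 f y x L \<longleftrightarrow>
     limitin T2 (\<lambda>t::real. (1 / t) *\<^sub>R (f (x + t *\<^sub>R y) - f x)) L (at 0)"

definition dir_deriv ::
    "'b::real_vector topology \<Rightarrow> ('a::real_vector \<Rightarrow> 'b) \<Rightarrow> 'a \<Rightarrow> 'a \<Rightarrow> 'b" where
  "dir_deriv T2 f y x = (THE L. has_dir_deriv T2 f y x L)"

primrec iter_deriv ::
    "'b::real_vector topology \<Rightarrow> ('a::real_vector \<Rightarrow> 'b) \<Rightarrow> 'a list \<Rightarrow> 'a \<Rightarrow> 'b" where
  "iter_deriv T2 f [] = f"
| "iter_deriv T2 f (y # ys) = dir_deriv T2 (iter_deriv T2 f ys) y"

text \<open>
  Meant for \<open>U\<close> open in \<open>T1\<close>; then values of \<open>f\<close> outside \<open>U\<close> are irrelevant. The arguments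
  \<open>y\<^sub>1, \<dots>, y\<^sub>k\<close> of \<open>d\<^sup>kf\<close> are indexed by \<open>{..<k}\<close>.
\<close>

definition Cr_map ::
    "enat \<Rightarrow> 'a::real_vector topology \<Rightarrow> 'a set \<Rightarrow> 'b::real_vector topology \<Rightarrow> ('a \<Rightarrow> 'b) \<Rightarrow> bool"
  where
  "Cr_map r T1 U T2 f \<longleftrightarrow>
     continuous_map (subtopology T1 U) T2 f \<and>
     (\<forall>k::nat. 1 \<le> k \<and> enat k \<le> r \<longrightarrow>
        (\<forall>x\<in>U. \<forall>y\<in>topspace T1. \<forall>ys. set ys \<subseteq> topspace T1 \<and> Suc (length ys) = k \<longrightarrow>
           (\<exists>L. has_dir_deriv T2 (iter_deriv T2 f ys) y x L)) \<and>
        continuous_map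
          (prod_topology (subtopology T1 U) (product_topology (\<lambda>_. T1) {..<k})) T2
          (\<lambda>(x, y). iter_deriv T2 f (map y [0..<k]) x))"

definition smoothly_regular :: "'a::real_vector topology \<Rightarrow> bool" where
  "smoothly_regular T \<longleftrightarrow>
     hausdorff_lcs T \<and>
     (\<forall>U. U \<subseteq> topspace T \<and> (\<exists>W. openin T W \<and> 0 \<in> W \<and> W \<subseteq> U) \<longrightarrow>
        (\<exists>f :: 'a \<Rightarrow> real. Cr_map \<infinity> T (topspace T) euclideanreal f \<and> f 0 = 1 \<and>
           (\<forall>x\<in>topspace T - U. f x = 0)))"

text \<open>
  A manifold is given by an atlas, not necessarily a maximal one; passing to the maximal
  atlas does not change the morphisms. Each manifold has one model space.
\<close>

record ('m, 'f) mfd =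
  mfd_top :: "'m topology"
  mfd_model :: "'f topology"
  mfd_atlas :: "('m set \<times> ('m \<Rightarrow> 'f)) set"

definition chart :: "'m topology \<Rightarrow> 'f topology \<Rightarrow> 'm set \<Rightarrow> ('m \<Rightarrow> 'f) \<Rightarrow> bool" where
  "chart X F U \<phi> \<longleftrightarrow>
     openin X U \<and> openin F (\<phi> ` U) \<and>
     homeomorphic_map (subtopology X U) (subtopology F (\<phi> ` U)) \<phi>"

definition Cr_manifold :: "enat \<Rightarrow> ('m, 'f::real_vector) mfd \<Rightarrow> bool" where
  "Cr_manifold r M \<longleftrightarrow>
     Hausdorff_space (mfd_top M) \<and> hausdorff_lcs (mfd_model M) \<and>
     (\<forall>(U, \<phi>)\<in>mfd_atlas M. chart (mfd_top M) (mfd_model M) U \<phi>) \<and>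
     (\<Union>(U, \<phi>)\<in>mfd_atlas M. U) = topspace (mfd_top M) \<and>
     (\<forall>(U, \<phi>)\<in>mfd_atlas M. \<forall>(V, \<psi>)\<in>mfd_atlas M.
        Cr_map r (mfd_model M) (\<phi> ` (U \<inter> V)) (mfd_model M) (\<psi> \<circ> inv_into U \<phi>))"

definition Cr_mfd_map ::
    "enat \<Rightarrow> ('m, 'f::real_vector) mfd \<Rightarrow> ('n, 'g::real_vector) mfd \<Rightarrow> ('m \<Rightarrow> 'n) \<Rightarrow> bool" where
  "Cr_mfd_map r M N f \<longleftrightarrow>
     continuous_map (mfd_top M) (mfd_top N) f \<and>
     (\<forall>(U, \<phi>)\<in>mfd_atlas M. \<forall>(V, \<psi>)\<in>mfd_atlas N.
        Cr_map r (mfd_model M) (\<phi> ` (U \<inter> f -` V)) (mfd_model N) (\<psi> \<circ> f \<circ> inv_into U \<phi>))"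

definition mfd_of_lcs :: "'a topology \<Rightarrow> ('a, 'a) mfd" where
  "mfd_of_lcs T = \<lparr>mfd_top = T, mfd_model = T, mfd_atlas = {(topspace T, \<lambda>x. x)}\<rparr>"

text \<open>
  Direct limit cones given by inclusion maps, in a concrete category with objects \<open>obj\<close>,
  underlying sets \<open>carrier\<close> and morphisms \<open>mor\<close>. The \<open>X n\<close> and \<open>L\<close> are meant to be objects.
  HOL cannot quantify over types inside a formula, so the test objects \<open>Y\<close> have their points
  (and, for manifolds, their model space) in the same type as \<open>L\<close>. Hence the negation of
  this property provides a counterexample \<open>Y\<close> of a particular kind, and in
  particular implies that \<open>L\<close> is not a direct limit in the category of all such objects.
\<close>

definition direct_limit_cone ::
    "('o \<Rightarrow> bool) \<Rightarrow> ('o \<Rightarrow> 'a set) \<Rightarrow> ('o \<Rightarrow> 'o \<Rightarrow> ('a \<Rightarrow> 'a) \<Rightarrow> bool) \<Rightarrow> (nat \<Rightarrow> 'o) \<Rightarrow> 'o \<Rightarrow> bool"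
  where
  "direct_limit_cone obj carrier mor X L \<longleftrightarrow>
     (\<forall>n. mor (X n) L (\<lambda>x. x)) \<and>
     (\<forall>Y f. obj Y \<and> (\<forall>n. mor (X n) Y (f n)) \<and>
            (\<forall>n. \<forall>x\<in>carrier (X n). f (Suc n) x = f n x) \<longrightarrow>
        (\<exists>g. mor L Y g \<and> (\<forall>n. \<forall>x\<in>carrier (X n). g x = f n x) \<and>
             (\<forall>h. mor L Y h \<and> (\<forall>n. \<forall>x\<in>carrier (X n). h x = f n x) \<longrightarrow>
                  (\<forall>x\<in>carrier L. h x = g x))))"

definition top_direct_limit :: "(nat \<Rightarrow> 'a topology) \<Rightarrow> 'a topology \<Rightarrow> bool" where
  "top_direct_limit = direct_limit_cone (\<lambda>_. True) topspace continuous_map"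

definition mfd_direct_limit ::
    "enat \<Rightarrow> (nat \<Rightarrow> ('a, 'a::real_vector) mfd) \<Rightarrow> ('a, 'a) mfd \<Rightarrow> bool" where
  "mfd_direct_limit r =
     direct_limit_cone (Cr_manifold r) (\<lambda>M. topspace (mfd_top M)) (Cr_mfd_map r)"

end

theory Submission
  imports Defs
begin

text \<open>
  Write \<open>E\<^sub>n\<close> for the \<open>n\<close>th step and \<open>E\<close> for the union with the locally convex direct limit
  topology. In both parts the point is that a \<open>0\<close>-neighbourhood of \<open>E\<close> contains sums \<open>u + v\<close> in which
  \<open>u \<in> E\<^sub>0\<close> is taken from a neighbourhood fixed in advance, while \<open>v\<close> is a small multiple of a vector
  far out in the sequence, and that neighbourhoods in infinite-dimensional spaces are large.

  Part (a). A \<open>0\<close>-neighbourhood of an infinite-dimensional Hausdorff space contains a sequence which is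
  uniformly discrete for some continuous seminorm (lemma \<open>separated_sequence_in_neighbourhood\<close>): multiples of
  a vector killed by the gauge, or a Riesz sequence. Choose such sequences \<open>(u\<^sub>j\<^sub>k)\<^sub>k\<close> in the members \<open>U\<^sub>j\<close>
  of a countable neighbourhood base of \<open>E\<^sub>0\<close>, and \<open>v\<^sub>j \<in> E\<^sub>j\<^sub>+\<^sub>1 - E\<^sub>j\<close>. The set of all
  \<open>u\<^sub>j\<^sub>k + v\<^sub>j/(k+1)\<close> meets each \<open>E\<^sub>n\<close> in finitely many closed discrete sequences, so it is closed in the
  topological direct limit, but \<open>0\<close> is in its closure in \<open>E\<close>.

  Part (b). On a nuclear space every continuous seminorm is dominated by a Hilbertian one, that is, one that
  satisfies the parallelogram law. Infima over decompositions \<open>x = \<Sum>x\<^sub>i\<close> with \<open>x\<^sub>i \<in> E\<^sub>i\<close> of \<open>\<ell>\<^sup>2\<close>-sums of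
  such seminorms are again Hilbertian, so \<open>E\<close> has as many continuous Hilbertian seminorms as one could wish
  (lemmas \<open>hilbertian_seminorm_dominating\<close>, \<open>hilbertian_seminorm_above\<close> and
  \<open>hilbertian_seminorm_vanishing\<close>). The square of a Hilbertian seminorm \<open>q\<close> is \<open>x \<mapsto> b(x, x)\<close> for a continuous
  symmetric bilinear form \<open>b\<close>, hence smooth. Composing \<open>q\<^sup>2\<close> with a smooth bump function on the line gives
  smooth regularity.

  For the failure of the direct limit property, choose Hilbertian seminorms \<open>r\<^sub>j\<close> on \<open>E\<close> which are unbounded on
  \<open>U\<^sub>j\<close> (an infinite-dimensional nuclear space has no bounded \<open>0\<close>-neighbourhood, lemma
  \<open>nuclear_unbounded_seminorm\<close>) and \<open>q\<^sub>j\<close> which vanish on \<open>E\<^sub>j\<close> but not on \<open>E\<^sub>j\<^sub>+\<^sub>1\<close> (as \<open>E\<^sub>j\<close> is complete,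
  it is closed in \<open>E\<^sub>j\<^sub>+\<^sub>1\<close>). The function \<open>f = \<Sum>\<^sub>j r\<^sub>j\<^sup>2 q\<^sub>j\<^sup>2\<close> is a finite sum on each \<open>E\<^sub>n\<close>, so it is a
  continuous polynomial of degree four there. It is unbounded on every \<open>0\<close>-neighbourhood of \<open>E\<close>: given a small
  multiple \<open>v\<close> of a vector with \<open>q\<^sub>j(v) > 0\<close>, the factor \<open>r\<^sub>j(u + v)\<close> can be made as large as one likes by the
  choice of \<open>u \<in> U\<^sub>j\<close>. The maps \<open>x \<mapsto> f(x) v\<close> from \<open>E\<^sub>n\<close> to \<open>E\<close>, for a fixed vector \<open>v \<noteq> 0\<close>, are therefore
  compatible and smooth, but their union is not even continuous.
\<close>

section \<open>Seminorms and locally convex spaces\<close>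

definition seminorm_on :: "'a::real_vector set \<Rightarrow> ('a \<Rightarrow> real) \<Rightarrow> bool" where
  "seminorm_on X p \<longleftrightarrow> subspace X \<and>
     (\<forall>x\<in>X. \<forall>y\<in>X. p (x + y) \<le> p x + p y) \<and> (\<forall>c. \<forall>x\<in>X. p (c *\<^sub>R x) = \<bar>c\<bar> * p x)"

lemma seminorm_onI:
  assumes "subspace X" "\<And>x y. x \<in> X \<Longrightarrow> y \<in> X \<Longrightarrow> p (x + y) \<le> p x + p y"
    "\<And>c x. x \<in> X \<Longrightarrow> p (c *\<^sub>R x) = \<bar>c\<bar> * p x"
  shows "seminorm_on X p"
  using assms unfolding seminorm_on_def by blast

lemma seminorm_onD:
  assumes "seminorm_on X p"
  shows "subspace X" "\<And>x y. x \<in> X \<Longrightarrow> y \<in> X \<Longrightarrow> p (x + y) \<le> p x + p y"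
    "\<And>c x. x \<in> X \<Longrightarrow> p (c *\<^sub>R x) = \<bar>c\<bar> * p x"
  using assms unfolding seminorm_on_def by blast+

lemma seminorm_on_zero: "seminorm_on X p \<Longrightarrow> p 0 = 0"
  using seminorm_onD(1,3)[of X p] subspace_0[of X] by (metis abs_zero mult_zero_left scaleR_zero_left)

lemma seminorm_on_minus: "seminorm_on X p \<Longrightarrow> x \<in> X \<Longrightarrow> p (- x) = p x"
  using seminorm_onD(3)[of X p x "-1"] by simp

lemma seminorm_on_nonneg:
  assumes "seminorm_on X p" "x \<in> X" shows "0 \<le> p x"
proof -
  have "- x \<in> X" using assms seminorm_onD(1) subspace_neg by blast
  then have "p (x + - x) \<le> p x + p (- x)" using assms seminorm_onD(2) by blast
  then show ?thesis using seminorm_on_zero[OF assms(1)] seminorm_on_minus[OF assms] by simp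
qed

lemma seminorm_on_triangle_minus:
  assumes "seminorm_on X p" "x \<in> X" "y \<in> X"
  shows "p (x - y) \<le> p x + p y" "p x - p y \<le> p (x - y)" "p (x - y) = p (y - x)"
    "p x - p y \<le> p (x + y)"
proof -
  have m: "- y \<in> X" "x - y \<in> X" "x + y \<in> X" using assms seminorm_onD(1)[OF assms(1)]
    by (auto intro: subspace_neg subspace_diff subspace_add)
  show "p (x - y) \<le> p x + p y"
    using seminorm_onD(2)[OF assms(1,2) m(1)] seminorm_on_minus[OF assms(1,3)] by simp
  show "p x - p y \<le> p (x - y)" using seminorm_onD(2)[OF assms(1) m(2) assms(3)] by simp
  show "p (x - y) = p (y - x)" using seminorm_on_minus[OF assms(1) m(2)] by simp
  show "p x - p y \<le> p (x + y)"
    using seminorm_onD(2)[OF assms(1) m(3) m(1)] seminorm_on_minus[OF assms(1,3)] by simp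
qed

lemma seminorm_on_sum:
  assumes "seminorm_on X p" "\<And>i. i \<in> I \<Longrightarrow> f i \<in> X"
  shows "p (sum f I) \<le> (\<Sum>i\<in>I. p (f i))"
  using assms(2)
proof (induction I rule: infinite_finite_induct)
  case (insert i I)
  have "sum f I \<in> X" using insert assms(1) seminorm_onD(1) by (metis insertCI subspace_sum)
  then show ?case using insert seminorm_onD(2)[OF assms(1), of "f i" "sum f I"] by force
qed (use seminorm_on_zero[OF assms(1)] in auto)

lemma seminorm_on_subset: "seminorm_on X p \<Longrightarrow> subspace Y \<Longrightarrow> Y \<subseteq> X \<Longrightarrow> seminorm_on Y p"
  unfolding seminorm_on_def by blast

text \<open>Normalising \<open>x\<close> by any \<open>s > p x\<close>, instead of by \<open>p x\<close>, also covers the vectors with \<open>p x = 0\<close>.\<close>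

lemma seminorm_le_by_scaling:
  assumes p: "seminorm_on X p" and q: "seminorm_on X q"
    and le: "\<And>x. x \<in> X \<Longrightarrow> p x < 1 \<Longrightarrow> q x \<le> C" and x: "x \<in> X"
  shows "q x \<le> C * p x"
proof -
  have C: "0 \<le> C" using le[of 0] seminorm_on_zero[OF p] seminorm_on_zero[OF q]
      subspace_0[OF seminorm_onD(1)[OF p]] by simp
  have 1: "q x \<le> C * s" if "p x < s" for s
  proof -
    have s: "0 < s" using that seminorm_on_nonneg[OF p x] by linarith
    have "p ((1/s) *\<^sub>R x) < 1" using seminorm_onD(3)[OF p x] s that by (simp add: field_simps)
    then have "q ((1/s) *\<^sub>R x) \<le> C"
      using le subspace_scale[OF seminorm_onD(1)[OF p] x] by blast
    then show ?thesis using seminorm_onD(3)[OF q x] s by (simp add: field_simps)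
  qed
  have "((\<lambda>s. C * s) \<longlongrightarrow> C * p x) (at_right (p x))" by (intro tendsto_intros)
  moreover have "eventually (\<lambda>s. q x \<le> C * s) (at_right (p x))"
    unfolding eventually_at_right_field using 1 by (metis less_add_one)
  ultimately show ?thesis by (rule tendsto_lowerbound) simp
qed

lemma continuous_seminorm_iff:
  "subspace (topspace T) \<Longrightarrow>
   continuous_seminorm T p \<longleftrightarrow> seminorm_on (topspace T) p \<and> continuous_map T euclideanreal p"
  unfolding continuous_seminorm_def seminorm_on_def by blast

lemma lc_spaceD:
  assumes "lc_space T"
  shows "subspace (topspace T)"
    "continuous_map (prod_topology T T) T (\<lambda>(x, y). x + y)"
    "continuous_map (prod_topology euclideanreal T) T (\<lambda>(c, x). c *\<^sub>R x)"
    "\<And>U. openin T U \<Longrightarrow> 0 \<in> U \<Longrightarrow> \<exists>V. openin T V \<and> 0 \<in> V \<and> convex V \<and> V \<subseteq> U"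
  using assms unfolding lc_space_def by blast+

lemma continuous_seminormD:
  assumes "lc_space T" "continuous_seminorm T p"
  shows "seminorm_on (topspace T) p" "continuous_map T euclideanreal p"
  using assms lc_spaceD(1) continuous_seminorm_iff by blast+

lemma lc_add_continuous:
  assumes "lc_space T" "continuous_map Z T f" "continuous_map Z T g"
  shows "continuous_map Z T (\<lambda>z. f z + g z)"
proof -
  have "continuous_map Z (prod_topology T T) (\<lambda>z. (f z, g z))"
    using assms by (simp add: continuous_map_pairedI)
  from continuous_map_compose[OF this lc_spaceD(2)[OF assms(1)]] show ?thesis by (simp add: o_def)
qed

lemma lc_scaleR_continuous:
  assumes "lc_space T" "continuous_map Z euclideanreal f" "continuous_map Z T g"
  shows "continuous_map Z T (\<lambda>z. f z *\<^sub>R g z)"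
proof -
  have "continuous_map Z (prod_topology euclideanreal T) (\<lambda>z. (f z, g z))"
    using assms by (simp add: continuous_map_pairedI)
  from continuous_map_compose[OF this lc_spaceD(3)[OF assms(1)]] show ?thesis by (simp add: o_def)
qed

lemma lc_affine_continuous:
  assumes "lc_space T" "x \<in> topspace T"
  shows "continuous_map T T (\<lambda>y. c *\<^sub>R (y - x))"
proof -
  have "- x \<in> topspace T" using assms lc_spaceD(1) subspace_neg by blast
  then have "continuous_map T T (\<lambda>y. c *\<^sub>R (y + - x))"
    using assms(1) by (intro lc_scaleR_continuous lc_add_continuous) auto
  then show ?thesis by simp
qed

text \<open>By homogeneity a seminorm which is bounded near \<open>0\<close> is small near \<open>0\<close>, and the triangle inequality carries
  this to all other points.\<close>

lemma seminorm_continuousI: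
  assumes T: "lc_space T" and p: "seminorm_on (topspace T) p"
    and O: "openin T N" "0 \<in> N" "\<And>x. x \<in> N \<Longrightarrow> p x \<le> C"
  shows "continuous_seminorm T p"
proof -
  have "continuous_map T euclideanreal p"
    unfolding continuous_map_def
  proof (intro conjI allI impI)
    fix V :: "real set" assume V: "openin euclideanreal V"
    show "openin T {x \<in> topspace T. p x \<in> V}"
    proof (subst openin_subopen, intro ballI)
      fix x assume x: "x \<in> {x \<in> topspace T. p x \<in> V}"
      then have xT: "x \<in> topspace T" by blast
      have C: "0 \<le> C" using O seminorm_on_zero[OF p] by force
      obtain e where e: "e > 0" "ball (p x) e \<subseteq> V" using x V open_contains_ball by force
      define d where "d = (C + 1) / e"
      have d: "d > 0" using e C d_def by simp
      let ?W = "{y \<in> topspace T. d *\<^sub>R (y - x) \<in> N}"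
      have "openin T ?W" by (rule openin_continuous_map_preimage[OF lc_affine_continuous[OF T xT] O(1)])
      moreover have "x \<in> ?W" using xT O by simp
      moreover have "?W \<subseteq> {x \<in> topspace T. p x \<in> V}"
      proof clarify
        fix y assume y: "y \<in> topspace T" "d *\<^sub>R (y - x) \<in> N"
        have yx: "y - x \<in> topspace T" using y xT lc_spaceD(1)[OF T] subspace_diff by blast
        have "d * p (y - x) \<le> C" using O(3)[OF y(2)] seminorm_onD(3)[OF p yx, of d] d by simp
        then have "(C + 1) * p (y - x) \<le> C * e" unfolding d_def using e by (simp add: field_simps)
        also have "\<dots> < (C + 1) * e" using e by simp
        finally have "p (y - x) < e" using C by simp
        then have "\<bar>p x - p y\<bar> < e"
          using seminorm_on_triangle_minus(2,3)[OF p y(1) xT] seminorm_on_triangle_minus(2)[OF p xT y(1)]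
          by linarith
        then show "p y \<in> V" using e(2) by (auto simp: dist_real_def)
      qed
      ultimately show "\<exists>W. openin T W \<and> x \<in> W \<and> W \<subseteq> {x \<in> topspace T. p x \<in> V}" by blast
    qed
  qed auto
  then show ?thesis using p continuous_seminorm_iff[OF lc_spaceD(1)[OF T]] by blast
qed

lemma open_seminorm_ball:
  assumes "lc_space T" "continuous_seminorm T p" "x \<in> topspace T"
  shows "openin T {y \<in> topspace T. p (y - x) < e}"
proof -
  have "continuous_map T euclideanreal (\<lambda>y. p (1 *\<^sub>R (y - x)))"
    using continuous_map_compose[OF lc_affine_continuous[OF assms(1,3), of 1]]
      continuous_seminormD(2)[OF assms(1,2)] by (simp add: o_def)
  then have "openin T {y \<in> topspace T. p (1 *\<^sub>R (y - x)) \<in> {..<e}}"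
    by (rule openin_continuous_map_preimage) auto
  then show ?thesis by simp
qed

lemma open_seminorm_ball_0:
  assumes "lc_space T" "continuous_seminorm T p"
  shows "openin T {y \<in> topspace T. p y < e}"
  using open_seminorm_ball[OF assms subspace_0[OF lc_spaceD(1)[OF assms(1)]]] by simp

lemma dominated_seminorm_continuous:
  assumes "lc_space T" "continuous_seminorm T q" "seminorm_on (topspace T) p"
    "\<And>x. x \<in> topspace T \<Longrightarrow> p x \<le> C * q x"
  shows "continuous_seminorm T p"
proof (rule seminorm_continuousI)
  show "openin T {y \<in> topspace T. q y < 1}" by (rule open_seminorm_ball_0) fact+
  show "0 \<in> {y \<in> topspace T. q y < 1}"
    using seminorm_on_zero[OF continuous_seminormD(1)[OF assms(1,2)]]
      subspace_0[OF lc_spaceD(1)[OF assms(1)]] by simp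
  show "p x \<le> \<bar>C\<bar>" if "x \<in> {y \<in> topspace T. q y < 1}" for x
  proof -
    have "0 \<le> q x" "q x < 1" using that seminorm_on_nonneg continuous_seminormD(1)[OF assms(1,2)] by auto
    then have "C * q x \<le> \<bar>C\<bar> * 1" by (intro mult_mono) auto
    then show ?thesis using assms(4)[of x] that by simp
  qed
qed fact+

lemma continuous_seminorm_scale:
  assumes "lc_space T" "continuous_seminorm T r" "0 \<le> c"
  shows "continuous_seminorm T (\<lambda>x. c * r x)"
proof (rule dominated_seminorm_continuous[OF assms(1,2)])
  show "seminorm_on (topspace T) (\<lambda>x. c * r x)"
    using continuous_seminormD(1)[OF assms(1,2)] assms(3) unfolding seminorm_on_def
    by (auto simp: distrib_left[symmetric] mult_left_mono)
qed auto

text \<open>The Minkowski functional of a convex open neighbourhood \<open>V\<close>, made symmetric by intersecting with \<open>-V\<close>. By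
  this lemma all neighbourhood arguments below reduce to inequalities between seminorms.\<close>

lemma gauge_seminorm:
  assumes T: "lc_space T" and U: "openin T U" "0 \<in> U"
  obtains p where "continuous_seminorm T p" "\<And>x. x \<in> topspace T \<Longrightarrow> p x < 1 \<Longrightarrow> x \<in> U"
proof -
  let ?X = "topspace T"
  have X: "subspace ?X" by (rule lc_spaceD(1)[OF T])
  obtain V where V: "openin T V" "0 \<in> V" "convex V" "V \<subseteq> U" using lc_spaceD(4)[OF T U] by blast
  define W where "W = {x \<in> ?X. x \<in> V \<and> - x \<in> V}"
  have "openin T {x \<in> ?X. (-1) *\<^sub>R (x - 0) \<in> V}"
    by (rule openin_continuous_map_preimage[OF lc_affine_continuous[OF T] V(1)])
       (rule subspace_0[OF X])
  then have "openin T (V \<inter> {x \<in> ?X. (-1) *\<^sub>R (x - 0) \<in> V})" using V(1) by blast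
  moreover have "W = V \<inter> {x \<in> ?X. (-1) *\<^sub>R (x - 0) \<in> V}" by (auto simp: W_def)
  ultimately have Wo: "openin T W" by simp
  have W0: "0 \<in> W" using V subspace_0[OF X] by (simp add: W_def)
  have Wneg: "- x \<in> W" if "x \<in> W" for x using that X by (auto simp: W_def subspace_neg)
  have Wc: "a *\<^sub>R x + b *\<^sub>R y \<in> W" if "x \<in> W" "y \<in> W" "a \<ge> 0" "b \<ge> 0" "a + b = 1" for a b x y
  proof -
    have "a *\<^sub>R x + b *\<^sub>R y \<in> V" "a *\<^sub>R (- x) + b *\<^sub>R (- y) \<in> V"
      using that V(3) unfolding W_def convex_def by blast+
    moreover have "a *\<^sub>R x + b *\<^sub>R y \<in> ?X" using that X by (simp add: W_def subspace_add subspace_scale)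
    ultimately show ?thesis by (simp add: W_def)
  qed
  define A where "A = (\<lambda>x. {t. 0 < t \<and> (1/t) *\<^sub>R x \<in> W})"
  define p where "p = (\<lambda>x. Inf (A x))"
  have ne: "A x \<noteq> {}" if x: "x \<in> ?X" for x
  proof -
    have "continuous_map euclideanreal T (\<lambda>c. c *\<^sub>R x)"
      using x by (intro lc_scaleR_continuous[OF T]) auto
    then have "open {c. c *\<^sub>R x \<in> W}" using openin_continuous_map_preimage[OF _ Wo] by fastforce
    moreover have "0 \<in> {c. c *\<^sub>R x \<in> W}" using W0 by simp
    ultimately obtain e where e: "e > 0" "ball 0 e \<subseteq> {c. c *\<^sub>R x \<in> W}"
      using open_contains_ball by blast
    have "e/2 \<in> ball 0 e" using e by simp
    then have "(e/2) *\<^sub>R x \<in> W" using e(2) by blast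
    then have "2/e \<in> A x" using e(1) by (simp add: A_def)
    then show ?thesis by blast
  qed
  have bdd: "bdd_below (A x)" for x by (rule bdd_belowI[of _ 0]) (simp add: A_def)
  have le: "p x \<le> t" if "t \<in> A x" for x t unfolding p_def by (rule cInf_lower[OF that bdd])
  have less: "s \<in> A x" if xs: "x \<in> ?X" "p x < s" for x s
  proof -
    obtain t where t: "t \<in> A x" "t < s" using cInf_lessD[OF ne[OF xs(1)]] xs(2) p_def by blast
    then have "(t/s) *\<^sub>R ((1/t) *\<^sub>R x) + (1 - t/s) *\<^sub>R 0 \<in> W"
      by (intro Wc W0) (auto simp: A_def field_simps)
    then show ?thesis using t by (simp add: A_def)
  qed
  have nonneg: "0 \<le> p x" if "x \<in> ?X" for x
    unfolding p_def by (rule cInf_greatest[OF ne[OF that]]) (simp add: A_def)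
  have tri: "p (x + y) \<le> p x + p y" if x: "x \<in> ?X" and y: "y \<in> ?X" for x y
  proof (rule field_le_epsilon)
    fix e :: real assume e: "0 < e"
    define s t where "s = p x + e/2" and "t = p y + e/2"
    have st: "s \<in> A x" "t \<in> A y" using less x y e by (auto simp: s_def t_def)
    then have "(s/(s+t)) *\<^sub>R ((1/s) *\<^sub>R x) + (t/(s+t)) *\<^sub>R ((1/t) *\<^sub>R y) \<in> W"
      by (intro Wc) (auto simp: A_def add_divide_distrib[symmetric])
    then have "s + t \<in> A (x + y)" using st by (simp add: A_def scaleR_add_right)
    from le[OF this] show "p (x + y) \<le> p x + p y + e" by (simp add: s_def t_def)
  qed
  have Asc: "\<bar>c\<bar> * t \<in> A (c *\<^sub>R x)" if "t \<in> A x" "c \<noteq> 0" for c t x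
  proof (cases "c > 0")
    case False
    then have "(1 / (\<bar>c\<bar> * t)) *\<^sub>R (c *\<^sub>R x) = - ((1/t) *\<^sub>R x)" using that by (simp add: A_def)
    then show ?thesis using that Wneg by (simp add: A_def)
  qed (use that in \<open>simp add: A_def\<close>)
  have hle: "p (c *\<^sub>R x) \<le> \<bar>c\<bar> * p x" if "x \<in> ?X" "c \<noteq> 0" for c x
  proof (rule field_le_epsilon)
    fix e :: real assume e: "0 < e"
    have "p x + e/\<bar>c\<bar> \<in> A x" using less e that by simp
    from le[OF Asc[OF this that(2)]] show "p (c *\<^sub>R x) \<le> \<bar>c\<bar> * p x + e"
      using that(2) by (simp add: distrib_left)
  qed
  have hom: "p (c *\<^sub>R x) = \<bar>c\<bar> * p x" if x: "x \<in> ?X" for c x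
  proof (cases "c = 0")
    case True
    have "p 0 \<le> e" if "0 < e" for e using le[of e 0] W0 that by (simp add: A_def)
    then have "p 0 \<le> 0" by (meson dense_ge)
    then show ?thesis using nonneg[OF subspace_0[OF X]] True by simp
  next
    case False
    have "p ((1/c) *\<^sub>R (c *\<^sub>R x)) \<le> \<bar>1/c\<bar> * p (c *\<^sub>R x)"
      using False x X subspace_scale by (intro hle) auto
    then have "\<bar>c\<bar> * p x \<le> p (c *\<^sub>R x)" using False by (simp add: field_simps)
    then show ?thesis using hle[OF x False] by linarith
  qed
  have sp: "seminorm_on ?X p" by (rule seminorm_onI[OF X tri hom])
  show ?thesis
  proof
    show "continuous_seminorm T p"
      by (rule seminorm_continuousI[OF T sp Wo W0, of 1]) (rule le, simp add: A_def)
    show "x \<in> U" if "x \<in> ?X" "p x < 1" for x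
      using less[OF that] V(4) by (auto simp: A_def W_def)
  qed
qed

text \<open>The topology of a single seminorm. It need not be Hausdorff; it serves as a competitor of the direct
  limit topology.\<close>

definition seminorm_topology :: "'a::real_vector set \<Rightarrow> ('a \<Rightarrow> real) \<Rightarrow> 'a topology" where
  "seminorm_topology X q = topology (\<lambda>U. U \<subseteq> X \<and>
     (\<forall>x\<in>U. \<exists>e>0. \<forall>y\<in>X. q (y - x) < e \<longrightarrow> y \<in> U))"

lemma openin_seminorm_topology:
  "openin (seminorm_topology X q) U \<longleftrightarrow>
     U \<subseteq> X \<and> (\<forall>x\<in>U. \<exists>e>0. \<forall>y\<in>X. q (y - x) < e \<longrightarrow> y \<in> U)"
proof -
  have "istopology (\<lambda>U. U \<subseteq> X \<and> (\<forall>x\<in>U. \<exists>e>0. \<forall>y\<in>X. q (y - x) < e \<longrightarrow> y \<in> U))"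
    unfolding istopology_def
  proof (intro conjI allI impI)
    fix U V assume U: "U \<subseteq> X \<and> (\<forall>x\<in>U. \<exists>e>0. \<forall>y\<in>X. q (y - x) < e \<longrightarrow> y \<in> U)"
      and V: "V \<subseteq> X \<and> (\<forall>x\<in>V. \<exists>e>0. \<forall>y\<in>X. q (y - x) < e \<longrightarrow> y \<in> V)"
    show "U \<inter> V \<subseteq> X" using U by blast
    show "\<forall>x\<in>U \<inter> V. \<exists>e>0. \<forall>y\<in>X. q (y - x) < e \<longrightarrow> y \<in> U \<inter> V"
    proof
      fix x assume x: "x \<in> U \<inter> V"
      obtain d where "d > 0" "\<forall>y\<in>X. q (y - x) < d \<longrightarrow> y \<in> U" using x U by blast
      moreover obtain e where "e > 0" "\<forall>y\<in>X. q (y - x) < e \<longrightarrow> y \<in> V" using x V by blast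
      ultimately have "min d e > 0 \<and> (\<forall>y\<in>X. q (y - x) < min d e \<longrightarrow> y \<in> U \<inter> V)" by simp
      then show "\<exists>e>0. \<forall>y\<in>X. q (y - x) < e \<longrightarrow> y \<in> U \<inter> V" by blast
    qed
  next
    fix K assume K: "\<forall>U\<in>K. U \<subseteq> X \<and> (\<forall>x\<in>U. \<exists>e>0. \<forall>y\<in>X. q (y - x) < e \<longrightarrow> y \<in> U)"
    then show "\<Union> K \<subseteq> X" by blast
    show "\<forall>x\<in>\<Union> K. \<exists>e>0. \<forall>y\<in>X. q (y - x) < e \<longrightarrow> y \<in> \<Union> K"
    proof
      fix x assume "x \<in> \<Union> K"
      then obtain U where U: "U \<in> K" "x \<in> U" by blast
      then obtain e where "e > 0" "\<forall>y\<in>X. q (y - x) < e \<longrightarrow> y \<in> U" using K by blast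
      then show "\<exists>e>0. \<forall>y\<in>X. q (y - x) < e \<longrightarrow> y \<in> \<Union> K" using U(1) by blast
    qed
  qed
  then show ?thesis by (simp add: seminorm_topology_def)
qed

lemma topspace_seminorm_topology: "topspace (seminorm_topology X q) = X"
proof
  show "topspace (seminorm_topology X q) \<subseteq> X"
    using openin_seminorm_topology[of X q "topspace (seminorm_topology X q)"] by simp
  have "openin (seminorm_topology X q) X"
    unfolding openin_seminorm_topology using zero_less_one by blast
  then show "X \<subseteq> topspace (seminorm_topology X q)" by (rule openin_subset)
qed

lemma openin_seminorm_topology_ball:
  assumes q: "seminorm_on X q" and x: "x \<in> X"
  shows "openin (seminorm_topology X q) {y \<in> X. q (y - x) < e}"
  unfolding openin_seminorm_topology
proof (intro conjI ballI)
  fix y assume "y \<in> {y \<in> X. q (y - x) < e}"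
  then have y: "y \<in> X" "q (y - x) < e" by auto
  have "q (z - x) < e" if z: "z \<in> X" "q (z - y) < e - q (y - x)" for z
  proof -
    have "z - y \<in> X" "y - x \<in> X" using x y z seminorm_onD(1)[OF q] by (auto intro: subspace_diff)
    then have "q ((z - y) + (y - x)) \<le> q (z - y) + q (y - x)" by (rule seminorm_onD(2)[OF q])
    then show ?thesis using z by simp
  qed
  then show "\<exists>d>0. \<forall>z\<in>X. q (z - y) < d \<longrightarrow> z \<in> {y \<in> X. q (y - x) < e}"
    using y by (intro exI[of _ "e - q (y - x)"]) simp
qed auto

lemma lc_space_seminorm_topology:
  assumes q: "seminorm_on X q"
  shows "lc_space (seminorm_topology X q)"
  unfolding lc_space_def topspace_seminorm_topology
proof (intro conjI allI impI)
  let ?T = "seminorm_topology X q"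
  note op = openin_seminorm_topology[of X q]
  note ts = topspace_seminorm_topology[of X q]
  note X = seminorm_onD(1)[OF q]
  note ball = openin_seminorm_topology_ball[OF q]
  have q0: "q 0 = 0" by (rule seminorm_on_zero[OF q])
  show "subspace X" by (rule X)
  show "continuous_map (prod_topology ?T ?T) ?T (\<lambda>(x, y). x + y)"
    unfolding continuous_map_def
  proof (intro conjI allI impI)
    show "(\<lambda>(x, y). x + y) \<in> topspace (prod_topology ?T ?T) \<rightarrow> topspace ?T"
      using X by (auto simp: ts subspace_add)
    fix U assume U: "openin ?T U"
    show "openin (prod_topology ?T ?T) {z \<in> topspace (prod_topology ?T ?T). (case z of (x, y) \<Rightarrow> x + y) \<in> U}"
      unfolding openin_prod_topology_alt
    proof (intro allI impI)
      fix x y assume "(x, y) \<in> {z \<in> topspace (prod_topology ?T ?T). (case z of (x, y) \<Rightarrow> x + y) \<in> U}"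
      then have xy: "x \<in> X" "y \<in> X" "x + y \<in> U" by (auto simp: ts)
      obtain e where e: "e > 0" "\<forall>z\<in>X. q (z - (x + y)) < e \<longrightarrow> z \<in> U" using U xy(3) op by blast
      let ?B = "\<lambda>x. {y \<in> X. q (y - x) < e/2}"
      have "a + b \<in> U" if "a \<in> ?B x" "b \<in> ?B y" for a b
      proof -
        have "a - x \<in> X" "b - y \<in> X" "a + b \<in> X" using that xy X
          by (auto intro: subspace_diff subspace_add)
        moreover from this have "q ((a - x) + (b - y)) \<le> q (a - x) + q (b - y)"
          using seminorm_onD(2)[OF q] by blast
        moreover have "q (a + b - (x + y)) = q ((a - x) + (b - y))" by (simp add: algebra_simps)
        moreover have "q (a - x) < e/2" "q (b - y) < e/2" using that by auto
        ultimately have "q (a + b - (x + y)) < e" by linarith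
        then show ?thesis using e \<open>a + b \<in> X\<close> by blast
      qed
      then show "\<exists>V W. openin ?T V \<and> openin ?T W \<and> x \<in> V \<and> y \<in> W \<and>
          V \<times> W \<subseteq> {z \<in> topspace (prod_topology ?T ?T). (case z of (x, y) \<Rightarrow> x + y) \<in> U}"
        using ball[OF xy(1), of "e/2"] ball[OF xy(2), of "e/2"] xy e(1) q0
        by (intro exI[of _ "?B x"] exI[of _ "?B y"]) (auto simp: ts)
    qed
  qed
  show "continuous_map (prod_topology euclideanreal ?T) ?T (\<lambda>(c, x). c *\<^sub>R x)"
    unfolding continuous_map_def
  proof (intro conjI allI impI)
    show "(\<lambda>(c, x). c *\<^sub>R x) \<in> topspace (prod_topology euclideanreal ?T) \<rightarrow> topspace ?T"
      using X by (auto simp: ts subspace_scale)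
    fix U assume U: "openin ?T U"
    show "openin (prod_topology euclideanreal ?T)
        {z \<in> topspace (prod_topology euclideanreal ?T). (case z of (c, x) \<Rightarrow> c *\<^sub>R x) \<in> U}"
      unfolding openin_prod_topology_alt
    proof (intro allI impI)
      fix c x assume "(c, x) \<in> {z \<in> topspace (prod_topology euclideanreal ?T). (case z of (c, x) \<Rightarrow> c *\<^sub>R x) \<in> U}"
      then have cx: "x \<in> X" "c *\<^sub>R x \<in> U" by (auto simp: ts)
      obtain e where e: "e > 0" "\<forall>z\<in>X. q (z - c *\<^sub>R x) < e \<longrightarrow> z \<in> U" using U cx(2) op by blast
      define r where "r = e / (2 * (q x + 1))"
      define s where "s = e / (2 * (\<bar>c\<bar> + r + 1))"
      have qx: "0 \<le> q x" by (rule seminorm_on_nonneg[OF q cx(1)])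
      have r: "r > 0" using e(1) qx by (simp add: r_def)
      have s: "s > 0" using e(1) r by (simp add: s_def)
      have half: "e / (2 * a) * a = e / 2" if "a > 0" for a :: real using that by simp
      have "r * (q x + 1) = e / 2" unfolding r_def using half[of "q x + 1"] qx by linarith
      then have rq: "r * q x < e / 2" using r by (simp add: distrib_left)
      have "s * (\<bar>c\<bar> + r + 1) = e / 2" unfolding s_def using half[of "\<bar>c\<bar> + r + 1"] r by linarith
      then have sq: "(\<bar>c\<bar> + r) * s < e / 2" using s by (simp add: algebra_simps)
      have "b *\<^sub>R y \<in> U" if "\<bar>b - c\<bar> < r" "y \<in> X" "q (y - x) < s" for b y
      proof -
        have yx: "y - x \<in> X" "b *\<^sub>R (y - x) \<in> X" "(b - c) *\<^sub>R x \<in> X" "b *\<^sub>R y \<in> X"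
          using that(2) cx X by (auto intro: subspace_diff subspace_scale)
        have "q (b *\<^sub>R y - c *\<^sub>R x) = q (b *\<^sub>R (y - x) + (b - c) *\<^sub>R x)"
          by (simp add: algebra_simps)
        also have "\<dots> \<le> \<bar>b\<bar> * q (y - x) + \<bar>b - c\<bar> * q x"
          using seminorm_onD(2)[OF q yx(2,3)] seminorm_onD(3)[OF q] yx(1) cx(1) by simp
        also have "\<dots> \<le> (\<bar>c\<bar> + r) * s + r * q x"
          using that qx r seminorm_on_nonneg[OF q yx(1)] by (intro add_mono mult_mono) auto
        also have "\<dots> < e" using rq sq by simp
        finally show ?thesis using e(2) yx(4) by blast
      qed
      then show "\<exists>V W. openin euclideanreal V \<and> openin ?T W \<and> c \<in> V \<and> x \<in> W \<and>
          V \<times> W \<subseteq> {z \<in> topspace (prod_topology euclideanreal ?T). (case z of (c, x) \<Rightarrow> c *\<^sub>R x) \<in> U}"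
        using ball[OF cx(1), of s] cx r s q0
        by (intro exI[of _ "ball c r"] exI[of _ "{y \<in> X. q (y - x) < s}"])
           (auto simp: ts dist_real_def abs_minus_commute)
    qed
  qed
  fix U assume U: "openin ?T U \<and> 0 \<in> U"
  then obtain e where e: "e > 0" "\<forall>y\<in>X. q (y - 0) < e \<longrightarrow> y \<in> U" using op by blast
  have "convex {y \<in> X. q (y - 0) < e}"
    unfolding convex_def
  proof (intro ballI allI impI)
    fix x y and u v :: real
    assume xy: "x \<in> {y \<in> X. q (y - 0) < e}" "y \<in> {y \<in> X. q (y - 0) < e}" "0 \<le> u" "0 \<le> v" "u + v = 1"
    have m: "u *\<^sub>R x \<in> X" "v *\<^sub>R y \<in> X" using xy X by (auto intro: subspace_scale)
    then have "q (u *\<^sub>R x + v *\<^sub>R y) \<le> u * q x + v * q y"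
      using seminorm_onD(2)[OF q m] seminorm_onD(3)[OF q] xy by simp
    also have "\<dots> < e" using xy convex_bound_lt[of "q x" e "q y" u v] by simp
    finally show "u *\<^sub>R x + v *\<^sub>R y \<in> {y \<in> X. q (y - 0) < e}" using m X by (simp add: subspace_add)
  qed
  then show "\<exists>V. openin ?T V \<and> 0 \<in> V \<and> convex V \<and> V \<subseteq> U"
    using ball[OF subspace_0[OF X], of e] e q0 subspace_0[OF X]
    by (intro exI[of _ "{y \<in> X. q (y - 0) < e}"]) auto
qed

lemma direct_limitD:
  assumes "lc_direct_limit_topology T S"
  shows "topspace S = (\<Union>n. topspace (T n))" "lc_space S"
    "\<And>n. continuous_map (T n) S (\<lambda>x. x)"
    "\<And>S' U. lc_topology_on_union T S' \<Longrightarrow> openin S' U \<Longrightarrow> openin S U"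
proof -
  have u: "lc_topology_on_union T S"
    and f: "\<forall>S'. lc_topology_on_union T S' \<longrightarrow> (\<forall>U. openin S' U \<longrightarrow> openin S U)"
    using assms by (simp_all add: lc_direct_limit_topology_def)
  show "topspace S = (\<Union>n. topspace (T n))" "lc_space S"
    "\<And>n. continuous_map (T n) S (\<lambda>x. x)"
    using u by (simp_all add: lc_topology_on_union_def)
  show "\<And>S' U. lc_topology_on_union T S' \<Longrightarrow> openin S' U \<Longrightarrow> openin S U" using f by blast
qed

text \<open>The direct limit topology is finer than every locally convex topology for which the inclusions are
  continuous, in particular than the topology defined by \<open>q\<close>.\<close>

lemma direct_limit_seminorm_continuous:
  assumes lc: "\<And>n. lc_space (T n)"
    and lim: "lc_direct_limit_topology T S"
    and q: "seminorm_on (topspace S) q" and cont: "\<And>n. continuous_seminorm (T n) q"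
  shows "continuous_seminorm S q"
proof (rule seminorm_continuousI[OF direct_limitD(2)[OF lim] q])
  let ?X = "topspace S" let ?Q = "seminorm_topology ?X q"
  have 0: "0 \<in> ?X" using seminorm_onD(1)[OF q] by (rule subspace_0)
  have "lc_topology_on_union T ?Q"
    unfolding lc_topology_on_union_def topspace_seminorm_topology
  proof (intro conjI allI)
    show "?X = (\<Union>n. topspace (T n))" by (rule direct_limitD(1)[OF lim])
    show "lc_space ?Q" by (rule lc_space_seminorm_topology[OF q])
    fix n
    have sub: "topspace (T n) \<subseteq> ?X" unfolding direct_limitD(1)[OF lim] by (rule UN_upper) simp
    show "continuous_map (T n) ?Q (\<lambda>x. x)"
      unfolding continuous_map_def topspace_seminorm_topology
    proof (intro conjI allI impI)
      fix U assume U: "openin ?Q U"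
      show "openin (T n) {x \<in> topspace (T n). x \<in> U}"
      proof (subst openin_subopen, intro ballI)
        fix x assume x: "x \<in> {x \<in> topspace (T n). x \<in> U}"
        then obtain e where e: "e > 0" "\<forall>y\<in>?X. q (y - x) < e \<longrightarrow> y \<in> U"
          using U[unfolded openin_seminorm_topology] by blast
        have "openin (T n) {y \<in> topspace (T n). q (y - x) < e}"
          by (rule open_seminorm_ball[OF lc cont]) (use x in blast)
        then show "\<exists>W. openin (T n) W \<and> x \<in> W \<and> W \<subseteq> {x \<in> topspace (T n). x \<in> U}"
          using x e sub seminorm_on_zero[OF q]
          by (intro exI[of _ "{y \<in> topspace (T n). q (y - x) < e}"]) auto
      qed
    qed (use sub in auto)
  qed
  then show "openin S {y \<in> ?X. q (y - 0) < 1}"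
    by (rule direct_limitD(4)[OF lim _ openin_seminorm_topology_ball[OF q 0]])
  show "0 \<in> {y \<in> ?X. q (y - 0) < 1}" using 0 seminorm_on_zero[OF q] by simp
  show "q x \<le> 1" if "x \<in> {y \<in> ?X. q (y - 0) < 1}" for x using that by simp
qed

lemma hausdorff_lcs_separating_seminorm:
  assumes T: "hausdorff_lcs T" and x: "x \<in> topspace T" "x \<noteq> 0"
  obtains p where "continuous_seminorm T p" "p x > 0"
proof -
  have lc: "lc_space T" and H: "Hausdorff_space T" using T by (auto simp: hausdorff_lcs_def)
  have 0: "0 \<in> topspace T" using lc_spaceD(1)[OF lc] by (rule subspace_0)
  have "\<exists>U V. openin T U \<and> openin T V \<and> 0 \<in> U \<and> x \<in> V \<and> disjnt U V"
    using H[unfolded Hausdorff_space_def, rule_format, of 0 x] 0 x by simp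
  then obtain U V where U: "openin T U" "0 \<in> U" "x \<in> V" "disjnt U V" by blast
  obtain p where p: "continuous_seminorm T p" "\<And>x. x \<in> topspace T \<Longrightarrow> p x < 1 \<Longrightarrow> x \<in> U"
    using gauge_seminorm[OF lc U(1,2)] by blast
  have "\<not> p x < 1" using p(2)[OF x(1)] U(3,4) by (auto simp: disjnt_iff)
  then show ?thesis using that[OF p(1)] by linarith
qed

lemma continuous_seminorm_mono_source:
  assumes "continuous_map T S (\<lambda>x. x)" "continuous_seminorm S q"
  shows "continuous_seminorm T q"
proof -
  have sub: "topspace T \<subseteq> topspace S" using assms(1) by (auto simp: continuous_map_def)
  have "continuous_map T euclideanreal q"
    using continuous_map_compose[OF assms(1), of euclideanreal q] assms(2)
    by (simp add: o_def continuous_seminorm_def)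
  then show ?thesis using assms(2) sub by (simp add: continuous_seminorm_def subset_iff)
qed

section \<open>Separated sequences in infinite-dimensional spaces\<close>

text \<open>A finite-dimensional subspace is closed. Induction on the spanning set: if \<open>v\<close> is a limit of vectors
  \<open>m\<^sub>k = t\<^sub>k b + n\<^sub>k\<close> with \<open>n\<^sub>k\<close> in the smaller span, then the \<open>t\<^sub>k\<close> are bounded because \<open>b\<close> has positive
  distance from that span, and a limit point \<open>s\<close> of them makes \<open>v - s b\<close> a limit of vectors of the smaller span.\<close>

lemma finite_span_closed:
  assumes p: "seminorm_on X p" and norm: "\<And>x. x \<in> X \<Longrightarrow> p x = 0 \<Longrightarrow> x = 0"
    and B: "finite B" "B \<subseteq> X" and v: "v \<in> X" "v \<notin> span B"
  shows "\<exists>d>0. \<forall>m\<in>span B. d \<le> p (v - m)"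
  using B v
proof (induction B arbitrary: v rule: finite_induct)
  case empty
  then have "v \<noteq> 0" by auto
  then have "p v > 0" using norm seminorm_on_nonneg[OF p] empty by fastforce
  then show ?case by auto
next
  case (insert b B)
  have X: "subspace X" by (rule seminorm_onD(1)[OF p])
  have sX: "span B \<subseteq> X" by (rule span_minimal[OF _ X]) (use insert.prems in blast)
  show ?case
  proof (cases "b \<in> span B")
    case True
    then have "span (insert b B) = span B" by (rule span_redundant)
    then show ?thesis using insert by auto
  next
    case False
    then obtain d where d: "d > 0" "\<forall>m\<in>span B. d \<le> p (b - m)" using insert by blast
    show ?thesis
    proof (rule ccontr)
      assume "\<not> (\<exists>d>0. \<forall>m\<in>span (insert b B). d \<le> p (v - m))"
      then have small: "\<exists>m\<in>span (insert b B). p (v - m) < d" if "d > 0" for d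
        using that by (meson not_le)
      have "\<forall>k. \<exists>m\<in>span (insert b B). p (v - m) < 1 / real (Suc k)"
        by (intro allI small) simp
      then obtain m where m: "\<And>k. m k \<in> span (insert b B)" "\<And>k. p (v - m k) < 1 / real (Suc k)"
        by metis
      from m(1) obtain t where t: "\<And>k. m k - t k *\<^sub>R b \<in> span B"
        unfolding span_insert by simp metis
      have mX: "m k \<in> X" for k
        using m(1)[of k] span_minimal[OF insert.prems(1) X] by blast
      have bX: "b \<in> X" using insert.prems(1) by blast
      have tb: "\<bar>t k\<bar> \<le> (p v + 1) / d" for k
      proof (cases "t k = 0")
        case True
        then show ?thesis using d seminorm_on_nonneg[OF p insert.prems(2)] by simp
      next
        case nz: False
        have "(-1 / t k) *\<^sub>R (m k - t k *\<^sub>R b) \<in> span B" by (rule span_scale[OF t])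
        from d(2)[rule_format, OF this] have "d \<le> p ((1 / t k) *\<^sub>R m k)" using nz by (simp add: algebra_simps)
        then have "\<bar>t k\<bar> * d \<le> p (m k)" using seminorm_onD(3)[OF p mX] nz by (simp add: field_simps)
        also have "p (m k) \<le> p v + p (v - m k)"
          using seminorm_on_triangle_minus(1)[OF p insert.prems(2), of "v - m k"] mX X
            insert.prems(2) by (simp add: subspace_diff)
        also have "\<dots> \<le> p v + 1"
          using less_le_trans[OF m(2)[of k], of 1] by (simp add: field_simps)
        finally show ?thesis using d(1) by (simp add: field_simps)
      qed
      have "bounded (range t)" using tb by (auto simp: bounded_iff)
      then obtain s r where r: "strict_mono r" "((t \<circ> r) \<longlongrightarrow> s) sequentially"
        using bounded_imp_convergent_subsequence by blast
      have "v - s *\<^sub>R b \<notin> span B"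
        using insert.prems(3) by (auto simp: span_insert)
      moreover have "v - s *\<^sub>R b \<in> X" using insert.prems(2) bX X by (simp add: subspace_diff subspace_scale)
      ultimately obtain e where e: "e > 0" "\<forall>m\<in>span B. e \<le> p (v - s *\<^sub>R b - m)"
        using insert.IH insert.prems(1) by blast
      have "e \<le> 1 / real (Suc (r k)) + \<bar>t (r k) - s\<bar> * p b" for k
      proof -
        have "e \<le> p (v - s *\<^sub>R b - (m (r k) - t (r k) *\<^sub>R b))" using e t by blast
        also have "\<dots> = p ((v - m (r k)) + (t (r k) - s) *\<^sub>R b)" by (simp add: algebra_simps)
        also have "\<dots> \<le> p (v - m (r k)) + \<bar>t (r k) - s\<bar> * p b"
          using seminorm_onD(2)[OF p, of "v - m (r k)" "(t (r k) - s) *\<^sub>R b"] seminorm_onD(3)[OF p bX]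
            insert.prems(2) mX bX X by (simp add: subspace_diff subspace_scale)
        finally show ?thesis using m(2)[of "r k"] by linarith
      qed
      moreover have "(\<lambda>k. 1 / real (Suc (r k)) + \<bar>t (r k) - s\<bar> * p b) \<longlonglongrightarrow> 0 + 0 * p b"
      proof (intro tendsto_intros)
        show "(\<lambda>k. 1 / real (Suc (r k))) \<longlonglongrightarrow> 0"
          using LIMSEQ_subseq_LIMSEQ[OF LIMSEQ_inverse_real_of_nat r(1)]
          by (simp add: o_def inverse_eq_divide)
        show "(\<lambda>k. \<bar>t (r k) - s\<bar>) \<longlonglongrightarrow> 0"
          using r(2) by (simp add: o_def LIM_zero_iff tendsto_rabs_zero_iff)
      qed
      ultimately have "e \<le> 0 + 0 * p b" by (intro LIMSEQ_le_const) auto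
      then show False using e by simp
    qed
  qed
qed

text \<open>Take \<open>v\<close> outside the span, a vector \<open>m\<close> of the span whose distance from \<open>v\<close> is less than twice the infimum,
  and normalise \<open>v - m\<close>.\<close>

lemma riesz_lemma:
  assumes p: "seminorm_on X p" and norm: "\<And>x. x \<in> X \<Longrightarrow> p x = 0 \<Longrightarrow> x = 0"
    and B: "finite B" "B \<subseteq> X" and inf: "infinite_dimensional X"
  shows "\<exists>u\<in>X. p u = 1 \<and> (\<forall>m\<in>span B. 1/2 \<le> p (u - m))"
proof -
  have X: "subspace X" by (rule seminorm_onD(1)[OF p])
  have sX: "span B \<subseteq> X" by (rule span_minimal[OF B(2) X])
  obtain v where v: "v \<in> X" "v \<notin> span B" using inf B(1) unfolding infinite_dimensional_def by blast
  let ?D = "(\<lambda>m. p (v - m)) ` span B"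
  obtain d where d: "d > 0" "\<forall>m\<in>span B. d \<le> p (v - m)"
    using finite_span_closed[OF p norm B v] by blast
  define I where "I = Inf ?D"
  have ne: "?D \<noteq> {}" using span_zero by blast
  have bdd: "bdd_below ?D" using d by (intro bdd_belowI[of _ d]) auto
  have "d \<le> I" unfolding I_def using d ne by (intro cInf_greatest) auto
  then have I: "I > 0" using d by simp
  have le: "I \<le> p (v - m)" if "m \<in> span B" for m
    unfolding I_def using bdd that by (intro cInf_lower) auto
  obtain m where m: "m \<in> span B" "p (v - m) < 2 * I"
    using cInf_lessD[OF ne, of "2 * I"] I unfolding I_def by auto
  define c where "c = p (v - m)"
  have c: "c > 0" using le[OF m(1)] I c_def by simp
  define u where "u = (1/c) *\<^sub>R (v - m)"
  have vm: "v - m \<in> X" using v m sX X by (auto intro: subspace_diff)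
  have "1/2 \<le> p (u - m')" if m': "m' \<in> span B" for m'
  proof -
    have "m + c *\<^sub>R m' \<in> span B" using m(1) m' by (simp add: span_add span_scale)
    from le[OF this] have "I \<le> p (c *\<^sub>R (u - m'))" using c by (simp add: u_def algebra_simps)
    moreover have "u - m' \<in> X" using vm m' sX X by (auto simp: u_def intro: subspace_diff subspace_scale)
    ultimately have "I \<le> c * p (u - m')" using seminorm_onD(3)[OF p] c by simp
    moreover have "c < 2 * I" using m(2) c_def by simp
    ultimately have "c * (1/2) \<le> c * p (u - m')" by linarith
    then show ?thesis using c by (simp only: mult_le_cancel_left_pos)
  qed
  moreover have "u \<in> X" "p u = 1"
    using vm X c seminorm_onD(3)[OF p vm, of "1/c"] by (auto simp: u_def subspace_scale c_def)
  ultimately show ?thesis by blast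
qed

text \<open>Apply the Riesz lemma successively to the span of the vectors already chosen.\<close>

lemma separated_sequence_of_norm:
  assumes p: "seminorm_on X p" and norm: "\<And>x. x \<in> X \<Longrightarrow> p x = 0 \<Longrightarrow> x = 0"
    and inf: "infinite_dimensional X"
  shows "\<exists>u::nat \<Rightarrow> 'a::real_vector. (\<forall>k. u k \<in> X \<and> p (u k) = 1) \<and> (\<forall>k l. k \<noteq> l \<longrightarrow> 1/2 \<le> p (u k - u l))"
proof -
  let ?P = "\<lambda>n (A::'a set). finite A \<and> A \<subseteq> X"
  let ?Q = "\<lambda>u A. u \<in> X \<and> p u = 1 \<and> (\<forall>m\<in>span A. 1/2 \<le> p (u - m))"
  have "\<exists>A. \<forall>n. ?P n (A n) \<and> (\<exists>u. ?Q u (A n) \<and> A (Suc n) = insert u (A n))"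
  proof (rule dependent_nat_choice)
    show "\<exists>A. ?P 0 A" by (rule exI[of _ "{}"]) simp
    fix A n assume A: "?P n A"
    then obtain u where u: "?Q u A" using riesz_lemma[OF p norm _ _ inf, of A] by blast
    then show "\<exists>A'. ?P (Suc n) A' \<and> (\<exists>u. ?Q u A \<and> A' = insert u A)"
      using A by (intro exI[of _ "insert u A"]) auto
  qed
  then obtain A u where A: "\<And>n. ?Q (u n) (A n)" "\<And>n. A (Suc n) = insert (u n) (A n)" by metis
  have mono: "A i \<subseteq> A j" if "i \<le> j" for i j using lift_Suc_mono_le[of A, OF _ that] A(2) by blast
  have less: "1/2 \<le> p (u l - u k)" if "k < l" for k l
  proof -
    have "u k \<in> A l" using A(2)[of k] mono[of "Suc k" l] that by auto
    then show ?thesis using A(1)[of l] span_base by blast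
  qed
  have "1/2 \<le> p (u k - u l)" if "k \<noteq> l" for k l
    using less[of k l] less[of l k] that seminorm_on_triangle_minus(3)[OF p, of "u k" "u l"] A(1)
    by (cases "k < l") auto
  then show ?thesis using A(1) by blast
qed

text \<open>Let \<open>p\<close> be a gauge with unit ball inside \<open>U\<close>. If \<open>p\<close> has a kernel vector \<open>w \<noteq> 0\<close>, then all multiples of \<open>w\<close>
  lie in \<open>U\<close>, and another seminorm separates them. Otherwise \<open>p\<close> is a norm, and a Riesz sequence does.\<close>

lemma separated_sequence_in_neighbourhood:
  assumes T: "hausdorff_lcs T" and inf: "infinite_dimensional (topspace T)"
    and U: "openin T U" "0 \<in> U"
  shows "\<exists>(u::nat \<Rightarrow> 'a::real_vector) s. continuous_seminorm T s \<and> (\<forall>k. u k \<in> U) \<and>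
     (\<forall>k l. k \<noteq> l \<longrightarrow> 1 \<le> s (u k - u l))"
proof -
  have lc: "lc_space T" using T by (simp add: hausdorff_lcs_def)
  have X: "subspace (topspace T)" by (rule lc_spaceD(1)[OF lc])
  obtain p where p: "continuous_seminorm T p" "\<And>x. x \<in> topspace T \<Longrightarrow> p x < 1 \<Longrightarrow> x \<in> U"
    using gauge_seminorm[OF lc U] by blast
  note sp = continuous_seminormD(1)[OF lc p(1)]
  show ?thesis
  proof (cases "\<exists>w\<in>topspace T. w \<noteq> 0 \<and> p w = 0")
    case True
    then obtain w where w: "w \<in> topspace T" "w \<noteq> 0" "p w = 0" by blast
    obtain r where r: "continuous_seminorm T r" "r w > 0"
      using hausdorff_lcs_separating_seminorm[OF T w(1,2)] by blast
    define s where "s = (\<lambda>x. (1 / r w) * r x)"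
    define u where "u = (\<lambda>k. real k *\<^sub>R w)"
    have "continuous_seminorm T s" unfolding s_def using r by (intro continuous_seminorm_scale[OF lc]) auto
    moreover have "u k \<in> U" for k
      using p(2)[of "u k"] w seminorm_onD(3)[OF sp w(1)] X by (simp add: u_def subspace_scale)
    moreover have "1 \<le> s (u k - u l)" if "k \<noteq> l" for k l
    proof -
      have "s (u k - u l) = (1 / r w) * r ((real k - real l) *\<^sub>R w)"
        by (simp add: s_def u_def scaleR_diff_left)
      also have "\<dots> = \<bar>real k - real l\<bar>"
        using seminorm_onD(3)[OF continuous_seminormD(1)[OF lc r(1)] w(1)] r(2) by simp
      finally show ?thesis using that by linarith
    qed
    ultimately show ?thesis by blast
  next
    case False
    have "\<exists>u::nat \<Rightarrow> 'a. (\<forall>k. u k \<in> topspace T \<and> p (u k) = 1) \<and> (\<forall>k l. k \<noteq> l \<longrightarrow> 1/2 \<le> p (u k - u l))"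
      by (rule separated_sequence_of_norm[OF sp _ inf]) (use False in blast)
    then obtain u :: "nat \<Rightarrow> 'a" where u': "\<forall>k. u k \<in> topspace T \<and> p (u k) = 1"
      "\<forall>k l. k \<noteq> l \<longrightarrow> 1/2 \<le> p (u k - u l)" by (elim exE conjE)
    then have u: "\<And>k. u k \<in> topspace T" "\<And>k. p (u k) = 1"
      "\<And>k l. k \<noteq> l \<Longrightarrow> 1/2 \<le> p (u k - u l)" by simp_all
    define s where "s = (\<lambda>x. 4 * p x)"
    define w where "w = (\<lambda>k::nat. (1/2) *\<^sub>R u k)"
    have "continuous_seminorm T s" unfolding s_def using p by (intro continuous_seminorm_scale[OF lc]) auto
    moreover have "w k \<in> U" for k
      using p(2)[of "w k"] u(1,2) seminorm_onD(3)[OF sp u(1)[of k]] X by (simp add: w_def subspace_scale)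
    moreover have "1 \<le> s (w k - w l)" if "k \<noteq> l" for k l
    proof -
      have "u k - u l \<in> topspace T" using u(1) X by (simp add: subspace_diff)
      then have "s (w k - w l) = 2 * p (u k - u l)"
        using seminorm_onD(3)[OF sp, of "u k - u l" "1/2"] by (simp add: s_def w_def scaleR_diff_right)
      then show ?thesis using u(3)[OF that] by linarith
    qed
    ultimately show ?thesis by blast
  qed
qed

section \<open>Ascending sequences of locally convex spaces\<close>

lemma eventually_small_quotient:
  fixes c e :: real assumes "e > 0" shows "\<exists>K. c / real (Suc K) < e"
proof -
  obtain K where "c / e < real K" using reals_Archimedean2 by blast
  then have "c < e * real (Suc K)" using assms by (simp add: field_simps)
  then show ?thesis by (intro exI[of _ K]) (simp add: divide_less_eq del: of_nat_Suc)
qed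

locale ascending_lcs =
  fixes T :: "nat \<Rightarrow> 'a::real_vector topology" and S :: "'a topology"
  assumes lcs: "\<And>n. hausdorff_lcs (T n)"
    and ascending: "\<And>n. topspace (T n) \<subseteq> topspace (T (Suc n))"
    and induced: "\<And>n. subtopology (T (Suc n)) (topspace (T n)) = T n"
    and limit_topology: "lc_direct_limit_topology T S"
begin

abbreviation "E \<equiv> \<lambda>n. topspace (T n)"

lemma lc: "lc_space (T n)" using lcs by (simp add: hausdorff_lcs_def)

lemma lc_S: "lc_space S" by (rule direct_limitD(2)[OF limit_topology])

lemma subspace_E: "subspace (E n)" by (rule lc_spaceD(1)[OF lc])

lemma zero_E: "0 \<in> E n" by (rule subspace_0[OF subspace_E])

lemma subspace_S: "subspace (topspace S)" by (rule lc_spaceD(1)[OF lc_S])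

lemma zero_S: "0 \<in> topspace S" by (rule subspace_0[OF subspace_S])

lemma topspace_S: "topspace S = (\<Union>n. E n)" by (rule direct_limitD(1)[OF limit_topology])

lemma E_subset_S: "E n \<subseteq> topspace S" unfolding topspace_S by (rule UN_upper) simp

lemma incl_S: "continuous_map (T n) S (\<lambda>x. x)" by (rule direct_limitD(3)[OF limit_topology])

lemma E_mono: "m \<le> n \<Longrightarrow> E m \<subseteq> E n"
  by (rule lift_Suc_mono_le[of E]) (rule ascending)

lemma induced_le: "m \<le> n \<Longrightarrow> subtopology (T n) (E m) = T m"
proof (induction n rule: dec_induct)
  case (step n)
  have "subtopology (T (Suc n)) (E m) = subtopology (subtopology (T (Suc n)) (E n)) (E m)"
    unfolding subtopology_subtopology using E_mono[OF step(1)] by (simp add: Int_absorb1)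
  then show ?case using step.IH induced by simp
qed simp

lemma openin_E_trace:
  assumes "m \<le> n" "openin (T m) U"
  obtains O' where "openin (T n) O'" "U = O' \<inter> E m"
proof -
  have "openin (subtopology (T n) (E m)) U" unfolding induced_le[OF assms(1)] by (rule assms(2))
  then show ?thesis using that unfolding openin_subtopology by blast
qed

lemma seminorm_S_restrict: "continuous_seminorm S q \<Longrightarrow> continuous_seminorm (T n) q"
  by (rule continuous_seminorm_mono_source[OF incl_S])

text \<open>The induced topology gives a neighbourhood in \<open>E n\<close> whose trace lies in the unit ball of \<open>p\<close>; its gauge
  dominates \<open>p\<close>.\<close>

lemma seminorm_dominated_above:
  assumes mn: "m \<le> n" and p: "continuous_seminorm (T m) p"
  obtains r where "continuous_seminorm (T n) r" "\<And>x. x \<in> E m \<Longrightarrow> p x \<le> r x"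
proof -
  note sp = continuous_seminormD(1)[OF lc p]
  have "openin (T m) {x \<in> E m. p x < 1}" by (rule open_seminorm_ball_0[OF lc p])
  then obtain O' where O: "openin (T n) O'" "{x \<in> E m. p x < 1} = O' \<inter> E m"
    using openin_E_trace[OF mn] by blast
  have "0 \<in> {x \<in> E m. p x < 1}" using zero_E seminorm_on_zero[OF sp] by simp
  then have "0 \<in> O'" unfolding O(2) by blast
  then obtain r where r: "continuous_seminorm (T n) r" "\<And>x. x \<in> E n \<Longrightarrow> r x < 1 \<Longrightarrow> x \<in> O'"
    using gauge_seminorm[OF lc O(1)] by blast
  have sr: "seminorm_on (E m) r"
    by (rule seminorm_on_subset[OF continuous_seminormD(1)[OF lc r(1)] subspace_E E_mono[OF mn]])
  have "p x \<le> 1 * r x" if "x \<in> E m" for x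
  proof (rule seminorm_le_by_scaling[OF sr sp _ that])
    fix y assume y: "y \<in> E m" "r y < 1"
    then have "y \<in> O' \<inter> E m" using r(2) E_mono[OF mn] by blast
    then show "p y \<le> 1" unfolding O(2)[symmetric] by simp
  qed
  then show ?thesis using that[OF r(1)] by simp
qed

text \<open>Of the terms with large index, at most one lies within distance \<open>1/4\<close> of a given point, because the
  perturbations tend to \<open>0\<close> and the \<open>u k\<close> have distance at least \<open>1\<close> from each other. So the sequence
  is locally finite.\<close>

lemma perturbed_separated_sequence_closed:
  assumes mn: "m \<le> n" and u: "\<And>k. u k \<in> E m" and s: "continuous_seminorm (T m) s"
    and sep: "\<And>k l. k \<noteq> l \<Longrightarrow> 1 \<le> s (u k - u l)" and v: "v \<in> E n"
  shows "closedin (T n) (range (\<lambda>k. u k + (1 / real (Suc k)) *\<^sub>R v))"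
proof -
  define a where "a = (\<lambda>k. u k + (1 / real (Suc k)) *\<^sub>R v)"
  obtain r where r: "continuous_seminorm (T n) r" "\<And>x. x \<in> E m \<Longrightarrow> s x \<le> r x"
    using seminorm_dominated_above[OF mn s] by blast
  note sr = continuous_seminormD(1)[OF lc r(1)]
  have uE: "u k \<in> E n" for k using u E_mono[OF mn] by blast
  have sv: "c *\<^sub>R v \<in> E n" for c by (rule subspace_scale[OF subspace_E v])
  have aE: "a k \<in> E n" for k unfolding a_def by (rule subspace_add[OF subspace_E uE sv])
  have sepr: "1 \<le> r (u k - u l)" if "k \<noteq> l" for k l
    using order_trans[OF sep[OF that] r(2)] subspace_diff[OF subspace_E u u] by blast
  obtain K where K: "r v / real (Suc K) < 1/8"
    using eventually_small_quotient[of "1/8" "r v"] by auto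
  have small: "r (u k - a k) < 1/8" if "k \<ge> K" for k
  proof -
    have "r (u k - a k) = r v / real (Suc k)"
      using seminorm_onD(3)[OF sr v, of "- (1 / real (Suc k))"] by (simp add: a_def)
    also have "\<dots> \<le> r v / real (Suc K)"
      using that seminorm_on_nonneg[OF sr v] by (intro divide_left_mono) auto
    finally show ?thesis using K by linarith
  qed
  have fin: "finite {k. r (a k - x) < 1/4}" if x: "x \<in> E n" for x
  proof -
    have eq: "k = l" if kl: "r (a k - x) < 1/4" "r (a l - x) < 1/4" "K \<le> k" "K \<le> l" for k l
    proof (rule ccontr)
      assume "k \<noteq> l"
      define d1 d2 d3 d4 where "d1 = u k - a k" and "d2 = a k - x" and "d3 = x - a l" and "d4 = a l - u l"
      have m: "d1 \<in> E n" "d2 \<in> E n" "d3 \<in> E n" "d4 \<in> E n"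
        using uE aE x by (auto simp: d1_def d2_def d3_def d4_def intro: subspace_diff[OF subspace_E])
      have "r (u k - u l) = r ((d1 + d2) + (d3 + d4))"
        by (simp add: d1_def d2_def d3_def d4_def)
      also have "\<dots> \<le> (r d1 + r d2) + (r d3 + r d4)"
        using seminorm_onD(2)[OF sr subspace_add[OF subspace_E m(1,2)] subspace_add[OF subspace_E m(3,4)]]
          seminorm_onD(2)[OF sr m(1,2)] seminorm_onD(2)[OF sr m(3,4)] by linarith
      also have "r d1 < 1/8" using small kl by (simp add: d1_def)
      also have "r d2 < 1/4" using kl by (simp add: d2_def)
      also have "r d3 < 1/4" using kl seminorm_on_triangle_minus(3)[OF sr x aE] by (simp add: d3_def)
      also have "r d4 < 1/8" using small[OF kl(4)] seminorm_on_triangle_minus(3)[OF sr uE aE, of l l]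
        by (simp add: d4_def)
      finally show False using sepr[OF \<open>k \<noteq> l\<close>] by simp
    qed
    have "finite {k. r (a k - x) < 1/4 \<and> K \<le> k}"
    proof (cases "{k. r (a k - x) < 1/4 \<and> K \<le> k} = {}")
      case False
      then obtain l where "r (a l - x) < 1/4 \<and> K \<le> l" by blast
      then have "{k. r (a k - x) < 1/4 \<and> K \<le> k} \<subseteq> {l}" using eq by blast
      then show ?thesis using finite_subset by blast
    qed (use finite.emptyI in metis)
    moreover have "{k. r (a k - x) < 1/4} \<subseteq> {..<K} \<union> {k. r (a k - x) < 1/4 \<and> K \<le> k}" by auto
    ultimately show ?thesis using finite_subset by blast
  qed
  have "openin (T n) (E n - range a)"
  proof (subst openin_subopen, intro ballI)
    fix x assume x: "x \<in> E n - range a"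
    let ?N = "{y \<in> E n. r (y - x) < 1/4}" let ?F = "a ` {k. r (a k - x) < 1/4}"
    have No: "openin (T n) ?N" by (rule open_seminorm_ball[OF lc r(1)]) (use x in blast)
    have "finite ?F" using fin x by blast
    moreover have "?F \<subseteq> E n" using aE by blast
    ultimately have "closedin (T n) ?F"
      using lcs[of n] closedin_Hausdorff_finite unfolding hausdorff_lcs_def by blast
    then have "openin (T n) (?N - ?F)" by (rule openin_diff[OF No])
    moreover have "x \<in> ?N - ?F" using x seminorm_on_zero[OF sr] by auto
    moreover have "?N - ?F \<subseteq> E n - range a" by blast
    ultimately show "\<exists>W. openin (T n) W \<and> x \<in> W \<and> W \<subseteq> E n - range a" by blast
  qed
  then have "closedin (T n) (range a)" using aE by (simp add: closedin_def image_subset_iff)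
  then show ?thesis by (simp add: a_def)
qed

end

section \<open>The direct limit in topological spaces\<close>

lemma metrizable_neighbourhood_base:
  assumes "metrizable_space X" "x \<in> topspace X"
  shows "\<exists>U::nat \<Rightarrow> 'a set. (\<forall>j. openin X (U j) \<and> x \<in> U j) \<and>
    (\<forall>W. openin X W \<and> x \<in> W \<longrightarrow> (\<exists>J. \<forall>j\<ge>J. U j \<subseteq> W))"
proof -
  obtain M d where M: "Metric_space M d" and X: "X = Metric_space.mtopology M d"
    using assms(1) unfolding metrizable_space_def by blast
  interpret Metric_space M d by (rule M)
  have x: "x \<in> M" using assms(2) X by simp
  show ?thesis
  proof (intro exI[of _ "\<lambda>j. mball x (1 / real (Suc j))"] conjI allI impI)
    show "openin X (mball x (1 / real (Suc j)))" for j unfolding X by simp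
    show "x \<in> mball x (1 / real (Suc j))" for j using x by simp
    fix W assume "openin X W \<and> x \<in> W"
    then obtain r where r: "r > 0" "mball x r \<subseteq> W" unfolding X openin_mtopology by blast
    obtain J where J: "1 / real (Suc J) < r" using r(1) nat_approx_posE by blast
    have "mball x (1 / real (Suc j)) \<subseteq> W" if "j \<ge> J" for j
    proof -
      have "1 / real (Suc j) \<le> 1 / real (Suc J)" using that by (intro divide_left_mono) auto
      then show ?thesis using mball_subset_concentric[of "1 / real (Suc j)" r x] J r(2) by force
    qed
    then show "\<exists>J. \<forall>j\<ge>J. mball x (1 / real (Suc j)) \<subseteq> W" by blast
  qed
qed

text \<open>The families of maps used below are restrictions of one map on the union, for which compatibility is
  automatic.\<close>

lemma direct_limit_cone_factor:
  assumes "direct_limit_cone obj carrier mor X L" "obj Y" "\<And>n. mor (X n) Y f"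
  shows "\<exists>g. mor L Y g \<and> (\<forall>n. \<forall>x\<in>carrier (X n). g x = f x)"
proof -
  have "\<forall>Y F. obj Y \<and> (\<forall>n. mor (X n) Y (F n)) \<and>
            (\<forall>n. \<forall>x\<in>carrier (X n). F (Suc n) x = F n x) \<longrightarrow>
        (\<exists>g. mor L Y g \<and> (\<forall>n. \<forall>x\<in>carrier (X n). g x = F n x) \<and>
             (\<forall>h. mor L Y h \<and> (\<forall>n. \<forall>x\<in>carrier (X n). h x = F n x) \<longrightarrow>
                  (\<forall>x\<in>carrier L. h x = g x)))"
    using assms(1) unfolding direct_limit_cone_def by (rule conjunct2)
  from this[rule_format, of Y "\<lambda>_. f"] assms(2,3) show ?thesis by blast
qed

locale strictly_ascending_lcs = ascending_lcs +
  assumes not_stationary: "\<not> (\<exists>N. \<forall>n\<ge>N. topspace (T n) = topspace (T N))"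
begin

lemma jump_above: "\<exists>j\<ge>N. E j \<noteq> E (Suc j)"
proof (rule ccontr)
  assume "\<not> (\<exists>j\<ge>N. E j \<noteq> E (Suc j))"
  then have *: "E j = E (Suc j)" if "j \<ge> N" for j using that by blast
  have "E n = E N" if "n \<ge> N" for n
    using that
  proof (induction n rule: dec_induct)
    case (step m)
    show ?case by (rule trans[OF *[OF step(1), symmetric] step(3)])
  qed (rule refl)
  then show False using not_stationary by blast
qed

text \<open>The test object is the union with the finest topology that makes the inclusions continuous.\<close>

lemma not_topological_limit:
  assumes inf: "infinite_dimensional (E 0)" and metr: "metrizable_space (T 0)"
  shows "\<not> top_direct_limit T S"
proof
  assume lim: "top_direct_limit T S"
  obtain U :: "nat \<Rightarrow> 'a set" where U': "(\<forall>j. openin (T 0) (U j) \<and> 0 \<in> U j) \<and>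
    (\<forall>W. openin (T 0) W \<and> 0 \<in> W \<longrightarrow> (\<exists>J. \<forall>j\<ge>J. U j \<subseteq> W))"
    using metrizable_neighbourhood_base[OF metr zero_E] by blast
  then have U: "\<And>j. openin (T 0) (U j)" "\<And>j. 0 \<in> U j"
    "\<And>W. openin (T 0) W \<Longrightarrow> 0 \<in> W \<Longrightarrow> \<exists>J. \<forall>j\<ge>J. U j \<subseteq> W" by simp_all
  have "\<exists>(u::nat \<Rightarrow> 'a) s. continuous_seminorm (T 0) s \<and> (\<forall>k. u k \<in> U j) \<and>
     (\<forall>k l. k \<noteq> l \<longrightarrow> 1 \<le> s (u k - u l))" for j
    by (rule separated_sequence_in_neighbourhood[OF lcs inf U(1,2)])
  then obtain u :: "nat \<Rightarrow> nat \<Rightarrow> 'a" and s where us: "\<And>j. continuous_seminorm (T 0) (s j)" "\<And>j k. u j k \<in> U j"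
    "\<And>j k l. k \<noteq> l \<Longrightarrow> 1 \<le> s j (u j k - u j l)" by metis
  have u0: "u j k \<in> E 0" for j k using us(2) openin_subset[OF U(1)] by blast
  define J where "J = {j. E j \<noteq> E (Suc j)}"
  have "\<exists>v. v \<in> E (Suc j) \<and> v \<notin> E j" if "j \<in> J" for j using that ascending[of j] by (auto simp: J_def)
  then obtain v where v: "\<And>j. j \<in> J \<Longrightarrow> v j \<in> E (Suc j)" "\<And>j. j \<in> J \<Longrightarrow> v j \<notin> E j" by metis
  define a where "a = (\<lambda>j k. u j k + (1 / real (Suc k)) *\<^sub>R v j)"
  have a_notin: "a j k \<notin> E n" if "j \<in> J" "n \<le> j" for j k n
  proof
    assume "a j k \<in> E n"
    then have "a j k \<in> E j" "u j k \<in> E j" using E_mono[OF that(2)] E_mono[of 0 j] u0 by auto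
    then have "real (Suc k) *\<^sub>R (a j k - u j k) \<in> E j"
      by (intro subspace_scale[OF subspace_E] subspace_diff[OF subspace_E])
    then have "v j \<in> E j" by (simp add: a_def del: of_nat_Suc)
    then show False using v(2)[OF that(1)] by blast
  qed
  \<comment> \<open>All terms with \<open>j \<ge> n\<close> are outside \<open>E n\<close>, so only finitely many \<open>j\<close> matter on each step.\<close>
  define A where "A = (\<Union>j\<in>J. range (a j))"
  have A_closed: "closedin (T n) (A \<inter> E n)" for n
  proof -
    have "range (a j) \<subseteq> E n" if "j \<in> J" "j < n" for j
    proof clarify
      fix k
      have "u j k \<in> E n" "v j \<in> E n" using u0 E_mono[of 0 n] E_mono[of "Suc j" n] v(1)[OF that(1)] that(2) by auto
      then show "a j k \<in> E n" unfolding a_def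
        by (intro subspace_scale[OF subspace_E] subspace_add[OF subspace_E])
    qed
    then have "(\<Union>j\<in>J \<inter> {..<n}. range (a j)) \<subseteq> A \<inter> E n" unfolding A_def by blast
    moreover have "A \<inter> E n \<subseteq> (\<Union>j\<in>J \<inter> {..<n}. range (a j))"
    proof
      fix x assume x: "x \<in> A \<inter> E n"
      then obtain j k where jk: "j \<in> J" "x = a j k" unfolding A_def by blast
      then have "j < n" using a_notin[of j n k] x by (meson IntD2 not_less)
      then show "x \<in> (\<Union>j\<in>J \<inter> {..<n}. range (a j))" using jk by blast
    qed
    ultimately have eq: "A \<inter> E n = (\<Union>j\<in>J \<inter> {..<n}. range (a j))" by (rule subset_antisym[rotated])
    have "closedin (T n) (range (a j))" if "j \<in> J \<inter> {..<n}" for j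
      unfolding a_def
    proof (rule perturbed_separated_sequence_closed[OF _ u0 us(1,3)])
      show "v j \<in> E n" using v(1)[of j] E_mono[of "Suc j" n] that by auto
    qed auto
    then show ?thesis unfolding eq by (intro closedin_Union) auto
  qed
  let ?P = "\<lambda>W. W \<subseteq> topspace S \<and> (\<forall>n. openin (T n) (W \<inter> E n))"
  define Y where "Y = topology ?P"
  have "istopology ?P"
    unfolding istopology_def
  proof (intro conjI allI impI)
    fix V W assume *: "?P V" "?P W"
    show "V \<inter> W \<subseteq> topspace S" using * by blast
    show "openin (T n) (V \<inter> W \<inter> E n)" for n
    proof -
      have "V \<inter> W \<inter> E n = (V \<inter> E n) \<inter> (W \<inter> E n)" by blast
      then show ?thesis using * openin_Int by metis
    qed
  next
    fix K assume *: "\<forall>W\<in>K. ?P W"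
    then show "\<Union> K \<subseteq> topspace S" by blast
    show "openin (T n) (\<Union> K \<inter> E n)" for n
    proof -
      have eq: "\<Union> K \<inter> E n = \<Union> ((\<lambda>W. W \<inter> E n) ` K)" by blast
      show ?thesis unfolding eq by (rule openin_Union) (use * in auto)
    qed
  qed
  then have openY: "openin Y W \<longleftrightarrow> ?P W" for W by (simp add: Y_def)
  have "?P (topspace S)" using E_subset_S by (simp add: Int_absorb1)
  then have topY: "topspace Y = topspace S" using openY openin_subset openin_topspace by (metis subset_antisym)
  have incY: "continuous_map (T n) Y (\<lambda>x. x)" for n
    unfolding continuous_map_def
  proof (intro conjI allI impI)
    show "(\<lambda>x. x) \<in> E n \<rightarrow> topspace Y" using E_subset_S topY by auto
    fix W assume "openin Y W"
    moreover have "{x \<in> E n. x \<in> W} = W \<inter> E n" by blast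
    ultimately show "openin (T n) {x \<in> E n. x \<in> W}" using openY by simp
  qed
  obtain g where g: "continuous_map S Y g" "\<And>n x. x \<in> E n \<Longrightarrow> g x = x"
    using direct_limit_cone_factor[OF lim[unfolded top_direct_limit_def], of Y "\<lambda>x. x"] incY by auto
  have "?P (topspace S - A)"
  proof (intro conjI allI)
    fix n
    have "(topspace S - A) \<inter> E n = E n - A \<inter> E n" using E_subset_S by blast
    then show "openin (T n) ((topspace S - A) \<inter> E n)" using A_closed[of n] by (simp add: closedin_def)
  qed blast
  then have "openin Y (topspace S - A)" using openY by blast
  then have "openin S {x \<in> topspace S. g x \<in> topspace S - A}" by (rule openin_continuous_map_preimage[OF g(1)])
  moreover have "{x \<in> topspace S. g x \<in> topspace S - A} = topspace S - A"
    using g(2) unfolding topspace_S by auto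
  ultimately have "openin S (topspace S - A)" by simp
  moreover have "0 \<in> topspace S - A"
  proof -
    have "0 \<noteq> a j k" if "j \<in> J" for j k using a_notin[OF that order_refl, of k] zero_E[of j] by metis
    then show ?thesis using zero_S unfolding A_def by blast
  qed
  ultimately obtain w where w: "continuous_seminorm S w"
    "\<And>x. x \<in> topspace S \<Longrightarrow> w x < 1 \<Longrightarrow> x \<in> topspace S - A"
    using gauge_seminorm[OF lc_S] by blast
  note sw = continuous_seminormD(1)[OF lc_S w(1)]
  have "openin (T 0) {x \<in> E 0. w x < 1/2}" by (rule open_seminorm_ball_0[OF lc seminorm_S_restrict[OF w(1)]])
  moreover have "0 \<in> {x \<in> E 0. w x < 1/2}" using zero_E seminorm_on_zero[OF sw] by simp
  ultimately obtain N where N: "\<And>j. j \<ge> N \<Longrightarrow> U j \<subseteq> {x \<in> E 0. w x < 1/2}" using U(3) by meson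
  obtain j where j: "j \<ge> N" "j \<in> J" using jump_above[of N] by (auto simp: J_def)
  obtain k where k: "w (v j) / real (Suc k) < 1/2"
    using eventually_small_quotient[of "1/2" "w (v j)"] by auto
  have m: "u j k \<in> topspace S" "v j \<in> topspace S" using u0 v(1)[OF j(2)] E_subset_S by blast+
  have "w (a j k) \<le> w (u j k) + w (v j) / real (Suc k)"
    unfolding a_def using seminorm_onD(2)[OF sw m(1) subspace_scale[OF subspace_S m(2)], of "1 / real (Suc k)"]
      seminorm_onD(3)[OF sw m(2), of "1 / real (Suc k)"] by simp
  also have "w (u j k) < 1/2" using N[OF j(1)] us(2)[of j k] by blast
  also note k
  finally have "w (a j k) < 1" by simp
  then have "a j k \<notin> A" using w(2) m unfolding a_def
    by (metis DiffD2 subspace_S subspace_add subspace_scale)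
  then show False using j(2) by (auto simp: A_def)
qed

end

section \<open>Hilbertian seminorms on nuclear spaces\<close>

text \<open>The parallelogram law is used instead of an inner product because it passes to infima, which is how
  seminorms on the union are built; the inner product is recovered only at the end.\<close>

definition hilbertian :: "'a::real_vector set \<Rightarrow> ('a \<Rightarrow> real) \<Rightarrow> bool" where
  "hilbertian X p \<longleftrightarrow> seminorm_on X p \<and>
     (\<forall>x\<in>X. \<forall>y\<in>X. (p (x + y))\<^sup>2 + (p (x - y))\<^sup>2 = 2 * (p x)\<^sup>2 + 2 * (p y)\<^sup>2)"

lemma hilbertianD:
  assumes "hilbertian X p"
  shows "seminorm_on X p"
    "\<And>x y. x \<in> X \<Longrightarrow> y \<in> X \<Longrightarrow> (p (x + y))\<^sup>2 + (p (x - y))\<^sup>2 = 2 * (p x)\<^sup>2 + 2 * (p y)\<^sup>2"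
  using assms by (simp_all add: hilbertian_def)

lemma seminorm_CauchyD:
  assumes "seminorm_Cauchy X p z"
  shows "\<And>m. z m \<in> X" "\<And>e. e > 0 \<Longrightarrow> \<exists>M. \<forall>i\<ge>M. \<forall>j\<ge>M. p (z i - z j) < e"
  using assms by (auto simp: seminorm_Cauchy_def)

lemma completion_norm_limit:
  assumes p: "seminorm_on X p" and z: "seminorm_Cauchy X p z"
  shows "(\<lambda>m. p (z m)) \<longlonglongrightarrow> completion_norm p z"
proof -
  have zX: "z m \<in> X" for m using z by (auto simp: seminorm_Cauchy_def)
  have "Cauchy (\<lambda>m. p (z m))"
  proof (rule CauchyI)
    fix e :: real assume "0 < e"
    then obtain M where "\<forall>i\<ge>M. \<forall>j\<ge>M. p (z i - z j) < e" using seminorm_CauchyD(2)[OF z] by metis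
    then have M: "p (z i - z j) < e" if "i \<ge> M" "j \<ge> M" for i j using that by simp
    have "norm (p (z i) - p (z j)) < e" if "i \<ge> M" "j \<ge> M" for i j
      using M[OF that] M[OF that(2,1)] seminorm_on_triangle_minus(2)[OF p zX[of i] zX[of j]]
        seminorm_on_triangle_minus(2)[OF p zX[of j] zX[of i]] by (simp add: abs_less_iff)
    then show "\<exists>M. \<forall>m\<ge>M. \<forall>n\<ge>M. norm (p (z m) - p (z n)) < e" by blast
  qed
  then show ?thesis unfolding completion_norm_def
    by (simp add: Cauchy_convergent_iff convergent_LIMSEQ_iff)
qed

lemma seminorm_Cauchy_diff_scaleR:
  assumes p: "seminorm_on X p" and z: "seminorm_Cauchy X p z" and y: "seminorm_Cauchy X p y"
  shows "seminorm_Cauchy X p (\<lambda>m. z m - a *\<^sub>R y m)"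
  unfolding seminorm_Cauchy_def
proof (intro conjI allI impI)
  note X = seminorm_onD(1)[OF p]
  have zX: "z m \<in> X" and yX: "y m \<in> X" for m using z y by (auto simp: seminorm_Cauchy_def)
  show "range (\<lambda>m. z m - a *\<^sub>R y m) \<subseteq> X"
    using zX yX X by (auto intro: subspace_diff subspace_scale)
  fix e :: real assume e: "0 < e"
  define d where "d = e / (2 * (\<bar>a\<bar> + 1))"
  have d: "0 < d" using e by (simp add: d_def)
  have ad: "\<bar>a\<bar> * d \<le> e / 2" using e by (simp add: d_def field_simps)
  obtain M1 where M1: "\<forall>i\<ge>M1. \<forall>j\<ge>M1. p (z i - z j) < e/2"
    using seminorm_CauchyD(2)[OF z, of "e/2"] e by auto
  obtain M2 where M2: "\<forall>i\<ge>M2. \<forall>j\<ge>M2. p (y i - y j) < d"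
    using seminorm_CauchyD(2)[OF y d] by blast
  have "p ((z i - a *\<^sub>R y i) - (z j - a *\<^sub>R y j)) < e" if "i \<ge> max M1 M2" "j \<ge> max M1 M2" for i j
  proof -
    have m: "z i - z j \<in> X" "y i - y j \<in> X" using zX yX X by (auto intro: subspace_diff)
    have "p ((z i - a *\<^sub>R y i) - (z j - a *\<^sub>R y j)) = p ((z i - z j) - a *\<^sub>R (y i - y j))"
      by (simp add: algebra_simps)
    also have "\<dots> \<le> p (z i - z j) + \<bar>a\<bar> * p (y i - y j)"
      using seminorm_on_triangle_minus(1)[OF p m(1) subspace_scale[OF X m(2)], of a]
        seminorm_onD(3)[OF p m(2)] by simp
    also have "\<dots> \<le> p (z i - z j) + \<bar>a\<bar> * d"
    proof -
      have "p (y i - y j) \<le> d" using M2 that by (simp add: less_imp_le)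
      then show ?thesis by (intro add_left_mono mult_left_mono) auto
    qed
    also have "\<dots> < e/2 + e/2" using M1 that ad by (intro add_less_le_mono) auto
    finally show ?thesis by simp
  qed
  then show "\<exists>M. \<forall>i\<ge>M. \<forall>j\<ge>M. p ((z i - a *\<^sub>R y i) - (z j - a *\<^sub>R y j)) < e" by blast
qed

text \<open>Evaluate \<open>p\<close> on the nuclear expansion of \<open>x\<close>; the vectors of the expansion lie in the unit ball of the
  completion for \<open>p\<close>.\<close>

lemma nuclear_seminorm_le_series:
  fixes X :: "'a::real_vector set"
  assumes p: "seminorm_on X p" and q: "seminorm_on X q" and nuc: "nuclear_canonical_map X q p"
  obtains c :: "nat \<Rightarrow> real" and l :: "nat \<Rightarrow> 'a \<Rightarrow> real" where "summable (\<lambda>n. \<bar>c n\<bar>)" "\<And>n. linear_functional_on X (l n)"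
    "\<And>n x. x \<in> X \<Longrightarrow> \<bar>l n x\<bar> \<le> q x"
    "\<And>x. x \<in> X \<Longrightarrow> summable (\<lambda>n. \<bar>c n\<bar> * \<bar>l n x\<bar>)"
    "\<And>x. x \<in> X \<Longrightarrow> p x \<le> (\<Sum>n. \<bar>c n\<bar> * \<bar>l n x\<bar>)"
proof -
  note X = seminorm_onD(1)[OF p]
  obtain c :: "nat \<Rightarrow> real" and l :: "nat \<Rightarrow> 'a \<Rightarrow> real" and y :: "nat \<Rightarrow> nat \<Rightarrow> 'a" where
    c: "summable (\<lambda>n. \<bar>c n\<bar>)"
    and l': "\<forall>n. linear_functional_on X (l n) \<and> (\<forall>x\<in>X. \<bar>l n x\<bar> \<le> q x)"
    and y': "\<forall>n. seminorm_Cauchy X p (y n) \<and> completion_norm p (y n) \<le> 1"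
    and rep: "\<forall>x\<in>X. (\<lambda>N. completion_norm p (\<lambda>m. x - (\<Sum>n<N. (c n * l n x) *\<^sub>R y n m))) \<longlonglongrightarrow> 0"
    using nuc unfolding nuclear_canonical_map_def by (elim exE conjE)
  have l: "\<And>n. linear_functional_on X (l n)" "\<And>n x. x \<in> X \<Longrightarrow> \<bar>l n x\<bar> \<le> q x" using l' by simp_all
  have y: "\<And>n. seminorm_Cauchy X p (y n)" "\<And>n. completion_norm p (y n) \<le> 1" using y' by simp_all
  have sm: "summable (\<lambda>n. \<bar>c n\<bar> * \<bar>l n x\<bar>)" if "x \<in> X" for x
    by (rule summable_comparison_test'[OF summable_mult2[OF c, of "q x"], of 0])
       (simp add: mult_left_mono l(2)[OF that])
  have yX: "y n m \<in> X" for n m using y(1)[of n] by (auto simp: seminorm_Cauchy_def)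
  have "p x \<le> (\<Sum>n. \<bar>c n\<bar> * \<bar>l n x\<bar>)" if x: "x \<in> X" for x
  proof -
    define z where "z = (\<lambda>N m. x - (\<Sum>n<N. (c n * l n x) *\<^sub>R y n m))"
    have zC: "seminorm_Cauchy X p (z N)" for N
    proof (induction N)
      case 0
      then show ?case using x seminorm_on_zero[OF p] by (auto simp: seminorm_Cauchy_def z_def)
    next
      case (Suc N)
      have "z (Suc N) = (\<lambda>m. z N m - (c N * l N x) *\<^sub>R y N m)" by (auto simp: z_def)
      then show ?case using seminorm_Cauchy_diff_scaleR[OF p Suc y(1)] by simp
    qed
    have zX: "z N m \<in> X" for N m using zC[of N] by (auto simp: seminorm_Cauchy_def)
    have bound: "p x \<le> completion_norm p (z N) + (\<Sum>n. \<bar>c n\<bar> * \<bar>l n x\<bar>)" for N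
    proof -
      have "p x \<le> p (z N m) + (\<Sum>n<N. \<bar>c n * l n x\<bar> * p (y n m))" for m
      proof -
        have s: "(c n * l n x) *\<^sub>R y n m \<in> X" for n by (rule subspace_scale[OF X yX])
        have "p x = p (z N m + (\<Sum>n<N. (c n * l n x) *\<^sub>R y n m))" by (simp add: z_def)
        also have "\<dots> \<le> p (z N m) + p (\<Sum>n<N. (c n * l n x) *\<^sub>R y n m)"
          by (rule seminorm_onD(2)[OF p zX subspace_sum[OF X s]])
        also have "p (\<Sum>n<N. (c n * l n x) *\<^sub>R y n m) \<le> (\<Sum>n<N. p ((c n * l n x) *\<^sub>R y n m))"
          by (rule seminorm_on_sum[OF p s])
        also have "\<dots> = (\<Sum>n<N. \<bar>c n * l n x\<bar> * p (y n m))"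
          by (simp only: seminorm_onD(3)[OF p yX])
        finally show ?thesis by simp
      qed
      moreover have "(\<lambda>m. p (z N m) + (\<Sum>n<N. \<bar>c n * l n x\<bar> * p (y n m))) \<longlonglongrightarrow>
          completion_norm p (z N) + (\<Sum>n<N. \<bar>c n * l n x\<bar> * completion_norm p (y n))"
        by (intro tendsto_intros completion_norm_limit[OF p] zC y(1))
      ultimately have "p x \<le> completion_norm p (z N) + (\<Sum>n<N. \<bar>c n * l n x\<bar> * completion_norm p (y n))"
        by (intro LIMSEQ_le_const) auto
      also have "(\<Sum>n<N. \<bar>c n * l n x\<bar> * completion_norm p (y n)) \<le> (\<Sum>n<N. \<bar>c n\<bar> * \<bar>l n x\<bar>)"
        using mult_left_mono[OF y(2), of "\<bar>c n * l n x\<bar>" for n]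
        by (intro sum_mono) (simp add: abs_mult)
      also have "\<dots> \<le> (\<Sum>n. \<bar>c n\<bar> * \<bar>l n x\<bar>)" by (rule sum_le_suminf[OF sm[OF x]]) auto
      finally show ?thesis by simp
    qed
    have "(\<lambda>N. completion_norm p (z N) + (\<Sum>n. \<bar>c n\<bar> * \<bar>l n x\<bar>)) \<longlonglongrightarrow> 0 + (\<Sum>n. \<bar>c n\<bar> * \<bar>l n x\<bar>)"
      using rep[rule_format, OF x] by (intro tendsto_intros) (simp add: z_def)
    then have "p x \<le> 0 + (\<Sum>n. \<bar>c n\<bar> * \<bar>l n x\<bar>)"
      by (rule LIMSEQ_le_const) (use bound in blast)
    then show ?thesis by simp
  qed
  then show ?thesis using that[OF c l sm] by blast
qed

lemma linear_functional_onD: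
  assumes "linear_functional_on X l" "subspace X"
  shows "\<And>x y. x \<in> X \<Longrightarrow> y \<in> X \<Longrightarrow> l (x + y) = l x + l y"
    "\<And>c x. x \<in> X \<Longrightarrow> l (c *\<^sub>R x) = c * l x"
    "\<And>x y. x \<in> X \<Longrightarrow> y \<in> X \<Longrightarrow> l (x - y) = l x - l y"
proof -
  show add: "\<And>x y. x \<in> X \<Longrightarrow> y \<in> X \<Longrightarrow> l (x + y) = l x + l y"
    and sc: "\<And>c x. x \<in> X \<Longrightarrow> l (c *\<^sub>R x) = c * l x"
    using assms(1) by (auto simp: linear_functional_on_def)
  show "l (x - y) = l x - l y" if "x \<in> X" "y \<in> X" for x y
    using add[OF that(1) subspace_scale[OF assms(2) that(2), of "-1"]] sc[OF that(2), of "-1"] by simp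
qed

text \<open>By the Cauchy--Schwarz inequality with weights \<open>\<bar>c n\<bar>\<close> one may take
  \<open>h(x)\<^sup>2 = (\<Sum>\<bar>c n\<bar>) \<cdot> (\<Sum>\<bar>c n\<bar> \<cdot> l n x\<^sup>2)\<close>. All properties of \<open>h\<close> are inherited from the partial sums, which
  are Euclidean norms.\<close>

lemma hilbertian_series:
  assumes q: "seminorm_on X q" and c: "summable (\<lambda>n. \<bar>c n\<bar>)"
    and l: "\<And>n. linear_functional_on X (l n)" "\<And>n x. x \<in> X \<Longrightarrow> \<bar>l n x\<bar> \<le> q x"
  obtains h where "hilbertian X h" "\<And>x. x \<in> X \<Longrightarrow> (\<Sum>n. \<bar>c n\<bar> * \<bar>l n x\<bar>) \<le> h x"
    "\<And>x. x \<in> X \<Longrightarrow> h x \<le> (\<Sum>n. \<bar>c n\<bar>) * q x"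
proof -
  note X = seminorm_onD(1)[OF q]
  note lin = linear_functional_onD[OF l(1) X]
  define C where "C = (\<Sum>n. \<bar>c n\<bar>)"
  have C: "0 \<le> C" unfolding C_def by (rule suminf_nonneg[OF c]) simp
  define D where "D = (\<lambda>x n. \<bar>c n\<bar> * (l n x)\<^sup>2)"
  have l2: "(l n x)\<^sup>2 \<le> (q x)\<^sup>2" if "x \<in> X" for n x
    using power_mono[OF l(2)[OF that], of n 2] by simp
  have Dle: "D x n \<le> \<bar>c n\<bar> * (q x)\<^sup>2" if "x \<in> X" for n x
    unfolding D_def using l2[OF that] by (intro mult_left_mono) auto
  have D0: "0 \<le> D x n" for x n by (simp add: D_def)
  have Ds: "summable (D x)" if "x \<in> X" for x
    by (rule summable_comparison_test'[OF summable_mult2[OF c, of "(q x)\<^sup>2"], of 0])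
       (use Dle[OF that] D0 in simp)
  define h where "h = (\<lambda>x. sqrt C * sqrt (\<Sum>n. D x n))"
  define L where "L = (\<lambda>N x. L2_set (\<lambda>n. sqrt \<bar>c n\<bar> * l n x) {..<N})"
  define A where "A = (\<lambda>N. L2_set (\<lambda>n. sqrt \<bar>c n\<bar>) {..<N})"
  have L_lim: "(\<lambda>N. L N x) \<longlonglongrightarrow> sqrt (\<Sum>n. D x n)" if "x \<in> X" for x
  proof -
    have "L N x = sqrt (\<Sum>n<N. D x n)" for N
      by (simp add: L_def L2_set_def D_def power_mult_distrib)
    then show ?thesis using summable_LIMSEQ[OF Ds[OF that]] by (simp add: tendsto_real_sqrt)
  qed
  have A_lim: "A \<longlonglongrightarrow> sqrt C"
  proof -
    have "A = (\<lambda>N. sqrt (\<Sum>n<N. \<bar>c n\<bar>))" by (rule ext) (simp add: A_def L2_set_def)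
    then show ?thesis using summable_LIMSEQ[OF c] by (simp add: C_def tendsto_real_sqrt)
  qed
  have Lh: "(\<lambda>N. sqrt C * L N x) \<longlonglongrightarrow> h x" if "x \<in> X" for x
    unfolding h_def by (intro tendsto_intros L_lim[OF that])
  have hsq: "(h x)\<^sup>2 = C * (\<Sum>n. D x n)" if "x \<in> X" for x
    using C suminf_nonneg[OF Ds[OF that] D0] by (simp add: h_def power_mult_distrib)
  have sn: "seminorm_on X h"
  proof (rule seminorm_onI[OF X])
    fix x y assume x: "x \<in> X" and y: "y \<in> X"
    have "L N (x + y) \<le> L N x + L N y" for N
      unfolding L_def lin(1)[OF x y] distrib_left by (rule L2_set_triangle_ineq)
    then have "sqrt C * L N (x + y) \<le> sqrt C * L N x + sqrt C * L N y" for N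
      using mult_left_mono[of "L N (x + y)" "L N x + L N y" "sqrt C"] C by (simp add: distrib_left)
    then show "h (x + y) \<le> h x + h y"
      by (intro LIMSEQ_le[OF Lh[OF subspace_add[OF X x y]] tendsto_add[OF Lh[OF x] Lh[OF y]]]) auto
  next
    fix a x assume x: "x \<in> X"
    have "D (a *\<^sub>R x) = (\<lambda>n. a\<^sup>2 * D x n)"
      by (rule ext) (simp add: D_def lin(2)[OF x] power_mult_distrib)
    then show "h (a *\<^sub>R x) = \<bar>a\<bar> * h x"
      using suminf_mult[OF Ds[OF x], of "a\<^sup>2"] by (simp add: h_def real_sqrt_mult)
  qed
  have "hilbertian X h"
    unfolding hilbertian_def
  proof (intro conjI ballI sn)
    fix x y assume x: "x \<in> X" and y: "y \<in> X"
    have xy: "x + y \<in> X" "x - y \<in> X" using x y X by (auto intro: subspace_add subspace_diff)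
    have "D (x + y) n + D (x - y) n = 2 * D x n + 2 * D y n" for n
      by (simp add: D_def lin(1)[OF x y] lin(3)[OF x y] power2_eq_square algebra_simps)
    then have "(\<Sum>n. D (x + y) n) + (\<Sum>n. D (x - y) n) = 2 * (\<Sum>n. D x n) + 2 * (\<Sum>n. D y n)"
      using suminf_add[OF Ds[OF xy(1)] Ds[OF xy(2)]]
        suminf_add[OF summable_mult[OF Ds[OF x], of 2] summable_mult[OF Ds[OF y], of 2]]
        suminf_mult[OF Ds[OF x], of 2] suminf_mult[OF Ds[OF y], of 2] by simp
    then show "(h (x + y))\<^sup>2 + (h (x - y))\<^sup>2 = 2 * (h x)\<^sup>2 + 2 * (h y)\<^sup>2"
      unfolding hsq[OF x] hsq[OF y] hsq[OF xy(1)] hsq[OF xy(2)]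
      by (metis (no_types, lifting) distrib_left mult.left_commute)
  qed
  moreover have "(\<Sum>n. \<bar>c n\<bar> * \<bar>l n x\<bar>) \<le> h x" if x: "x \<in> X" for x
  proof -
    have "summable (\<lambda>n. \<bar>c n\<bar> * \<bar>l n x\<bar>)"
      by (rule summable_comparison_test'[OF summable_mult2[OF c, of "q x"], of 0])
         (simp add: mult_left_mono l(2)[OF x])
    moreover have "(\<Sum>n<N. \<bar>c n\<bar> * \<bar>l n x\<bar>) \<le> A N * L N x" for N
    proof -
      have "(\<Sum>n<N. \<bar>c n\<bar> * \<bar>l n x\<bar>) = (\<Sum>n<N. \<bar>sqrt \<bar>c n\<bar>\<bar> * \<bar>sqrt \<bar>c n\<bar> * l n x\<bar>)"
        by (rule sum.cong) (simp_all add: abs_mult mult.assoc[symmetric])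
      then show ?thesis unfolding A_def L_def by (simp only: L2_set_mult_ineq)
    qed
    ultimately show ?thesis unfolding h_def
      by (intro LIMSEQ_le[OF summable_LIMSEQ tendsto_mult[OF A_lim L_lim[OF x]]]) auto
  qed
  moreover have "h x \<le> C * q x" if x: "x \<in> X" for x
  proof -
    have "(\<Sum>n. D x n) \<le> (\<Sum>n. \<bar>c n\<bar> * (q x)\<^sup>2)"
      by (rule suminf_le[OF Dle[OF x] Ds[OF x] summable_mult2[OF c]])
    also have "\<dots> = C * (q x)\<^sup>2" using suminf_mult2[OF c] by (simp add: C_def)
    finally have "h x \<le> sqrt C * sqrt (C * (q x)\<^sup>2)"
      unfolding h_def using C by (intro mult_left_mono) auto
    then show ?thesis using C seminorm_on_nonneg[OF q x] by (simp add: real_sqrt_mult mult.assoc[symmetric])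
  qed
  ultimately show ?thesis using that unfolding C_def by blast
qed

lemma nuclear_hilbertian_seminorm:
  fixes T :: "'a::real_vector topology"
  assumes T: "nuclear_space T" and p: "continuous_seminorm T p"
  obtains h where "continuous_seminorm T h" "hilbertian (topspace T) h"
    "\<And>x. x \<in> topspace T \<Longrightarrow> p x \<le> h x"
proof -
  have lc: "lc_space T" using T by (simp add: nuclear_space_def hausdorff_lcs_def)
  obtain q where q: "continuous_seminorm T q" "nuclear_canonical_map (topspace T) q p"
    using T p unfolding nuclear_space_def by blast
  note sp = continuous_seminormD(1)[OF lc p] and sq = continuous_seminormD(1)[OF lc q(1)]
  obtain c :: "nat \<Rightarrow> real" and l :: "nat \<Rightarrow> 'a \<Rightarrow> real" where cl: "summable (\<lambda>n. \<bar>c n\<bar>)"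
    "\<And>n. linear_functional_on (topspace T) (l n)" "\<And>n x. x \<in> topspace T \<Longrightarrow> \<bar>l n x\<bar> \<le> q x"
    "\<And>x. x \<in> topspace T \<Longrightarrow> p x \<le> (\<Sum>n. \<bar>c n\<bar> * \<bar>l n x\<bar>)"
    by (rule nuclear_seminorm_le_series[OF sp sq q(2)]) blast
  obtain h where h: "hilbertian (topspace T) h"
    "\<And>x. x \<in> topspace T \<Longrightarrow> (\<Sum>n. \<bar>c n\<bar> * \<bar>l n x\<bar>) \<le> h x"
    "\<And>x. x \<in> topspace T \<Longrightarrow> h x \<le> (\<Sum>n. \<bar>c n\<bar>) * q x"
    by (rule hilbertian_series[of "topspace T" q c l, OF sq cl(1,2)]) (erule cl(3), rule that)
  show ?thesis
  proof (rule that[OF _ h(1)])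
    show "continuous_seminorm T h"
      by (rule dominated_seminorm_continuous[OF lc q(1) hilbertianD(1)[OF h(1)] h(3)])
    show "p x \<le> h x" if "x \<in> topspace T" for x
      using cl(4)[OF that] h(2)[OF that] by linarith
  qed
qed

lemma infinite_dimensional_kernel:
  assumes "infinite_dimensional X" "subspace X" "linear_functional_on X l"
  shows "infinite_dimensional {x \<in> X. l x = 0}" "subspace {x \<in> X. l x = 0}"
proof -
  note lin = linear_functional_onD[OF assms(3,2)]
  show "subspace {x \<in> X. l x = 0}"
    using assms(2) lin(1) lin(2)[of 0 0] lin(2) subspace_0[OF assms(2)] unfolding subspace_def by force
  show "infinite_dimensional {x \<in> X. l x = 0}"
    unfolding infinite_dimensional_def
  proof
    assume "\<exists>B. finite B \<and> {x \<in> X. l x = 0} \<subseteq> span B"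
    then obtain B where B: "finite B" "{x \<in> X. l x = 0} \<subseteq> span B" by blast
    show False
    proof (cases "\<exists>v\<in>X. l v \<noteq> 0")
      case True
      then obtain v where v: "v \<in> X" "l v \<noteq> 0" by blast
      have "x \<in> span (insert v B)" if x: "x \<in> X" for x
      proof -
        have "(l x / l v) *\<^sub>R v \<in> X" by (rule subspace_scale[OF assms(2) v(1)])
        then have "x - (l x / l v) *\<^sub>R v \<in> X" "l (x - (l x / l v) *\<^sub>R v) = 0"
          using lin(3)[OF x] lin(2)[OF v(1)] v x subspace_diff[OF assms(2)] by auto
        then show ?thesis using B(2) unfolding span_insert by blast
      qed
      then show False using assms(1) B(1) unfolding infinite_dimensional_def by blast
    next
      case False
      then have "X \<subseteq> span B" using B(2) by blast
      then show False using assms(1) B(1) unfolding infinite_dimensional_def by blast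
    qed
  qed
qed

text \<open>The kernel of a functional has codimension at most one, so intersecting finitely many kernels keeps
  the dimension infinite.\<close>

lemma common_zero_of_functionals:
  fixes l :: "nat \<Rightarrow> 'a::real_vector \<Rightarrow> real"
  assumes "infinite_dimensional X" "subspace X" "\<And>n. linear_functional_on X (l n)"
  shows "\<exists>x\<in>X. x \<noteq> 0 \<and> (\<forall>n<N. l n x = 0)"
proof -
  have "infinite_dimensional {x \<in> X. \<forall>n<N. l n x = 0} \<and> subspace {x \<in> X. \<forall>n<N. l n x = 0}"
  proof (induction N)
    case (Suc N)
    let ?Y = "{x \<in> X. \<forall>n<N. l n x = 0}"
    have l: "linear_functional_on ?Y (l N)" using assms(3)[of N] by (simp add: linear_functional_on_def)
    have "{x \<in> X. \<forall>n<Suc N. l n x = 0} = {x \<in> ?Y. l N x = 0}" by (auto simp: less_Suc_eq)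
    then show ?case
      using infinite_dimensional_kernel[OF Suc[THEN conjunct1] Suc[THEN conjunct2] l] by simp
  qed (use assms in simp)
  then have "\<not> {x \<in> X. \<forall>n<N. l n x = 0} \<subseteq> span {}"
    unfolding infinite_dimensional_def using finite.emptyI by blast
  then show ?thesis by auto
qed

text \<open>If every continuous seminorm were bounded on \<open>U\<close>, then a single seminorm \<open>p\<close> would dominate all of them up to
  constants, also the seminorm \<open>q\<close> in the nuclear expansion of \<open>p\<close>. A nonzero vector killed by the first
  functionals of the expansion then satisfies \<open>p x \<le> p x / 2\<close>, so that all seminorms vanish at \<open>x\<close>.\<close>

lemma nuclear_unbounded_seminorm:
  fixes T :: "'a::real_vector topology"
  assumes T: "nuclear_space T" and inf: "infinite_dimensional (topspace T)"
    and U: "openin T U" "0 \<in> U"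
  shows "\<exists>p. continuous_seminorm T p \<and> (\<forall>K. \<exists>u\<in>U. K < p u)"
proof (rule ccontr)
  assume "\<not> ?thesis"
  then have bdd: "\<exists>K. \<forall>u\<in>U. p u \<le> K" if "continuous_seminorm T p" for p
    using that by (meson not_le)
  let ?X = "topspace T"
  have H: "hausdorff_lcs T" and lc: "lc_space T" using T by (auto simp: nuclear_space_def hausdorff_lcs_def)
  obtain p where p: "continuous_seminorm T p" "\<And>x. x \<in> ?X \<Longrightarrow> p x < 1 \<Longrightarrow> x \<in> U"
    using gauge_seminorm[OF lc U] by blast
  note sp = continuous_seminormD(1)[OF lc p(1)]
  have dom: "\<exists>K. \<forall>x\<in>?X. r x \<le> K * p x" if r: "continuous_seminorm T r" for r
  proof -
    obtain K where K: "\<forall>u\<in>U. r u \<le> K" using bdd[OF r] by blast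
    have "r x \<le> K * p x" if "x \<in> ?X" for x
      by (rule seminorm_le_by_scaling[OF sp continuous_seminormD(1)[OF lc r] _ that])
         (use K p(2) in blast)
    then show ?thesis by blast
  qed
  obtain q where q: "continuous_seminorm T q" "nuclear_canonical_map ?X q p"
    using T p(1) unfolding nuclear_space_def by blast
  note sq = continuous_seminormD(1)[OF lc q(1)]
  obtain K where K: "\<forall>x\<in>?X. q x \<le> K * p x" using dom[OF q(1)] by blast
  obtain c :: "nat \<Rightarrow> real" and l :: "nat \<Rightarrow> 'a \<Rightarrow> real" where cl: "summable (\<lambda>n. \<bar>c n\<bar>)"
    "\<And>n. linear_functional_on ?X (l n)" "\<And>n x. x \<in> ?X \<Longrightarrow> \<bar>l n x\<bar> \<le> q x"
    "\<And>x. x \<in> ?X \<Longrightarrow> summable (\<lambda>n. \<bar>c n\<bar> * \<bar>l n x\<bar>)"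
    "\<And>x. x \<in> ?X \<Longrightarrow> p x \<le> (\<Sum>n. \<bar>c n\<bar> * \<bar>l n x\<bar>)"
    by (rule nuclear_seminorm_le_series[OF sp sq q(2)]) blast
  define e where "e = 1 / (2 * (\<bar>K\<bar> + 1))"
  have e: "e > 0" by (simp add: e_def)
  have eK: "e * \<bar>K\<bar> \<le> 1/2" by (simp add: e_def field_simps)
  \<comment> \<open>The tail beyond \<open>N\<close> contributes at most \<open>e \<cdot> q x \<le> p x / 2\<close>.\<close>
  obtain N where N: "\<bar>\<Sum>i. \<bar>c (i + N)\<bar>\<bar> < e"
    using suminf_exist_split[OF e cl(1)] by auto
  obtain x where x: "x \<in> ?X" "x \<noteq> 0" "\<And>n. n < N \<Longrightarrow> l n x = 0"
    using common_zero_of_functionals[of ?X l N, OF inf lc_spaceD(1)[OF lc] cl(2)] by auto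
  have q0: "0 \<le> q x" and p0: "0 \<le> p x" by (rule seminorm_on_nonneg[OF sq x(1)] seminorm_on_nonneg[OF sp x(1)])+
  have tail: "summable (\<lambda>i. \<bar>c (i + N)\<bar>)" by (rule summable_ignore_initial_segment[OF cl(1)])
  have "p x \<le> (\<Sum>n. \<bar>c n\<bar> * \<bar>l n x\<bar>)" by (rule cl(5)[OF x(1)])
  also have "\<dots> = (\<Sum>i. \<bar>c (i + N)\<bar> * \<bar>l (i + N) x\<bar>)"
    using suminf_split_initial_segment[OF cl(4)[OF x(1)], of N] x(3) by simp
  also have "\<dots> \<le> (\<Sum>i. \<bar>c (i + N)\<bar> * q x)"
    using cl(3)[OF x(1)] cl(4)[OF x(1)] tail
    by (intro suminf_le summable_mult2 mult_left_mono) (auto simp: summable_iff_shift[of "\<lambda>n. \<bar>c n\<bar> * \<bar>l n x\<bar>"])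
  also have "\<dots> = (\<Sum>i. \<bar>c (i + N)\<bar>) * q x" using suminf_mult2[OF tail] by simp
  also have "\<dots> \<le> e * (\<bar>K\<bar> * p x)"
  proof (intro mult_mono)
    have "q x \<le> K * p x" using K x(1) by blast
    also have "\<dots> \<le> \<bar>K\<bar> * p x" using p0 by (intro mult_right_mono) auto
    finally show "q x \<le> \<bar>K\<bar> * p x" .
  qed (use N e q0 in auto)
  also have "\<dots> \<le> 1/2 * p x" using mult_right_mono[OF eK p0] by (simp add: mult.assoc)
  finally have "p x = 0" using p0 by simp
  obtain r where r: "continuous_seminorm T r" "r x > 0"
    using hausdorff_lcs_separating_seminorm[OF H x(1,2)] by blast
  obtain K' where "\<forall>x\<in>?X. r x \<le> K' * p x" using dom[OF r(1)] by blast
  then have "r x \<le> K' * p x" using x(1) by blast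
  then show False using r(2) \<open>p x = 0\<close> by simp
qed

section \<open>Hilbertian seminorms on the locally convex direct limit\<close>

text \<open>The parallelogram inequality passes to the infimum; applied to \<open>x + y\<close> and \<open>x - y\<close> it is the reverse
  inequality. Here \<open>N x\<close> is the set of values over which the infimum is taken.\<close>

lemma hilbertian_Inf:
  fixes N :: "'a::real_vector \<Rightarrow> real set"
  assumes X: "subspace X"
    and ne: "\<And>x. x \<in> X \<Longrightarrow> N x \<noteq> {}"
    and nonneg: "\<And>x a. a \<in> N x \<Longrightarrow> 0 \<le> a"
    and scale: "\<And>c x a. a \<in> N x \<Longrightarrow> \<bar>c\<bar> * a \<in> N (c *\<^sub>R x)"
    and par: "\<And>x y a b. a \<in> N x \<Longrightarrow> b \<in> N y \<Longrightarrow> \<exists>s\<in>N (x + y). \<exists>t\<in>N (x - y).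
      s \<le> a + b \<and> s\<^sup>2 + t\<^sup>2 \<le> 2 * a\<^sup>2 + 2 * b\<^sup>2"
  shows "hilbertian X (\<lambda>x. Inf (N x))"
proof -
  define q where "q = (\<lambda>x. Inf (N x))"
  have bdd: "bdd_below (N x)" for x using nonneg by (rule bdd_belowI)
  have le: "q x \<le> a" if "a \<in> N x" for x a unfolding q_def by (rule cInf_lower[OF that bdd])
  have q0: "0 \<le> q x" if "x \<in> X" for x unfolding q_def by (rule cInf_greatest[OF ne[OF that] nonneg])
  have appr: "\<exists>a\<in>N x. a < q x + e" if x: "x \<in> X" and e: "0 < e" for x e
    using cInf_lessD[OF ne[OF x], of "q x + e"] e unfolding q_def by auto
  have sle: "q (c *\<^sub>R x) \<le> \<bar>c\<bar> * q x" if x: "x \<in> X" for c x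
  proof (rule field_le_epsilon)
    fix e :: real assume e: "0 < e"
    define d where "d = e / (\<bar>c\<bar> + 1)"
    have d: "0 < d" "\<bar>c\<bar> * d \<le> e" using e by (auto simp: d_def field_simps)
    obtain a where a: "a \<in> N x" "a < q x + d" using appr[OF x d(1)] by blast
    have "q (c *\<^sub>R x) \<le> \<bar>c\<bar> * a" by (rule le[OF scale[OF a(1)]])
    also have "\<dots> \<le> \<bar>c\<bar> * (q x + d)" using a(2) by (intro mult_left_mono) auto
    finally show "q (c *\<^sub>R x) \<le> \<bar>c\<bar> * q x + e" using d(2) by (simp add: distrib_left)
  qed
  have hom: "q (c *\<^sub>R x) = \<bar>c\<bar> * q x" if x: "x \<in> X" for c x
  proof (cases "c = 0")
    case True
    have "q (0 *\<^sub>R x) \<le> 0" using sle[OF x, of 0] by simp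
    then show ?thesis using q0[OF subspace_0[OF X]] True by simp
  next
    case False
    have "q ((1/c) *\<^sub>R (c *\<^sub>R x)) \<le> \<bar>1/c\<bar> * q (c *\<^sub>R x)" by (rule sle[OF subspace_scale[OF X x]])
    then have "\<bar>c\<bar> * q x \<le> q (c *\<^sub>R x)" using False by (simp add: field_simps)
    then show ?thesis using sle[OF x, of c] by linarith
  qed
  have tri: "q (x + y) \<le> q x + q y" if x: "x \<in> X" and y: "y \<in> X" for x y
  proof (rule field_le_epsilon)
    fix e :: real assume e: "0 < e"
    obtain a b where ab: "a \<in> N x" "a < q x + e/2" "b \<in> N y" "b < q y + e/2"
      using appr[OF x, of "e/2"] appr[OF y, of "e/2"] e by auto
    obtain s where "s \<in> N (x + y)" "s \<le> a + b" using par[OF ab(1,3)] by blast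
    then show "q (x + y) \<le> q x + q y + e" using le[of s "x + y"] ab by linarith
  qed
  have parle: "(q (x + y))\<^sup>2 + (q (x - y))\<^sup>2 \<le> 2 * (q x)\<^sup>2 + 2 * (q y)\<^sup>2" if x: "x \<in> X" and y: "y \<in> X" for x y
  proof -
    have xy: "x + y \<in> X" "x - y \<in> X" using x y X by (auto intro: subspace_add subspace_diff)
    have *: "(q (x + y))\<^sup>2 + (q (x - y))\<^sup>2 \<le> 2 * (q x + e)\<^sup>2 + 2 * (q y + e)\<^sup>2" if e: "0 < e" for e
    proof -
      obtain a b where ab: "a \<in> N x" "a < q x + e" "b \<in> N y" "b < q y + e"
        using appr[OF x e] appr[OF y e] by auto
      obtain s t where st: "s \<in> N (x + y)" "t \<in> N (x - y)" "s\<^sup>2 + t\<^sup>2 \<le> 2 * a\<^sup>2 + 2 * b\<^sup>2"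
        using par[OF ab(1,3)] by blast
      have "(q (x + y))\<^sup>2 \<le> s\<^sup>2" "(q (x - y))\<^sup>2 \<le> t\<^sup>2"
        using le[OF st(1)] le[OF st(2)] q0[OF xy(1)] q0[OF xy(2)] by (auto intro: power_mono)
      moreover have "a\<^sup>2 \<le> (q x + e)\<^sup>2" "b\<^sup>2 \<le> (q y + e)\<^sup>2"
        using ab nonneg[OF ab(1)] nonneg[OF ab(3)] by (auto intro: power_mono)
      ultimately show ?thesis using st(3) by linarith
    qed
    have "((\<lambda>e. 2 * (q x + e)\<^sup>2 + 2 * (q y + e)\<^sup>2) \<longlongrightarrow> 2 * (q x + 0)\<^sup>2 + 2 * (q y + 0)\<^sup>2) (at_right 0)"
      by (intro tendsto_intros)
    moreover have "eventually (\<lambda>e. (q (x + y))\<^sup>2 + (q (x - y))\<^sup>2 \<le> 2 * (q x + e)\<^sup>2 + 2 * (q y + e)\<^sup>2) (at_right 0)"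
      unfolding eventually_at_right_field using * zero_less_one by blast
    ultimately have "(q (x + y))\<^sup>2 + (q (x - y))\<^sup>2 \<le> 2 * (q x + 0)\<^sup>2 + 2 * (q y + 0)\<^sup>2"
      by (rule tendsto_lowerbound) simp
    then show ?thesis by simp
  qed
  have "hilbertian X q"
    unfolding hilbertian_def
  proof (intro conjI ballI)
    show "seminorm_on X q" by (rule seminorm_onI[OF X tri hom])
    fix x y assume x: "x \<in> X" and y: "y \<in> X"
    have xy: "x + y \<in> X" "x - y \<in> X" using x y X by (auto intro: subspace_add subspace_diff)
    have "(x + y) + (x - y) = 2 *\<^sub>R x" "(x + y) - (x - y) = 2 *\<^sub>R y" by (simp_all add: scaleR_2)
    then have "(2 * q x)\<^sup>2 + (2 * q y)\<^sup>2 \<le> 2 * (q (x + y))\<^sup>2 + 2 * (q (x - y))\<^sup>2"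
      using parle[OF xy] hom[OF x, of 2] hom[OF y, of 2] by simp
    then show "(q (x + y))\<^sup>2 + (q (x - y))\<^sup>2 = 2 * (q x)\<^sup>2 + 2 * (q y)\<^sup>2"
      using parle[OF x y] by (simp add: power_mult_distrib)
  qed
  then show ?thesis by (simp add: q_def)
qed

text \<open>The quotient seminorm of the Hilbert direct sum of the \<open>(V i, h i)\<close> under the addition map onto the union.\<close>

lemma hilbertian_infimum_over_decompositions:
  fixes V :: "nat \<Rightarrow> 'a::real_vector set"
  assumes mono: "\<And>i j. i \<le> j \<Longrightarrow> V i \<subseteq> V j" and h: "\<And>i. hilbertian (V i) (h i)"
  obtains q where "hilbertian (\<Union>i. V i) q" "\<And>i x. x \<in> V i \<Longrightarrow> q x \<le> h i x"
    "\<And>x c. x \<in> (\<Union>i. V i) \<Longrightarrow>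
      (\<forall>n xs. (\<forall>i. xs i \<in> V i) \<longrightarrow> x = (\<Sum>i<n. xs i) \<longrightarrow> c \<le> L2_set (\<lambda>i. h i (xs i)) {..<n}) \<Longrightarrow> c \<le> q x"
proof -
  let ?X = "\<Union>i. V i"
  note sh = hilbertianD(1)[OF h]
  note sV = seminorm_onD(1)[OF sh]
  have V0: "0 \<in> V i" for i by (rule subspace_0[OF sV])
  have X: "subspace ?X"
    unfolding subspace_def
  proof (intro conjI ballI allI)
    fix x y assume "x \<in> ?X" "y \<in> ?X"
    then obtain i j where "x \<in> V i" "y \<in> V j" by blast
    then have "x \<in> V (max i j)" "y \<in> V (max i j)" using mono[of i "max i j"] mono[of j "max i j"] by auto
    then show "x + y \<in> ?X" using subspace_add[OF sV] by blast
  qed (use V0 subspace_scale[OF sV] in blast)+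
  define L where "L = (\<lambda>n xs. L2_set (\<lambda>i. h i (xs i)) {..<n})"
  \<comment> \<open>Requiring \<open>xs i = 0\<close> for \<open>i \<ge> n\<close> allows two decompositions to be brought to the same length.\<close>
  define dec where "dec = (\<lambda>x xs n. (\<forall>i. xs i \<in> V i) \<and> (\<forall>i\<ge>n. xs i = 0) \<and> x = (\<Sum>i<n::nat. xs i))"
  define N where "N = (\<lambda>x. {a. \<exists>xs n. dec x xs n \<and> a = L n xs})"
  have pad: "dec x xs k \<and> L k xs = L n xs" if "dec x xs n" "n \<le> k" for x xs n k
  proof
    have z: "\<And>i. i \<in> {..<k} - {..<n} \<Longrightarrow> xs i = 0" using that(1) by (auto simp: dec_def)
    have "(\<Sum>i<n. xs i) = (\<Sum>i<k. xs i)" by (rule sum.mono_neutral_left) (use that z in auto)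
    then show "dec x xs k" using that by (auto simp: dec_def)
    have "(\<Sum>i<n. (h i (xs i))\<^sup>2) = (\<Sum>i<k. (h i (xs i))\<^sup>2)"
      by (rule sum.mono_neutral_left) (use that z seminorm_on_zero[OF sh] in auto)
    then show "L k xs = L n xs" by (simp add: L_def L2_set_def)
  qed
  have Lsq: "(L n xs)\<^sup>2 = (\<Sum>i<n. (h i (xs i))\<^sup>2)" for n xs by (simp add: L_def L2_set_def sum_nonneg)
  have hil: "hilbertian ?X (\<lambda>x. Inf (N x))"
  proof (rule hilbertian_Inf[OF X])
    fix x assume "x \<in> ?X"
    then obtain i where i: "x \<in> V i" by blast
    have "dec x (\<lambda>k. if k = i then x else 0) (Suc i)" using i V0 by (auto simp: dec_def)
    then show "N x \<noteq> {}" by (auto simp: N_def)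
  next
    fix x a assume "a \<in> N x" then show "0 \<le> a" by (auto simp: N_def L_def)
  next
    fix c x a assume "a \<in> N x"
    then obtain xs n where d: "dec x xs n" and a: "a = L n xs" by (auto simp: N_def)
    have "dec (c *\<^sub>R x) (\<lambda>i. c *\<^sub>R xs i) n" using d subspace_scale[OF sV] by (auto simp: dec_def scaleR_sum_right)
    moreover have "\<bar>c\<bar> * a = L n (\<lambda>i. c *\<^sub>R xs i)"
    proof -
      have "h i (c *\<^sub>R xs i) = \<bar>c\<bar> * h i (xs i)" for i
        by (rule seminorm_onD(3)[OF sh]) (use d in \<open>simp add: dec_def\<close>)
      then show ?thesis by (simp add: a L_def L2_set_right_distrib)
    qed
    ultimately show "\<bar>c\<bar> * a \<in> N (c *\<^sub>R x)" by (auto simp: N_def)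
  next
    fix x y a b assume "a \<in> N x" "b \<in> N y"
    then obtain xs n ys m where d: "dec x xs n" "dec y ys m" and ab: "a = L n xs" "b = L m ys"
      by (auto simp: N_def)
    let ?k = "max n m"
    have xk: "dec x xs ?k" "a = L ?k xs" and yk: "dec y ys ?k" "b = L ?k ys"
      using pad[OF d(1), of ?k] pad[OF d(2), of ?k] ab by simp_all
    have xV: "xs i \<in> V i" and yV: "ys i \<in> V i" for i using xk yk by (auto simp: dec_def)
    let ?s = "L ?k (\<lambda>i. xs i + ys i)" and ?t = "L ?k (\<lambda>i. xs i - ys i)"
    have "dec (x + y) (\<lambda>i. xs i + ys i) ?k" "dec (x - y) (\<lambda>i. xs i - ys i) ?k"
      using xk yk subspace_add[OF sV] subspace_diff[OF sV]
      by (auto simp: dec_def sum.distrib sum_subtractf)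
    then have "?s \<in> N (x + y)" "?t \<in> N (x - y)" by (auto simp: N_def)
    moreover have "?s \<le> a + b"
    proof -
      have "?s \<le> L2_set (\<lambda>i. h i (xs i) + h i (ys i)) {..<?k}"
        unfolding L_def by (rule L2_set_mono)
          (use seminorm_onD(2)[OF sh xV yV] seminorm_on_nonneg[OF sh] subspace_add[OF sV xV yV] in auto)
      also have "\<dots> \<le> a + b" unfolding xk(2) yk(2) L_def by (rule L2_set_triangle_ineq)
      finally show ?thesis .
    qed
    moreover have "?s\<^sup>2 + ?t\<^sup>2 \<le> 2 * a\<^sup>2 + 2 * b\<^sup>2"
      unfolding xk(2) yk(2) Lsq
      by (simp add: sum.distrib[symmetric] hilbertianD(2)[OF h xV yV] sum_distrib_left)
    ultimately show "\<exists>s\<in>N (x + y). \<exists>t\<in>N (x - y). s \<le> a + b \<and> s\<^sup>2 + t\<^sup>2 \<le> 2 * a\<^sup>2 + 2 * b\<^sup>2" by blast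
  qed
  show ?thesis
  proof (rule that[OF hil])
    fix i x assume x: "x \<in> V i"
    let ?xs = "\<lambda>k. if k = i then x else 0"
    have "dec x ?xs (Suc i)" using x V0 by (auto simp: dec_def)
    then have "L (Suc i) ?xs \<in> N x" by (auto simp: N_def)
    moreover have "L (Suc i) ?xs = h i x"
    proof -
      have "(\<Sum>k<Suc i. (h k (?xs k))\<^sup>2) = (\<Sum>k<Suc i. if k = i then (h i x)\<^sup>2 else 0)"
        by (rule sum.cong) (auto simp: seminorm_on_zero[OF sh])
      then have "(\<Sum>k<Suc i. (h k (?xs k))\<^sup>2) = (h i x)\<^sup>2" by simp
      then show ?thesis using seminorm_on_nonneg[OF sh x] unfolding L_def L2_set_def by simp
    qed
    ultimately have "h i x \<in> N x" by simp
    then show "Inf (N x) \<le> h i x"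
      by (rule cInf_lower) (rule bdd_belowI[of _ 0], auto simp: N_def L_def)
  next
    fix x c assume x: "x \<in> ?X"
      and c: "\<forall>n xs. (\<forall>i. xs i \<in> V i) \<longrightarrow> x = (\<Sum>i<n. xs i) \<longrightarrow> c \<le> L2_set (\<lambda>i. h i (xs i)) {..<n}"
    obtain i where i: "x \<in> V i" using x by blast
    have "dec x (\<lambda>k. if k = i then x else 0) (Suc i)" using i V0 by (auto simp: dec_def)
    then have "N x \<noteq> {}" by (auto simp: N_def)
    then show "c \<le> Inf (N x)"
    proof (rule cInf_greatest)
      fix a assume "a \<in> N x"
      then obtain xs n where "dec x xs n" "a = L n xs" by (auto simp: N_def)
      then show "c \<le> a" using c by (simp add: dec_def L_def)
    qed
  qed
qed

context ascending_lcs
begin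

lemma incl: "m \<le> n \<Longrightarrow> continuous_map (T m) (T n) (\<lambda>x. x)"
  using continuous_map_from_subtopology[OF continuous_map_id[unfolded id_def], of "T n" "E m"] induced_le[of m n]
  by simp

lemma zero_seminorm: "continuous_seminorm (T i) (\<lambda>_. 0)" "hilbertian (E i) (\<lambda>_. 0)"
  using subspace_E by (auto simp: continuous_seminorm_def hilbertian_def seminorm_on_def)

text \<open>The \<open>h i\<close> are chosen with \<open>2\<^sup>i\<^sup>+\<^sup>1 p i \<le> h i\<close>, so that an \<open>\<ell>\<^sup>1\<close>-sum of the \<open>p i\<close> is bounded by the
  \<open>\<ell>\<^sup>2\<close>-sum of the \<open>h i\<close>. A lower bound for \<open>q x\<close> thus needs to be checked for \<open>\<ell>\<^sup>1\<close>-sums only, where the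
  triangle inequality applies. Where \<open>p i\<close> vanishes, so does \<open>h i\<close>.\<close>

lemma hilbertian_seminorm_from_family:
  assumes nuc: "\<And>n. nuclear_space (T n)" and p: "\<And>i. continuous_seminorm (T i) (p i)"
  obtains q where "continuous_seminorm S q" "hilbertian (topspace S) q"
    "\<And>i x. \<forall>y\<in>E i. p i y = 0 \<Longrightarrow> x \<in> E i \<Longrightarrow> q x = 0"
    "\<And>x c. x \<in> topspace S \<Longrightarrow> (\<forall>n xs. (\<forall>i. xs i \<in> E i) \<longrightarrow> x = (\<Sum>i<n. xs i) \<longrightarrow>
       c \<le> (\<Sum>i<n. p i (xs i))) \<Longrightarrow> c \<le> q x"
proof -
  have "\<exists>h. continuous_seminorm (T i) h \<and> hilbertian (E i) h \<and> (\<forall>x\<in>E i. 2 ^ Suc i * p i x \<le> h x) \<and>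
      ((\<forall>x\<in>E i. p i x = 0) \<longrightarrow> (\<forall>x\<in>E i. h x = 0))" for i
  proof (cases "\<forall>x\<in>E i. p i x = 0")
    case True
    then show ?thesis using zero_seminorm[of i] by (intro exI[of _ "\<lambda>_. 0"]) simp
  next
    case False
    have "continuous_seminorm (T i) (\<lambda>x. 2 ^ Suc i * p i x)"
      by (rule continuous_seminorm_scale[OF lc p]) simp
    then obtain h where h: "continuous_seminorm (T i) h" "hilbertian (E i) h"
      "\<And>x. x \<in> E i \<Longrightarrow> 2 ^ Suc i * p i x \<le> h x"
      by (rule nuclear_hilbertian_seminorm[OF nuc]) (rule that)
    show ?thesis by (rule exI[of _ h]) (use False h in blast)
  qed
  then obtain h where h: "\<And>i. continuous_seminorm (T i) (h i)" "\<And>i. hilbertian (E i) (h i)"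
    "\<And>i x. x \<in> E i \<Longrightarrow> 2 ^ Suc i * p i x \<le> h i x"
    "\<And>i. (\<forall>x\<in>E i. p i x = 0) \<longrightarrow> (\<forall>x\<in>E i. h i x = 0)" by metis
  obtain q where q: "hilbertian (topspace S) q" "\<And>i x. x \<in> E i \<Longrightarrow> q x \<le> h i x"
    "\<And>x c. x \<in> topspace S \<Longrightarrow> (\<forall>n xs. (\<forall>i. xs i \<in> E i) \<longrightarrow> x = (\<Sum>i<n. xs i) \<longrightarrow>
       c \<le> L2_set (\<lambda>i. h i (xs i)) {..<n}) \<Longrightarrow> c \<le> q x"
    by (rule hilbertian_infimum_over_decompositions[of E h, OF _ h(2), folded topspace_S]) (erule E_mono, rule that)
  note sq = hilbertianD(1)[OF q(1)]
  show ?thesis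
  proof (rule that[OF _ q(1)])
    show "continuous_seminorm S q"
    proof (rule direct_limit_seminorm_continuous[OF lc limit_topology sq])
      fix i show "continuous_seminorm (T i) q"
        by (rule dominated_seminorm_continuous[OF lc h(1) seminorm_on_subset[OF sq subspace_E E_subset_S], of i 1])
           (use q(2) in simp)
    qed
    fix i x assume "\<forall>y\<in>E i. p i y = 0" and x: "x \<in> E i"
    then have "h i x = 0" using h(4)[of i] by blast
    then show "q x = 0" using q(2)[OF x] seminorm_on_nonneg[OF sq, of x] x E_subset_S by force
  next
    fix x c assume x: "x \<in> topspace S"
      and c: "\<forall>n xs. (\<forall>i. xs i \<in> E i) \<longrightarrow> x = (\<Sum>i<n. xs i) \<longrightarrow> c \<le> (\<Sum>i<n. p i (xs i))"
    show "c \<le> q x"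
    proof (rule q(3)[OF x], intro allI impI)
      fix n xs assume xs: "\<forall>i. xs i \<in> E i" "x = (\<Sum>i<n. xs i)"
      define L where "L = L2_set (\<lambda>i. h i (xs i)) {..<n}"
      have L: "0 \<le> L" by (simp add: L_def)
      have "p i (xs i) \<le> (1/2) ^ Suc i * L" if "i < n" for i
      proof -
        have "2 ^ Suc i * p i (xs i) \<le> L"
          using order_trans[OF h(3)[OF xs(1)[rule_format, of i]] member_le_L2_set[of "{..<n}" i "\<lambda>i. h i (xs i)"]] that
          by (simp add: L_def)
        then show ?thesis by (simp add: field_simps power_divide)
      qed
      then have "(\<Sum>i<n. p i (xs i)) \<le> (\<Sum>i<n. (1/2) ^ Suc i * L)" by (intro sum_mono) simp
      also have "\<dots> = (1 - (1/2) ^ n) * L" by (induction n) (simp_all add: algebra_simps)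
      also have "\<dots> \<le> 1 * L" using L by (intro mult_right_mono) auto
      finally show "c \<le> L2_set (\<lambda>i. h i (xs i)) {..<n}" using c xs unfolding L_def by fastforce
    qed
  qed
qed

lemma hilbertian_seminorm_dominating:
  assumes nuc: "\<And>n. nuclear_space (T n)" and g: "continuous_seminorm S g"
  obtains q where "continuous_seminorm S q" "hilbertian (topspace S) q" "\<And>x. x \<in> topspace S \<Longrightarrow> g x \<le> q x"
proof -
  obtain q where q: "continuous_seminorm S q" "hilbertian (topspace S) q"
    "\<And>x c. x \<in> topspace S \<Longrightarrow> (\<forall>n xs. (\<forall>i. xs i \<in> E i) \<longrightarrow> x = (\<Sum>i<n. xs i) \<longrightarrow>
       c \<le> (\<Sum>i<n. g (xs i))) \<Longrightarrow> c \<le> q x"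
    by (rule hilbertian_seminorm_from_family[OF nuc, of "\<lambda>_. g", OF seminorm_S_restrict[OF g]]) (rule that)
  show ?thesis
  proof (rule that[OF q(1,2)])
    fix x assume x: "x \<in> topspace S"
    show "g x \<le> q x"
    proof (rule q(3)[OF x], intro allI impI)
      fix n xs assume "\<forall>i. xs i \<in> E i" "x = (\<Sum>i<n. xs i)"
      then show "g x \<le> (\<Sum>i<n. g (xs i))"
        using seminorm_on_sum[OF continuous_seminormD(1)[OF lc_S g], of "{..<n}" xs] E_subset_S by blast
    qed
  qed
qed

text \<open>Since \<open>P j\<close> is \<open>p\<close> for \<open>j \<le> m\<close>, it lives on the step with index \<open>max m j\<close>.\<close>

lemma increasing_seminorms:
  assumes p: "continuous_seminorm (T m) p"
  obtains P where "\<And>j. continuous_seminorm (T (max m j)) (P j)" "\<And>j. j \<le> m \<Longrightarrow> P j = p"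
    "\<And>j x. x \<in> E (max m j) \<Longrightarrow> P j x \<le> P (Suc j) x"
proof -
  have "\<exists>Q. \<forall>k. (continuous_seminorm (T (m + k)) (Q k) \<and> (k = 0 \<longrightarrow> Q k = p)) \<and>
      (\<forall>x\<in>E (m + k). Q k x \<le> Q (Suc k) x)"
  proof (rule dependent_nat_choice)
    show "\<exists>r. continuous_seminorm (T (m + 0)) r \<and> (0 = (0::nat) \<longrightarrow> r = p)" using p by simp
    fix r k assume "continuous_seminorm (T (m + k)) r \<and> (k = 0 \<longrightarrow> r = p)"
    then obtain r' where "continuous_seminorm (T (m + Suc k)) r'" "\<And>x. x \<in> E (m + k) \<Longrightarrow> r x \<le> r' x"
      using seminorm_dominated_above[of "m + k" "m + Suc k" r] by auto
    then show "\<exists>r'. (continuous_seminorm (T (m + Suc k)) r' \<and> (Suc k = 0 \<longrightarrow> r' = p)) \<and>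
        (\<forall>x\<in>E (m + k). r x \<le> r' x)" by blast
  qed
  then obtain Q where Q: "\<And>k. continuous_seminorm (T (m + k)) (Q k)" "Q 0 = p"
    "\<And>k x. x \<in> E (m + k) \<Longrightarrow> Q k x \<le> Q (Suc k) x" by blast
  have mx: "max m j = m + (j - m)" for j by simp
  show ?thesis
  proof (rule that[of "\<lambda>j. Q (j - m)"])
    show "continuous_seminorm (T (max m j)) (Q (j - m))" for j unfolding mx by (rule Q(1))
    show "Q (j - m) = p" if "j \<le> m" for j using that Q(2) by simp
    show "Q (j - m) x \<le> Q (Suc j - m) x" if x: "x \<in> E (max m j)" for j x
    proof (cases "m \<le> j")
      case True
      then show ?thesis using Q(3)[of x "j - m"] x by (simp add: Suc_diff_le)
    qed simp
  qed
qed

text \<open>The summands \<open>xs i\<close> are split off one after the other. Before \<open>xs j\<close> is split off, the rest of \<open>x\<close> is still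
  in the step on which \<open>P j\<close> is defined, and afterwards \<open>P j\<close> may be replaced by the larger \<open>P (Suc j)\<close>.\<close>

lemma increasing_seminorms_telescope:
  assumes P: "\<And>j. continuous_seminorm (T (max m j)) (P j)"
    "\<And>j x. x \<in> E (max m j) \<Longrightarrow> P j x \<le> P (Suc j) x"
    and x: "x \<in> E m" and xs: "\<And>i. xs i \<in> E i" "x = (\<Sum>i<n. xs i)"
  shows "P 0 x \<le> (\<Sum>i<n. P i (xs i))"
proof -
  let ?s = "\<lambda>j. \<Sum>i<j. xs i"
  have xsm: "xs i \<in> E (max m j)" if "i \<le> j" for i j
    by (rule subsetD[OF E_mono xs(1)]) (use that in simp)
  have xm: "x \<in> E (max m j)" for j by (rule subsetD[OF E_mono x]) simp
  have sm: "?s k \<in> E (max m j)" if "k \<le> Suc j" for k j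
    by (rule subspace_sum[OF subspace_E xsm]) (use that in auto)
  have "P 0 x \<le> (\<Sum>i<j. P i (xs i)) + P j (x - ?s j)" for j
  proof (induction j)
    case (Suc j)
    note sP = continuous_seminormD(1)[OF lc P(1)[of j]]
    have m: "x - ?s (Suc j) \<in> E (max m j)" by (rule subspace_diff[OF subspace_E xm sm]) simp
    have "P j (x - ?s j) = P j (xs j + (x - ?s (Suc j)))" by simp
    also have "\<dots> \<le> P j (xs j) + P j (x - ?s (Suc j))" by (rule seminorm_onD(2)[OF sP xsm m]) simp
    also have "\<dots> \<le> P j (xs j) + P (Suc j) (x - ?s (Suc j))" using P(2)[OF m] by simp
    finally show ?case using Suc by simp
  qed simp
  from this[of n] show ?thesis
    using xs(2) seminorm_on_zero[OF continuous_seminormD(1)[OF lc P(1)[of n]]] by simp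
qed

lemma hilbertian_seminorm_above:
  assumes nuc: "\<And>n. nuclear_space (T n)" and p: "continuous_seminorm (T m) p"
  obtains q where "continuous_seminorm S q" "hilbertian (topspace S) q" "\<And>x. x \<in> E m \<Longrightarrow> p x \<le> q x"
proof -
  obtain P where P: "\<And>j. continuous_seminorm (T (max m j)) (P j)" "\<And>j. j \<le> m \<Longrightarrow> P j = p"
    "\<And>j x. x \<in> E (max m j) \<Longrightarrow> P j x \<le> P (Suc j) x" by (rule increasing_seminorms[OF p]) (rule that)
  have Pc: "continuous_seminorm (T j) (P j)" for j
    by (rule continuous_seminorm_mono_source[OF incl P(1)]) simp
  obtain q where q: "continuous_seminorm S q" "hilbertian (topspace S) q"
    "\<And>x c. x \<in> topspace S \<Longrightarrow> (\<forall>n xs. (\<forall>i. xs i \<in> E i) \<longrightarrow> x = (\<Sum>i<n. xs i) \<longrightarrow>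
       c \<le> (\<Sum>i<n. P i (xs i))) \<Longrightarrow> c \<le> q x"
    by (rule hilbertian_seminorm_from_family[OF nuc Pc]) (rule that)
  show ?thesis
  proof (rule that[OF q(1,2)])
    fix x assume x: "x \<in> E m"
    show "p x \<le> q x"
    proof (rule q(3)[OF subsetD[OF E_subset_S x]], intro allI impI)
      fix n xs assume "\<forall>i. xs i \<in> E i" "x = (\<Sum>i<n. xs i)"
      from increasing_seminorms_telescope[OF P(1,3) x this(1)[rule_format] this(2)] show "p x \<le> (\<Sum>i<n. P i (xs i))"
        using P(2)[of 0] by simp
    qed
  qed
qed

text \<open>The family is \<open>0\<close> up to the index \<open>j\<close> and increasing from \<open>p\<close> afterwards. In a decomposition of \<open>w\<close> the
  summands with index at most \<open>j\<close> cost nothing, but they only change \<open>w\<close> by an element of \<open>E j\<close>.\<close>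

lemma hilbertian_seminorm_vanishing:
  assumes nuc: "\<And>n. nuclear_space (T n)" and p: "continuous_seminorm (T (Suc j)) p"
    and w: "w \<in> E (Suc j)" "\<And>e. e \<in> E j \<Longrightarrow> 1 \<le> p (w - e)"
  obtains q where "continuous_seminorm S q" "hilbertian (topspace S) q"
    "\<And>x. x \<in> E j \<Longrightarrow> q x = 0" "1 \<le> q w"
proof -
  obtain P where P: "\<And>i. continuous_seminorm (T (max (Suc j) i)) (P i)" "\<And>i. i \<le> Suc j \<Longrightarrow> P i = p"
    "\<And>i x. x \<in> E (max (Suc j) i) \<Longrightarrow> P i x \<le> P (Suc i) x" by (rule increasing_seminorms[OF p]) (rule that)
  define R where "R = (\<lambda>i. if i \<le> j then (\<lambda>_. 0) else P i)"
  have Rc: "continuous_seminorm (T i) (R i)" for i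
    using continuous_seminorm_mono_source[OF incl P(1), of i i] zero_seminorm(1)[of i] by (simp add: R_def)
  obtain q where q: "continuous_seminorm S q" "hilbertian (topspace S) q"
    "\<And>i x. \<forall>y\<in>E i. R i y = 0 \<Longrightarrow> x \<in> E i \<Longrightarrow> q x = 0"
    "\<And>x c. x \<in> topspace S \<Longrightarrow> (\<forall>n xs. (\<forall>i. xs i \<in> E i) \<longrightarrow> x = (\<Sum>i<n. xs i) \<longrightarrow>
       c \<le> (\<Sum>i<n. R i (xs i))) \<Longrightarrow> c \<le> q x"
    by (rule hilbertian_seminorm_from_family[OF nuc Rc]) (rule that)
  show ?thesis
  proof (rule that[OF q(1,2)])
    show "q x = 0" if "x \<in> E j" for x by (rule q(3)[OF _ that]) (simp add: R_def)
    show "1 \<le> q w"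
    proof (rule q(4)[OF subsetD[OF E_subset_S w(1)]], intro allI impI)
      fix n xs assume xs: "\<forall>i. xs i \<in> E i" "w = (\<Sum>i<n. xs i)"
      define e where "e = (\<Sum>i<n. if i \<le> j then xs i else 0)"
      define ys where "ys = (\<lambda>i. if i \<le> j then 0 else xs i)"
      have e: "e \<in> E j" unfolding e_def
        using xs(1) E_mono[of _ j] zero_E by (intro subspace_sum[OF subspace_E]) auto
      have ys: "ys i \<in> E i" for i using xs(1) zero_E by (simp add: ys_def)
      have "w - e = (\<Sum>i<n. ys i)"
        unfolding xs(2) e_def sum_subtractf[symmetric] by (rule sum.cong) (auto simp: ys_def)
      moreover have "w - e \<in> E (Suc j)" using subspace_diff[OF subspace_E w(1)] e ascending by blast
      ultimately have "P 0 (w - e) \<le> (\<Sum>i<n. P i (ys i))"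
        using increasing_seminorms_telescope[OF P(1,3) _ ys] by blast
      also have "\<dots> = (\<Sum>i<n. R i (xs i))"
        by (rule sum.cong)
           (auto simp: ys_def R_def seminorm_on_zero[OF continuous_seminormD(1)[OF lc P(1)]])
      finally show "1 \<le> (\<Sum>i<n. R i (xs i))" using w(2)[OF e] P(2)[of 0] by simp
    qed
  qed
qed

lemma hausdorff_S:
  assumes nuc: "\<And>n. nuclear_space (T n)"
  shows "hausdorff_lcs S"
  unfolding hausdorff_lcs_def Hausdorff_space_def
proof (intro conjI lc_S allI impI)
  fix x y assume xy: "x \<in> topspace S \<and> y \<in> topspace S \<and> x \<noteq> y"
  then have "x - y \<in> topspace S" using subspace_diff[OF subspace_S] by blast
  then obtain m where m: "x - y \<in> E m" unfolding topspace_S by blast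
  obtain p where p: "continuous_seminorm (T m) p" "p (x - y) > 0"
    using hausdorff_lcs_separating_seminorm[OF lcs m] xy by auto
  obtain q where q: "continuous_seminorm S q" "\<And>x. x \<in> E m \<Longrightarrow> p x \<le> q x"
    by (rule hilbertian_seminorm_above[OF nuc p(1)]) (rule that)
  note sq = continuous_seminormD(1)[OF lc_S q(1)]
  define d where "d = q (x - y) / 2"
  have d: "d > 0" using p(2) q(2)[OF m] by (simp add: d_def)
  let ?U = "\<lambda>z. {u \<in> topspace S. q (u - z) < d}"
  have "disjnt (?U x) (?U y)"
    unfolding disjnt_iff
  proof (intro allI notI)
    fix u assume u: "u \<in> ?U x \<and> u \<in> ?U y"
    then have "q (x - y) = q ((u - y) - (u - x))" by simp
    also have "\<dots> \<le> q (u - y) + q (u - x)"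
      using u xy by (intro seminorm_on_triangle_minus(1)[OF sq] subspace_diff[OF subspace_S]) auto
    also have "\<dots> < d + d" using u by (intro add_strict_mono) auto
    finally show False by (simp add: d_def)
  qed
  moreover have "x \<in> ?U x" "y \<in> ?U y" using xy d seminorm_on_zero[OF sq] by auto
  moreover have "openin S (?U x)" "openin S (?U y)" using open_seminorm_ball[OF lc_S q(1)] xy by blast+
  ultimately show "\<exists>U V. openin S U \<and> openin S V \<and> x \<in> U \<and> y \<in> V \<and> disjnt U V" by blast
qed

text \<open>Otherwise \<open>w\<close> is a limit of elements \<open>e i\<close> of \<open>E j\<close>. As the invariant metric defines the induced topology,
  they form a Cauchy sequence for it, whose limit in \<open>E j\<close> must be \<open>w\<close>.\<close>

lemma complete_step_separated:
  assumes fr: "frechet_space (T j)" and metr: "metrizable_space (T (Suc j))"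
    and w: "w \<in> E (Suc j)" "w \<notin> E j"
  shows "\<exists>p. continuous_seminorm (T (Suc j)) p \<and> (\<forall>e\<in>E j. 1 \<le> p (w - e))"
proof (rule ccontr)
  assume "\<not> ?thesis"
  then have near: "\<exists>e\<in>E j. p (w - e) < 1" if "continuous_seminorm (T (Suc j)) p" for p
    using that by (meson not_le)
  let ?T = "T (Suc j)"
  obtain U :: "nat \<Rightarrow> 'a set" where U: "(\<forall>i. openin ?T (U i) \<and> 0 \<in> U i) \<and>
    (\<forall>W. openin ?T W \<and> 0 \<in> W \<longrightarrow> (\<exists>J. \<forall>i\<ge>J. U i \<subseteq> W))"
    using metrizable_neighbourhood_base[OF metr zero_E] by blast
  have "\<exists>e. e \<in> E j \<and> w - e \<in> U i" for i
  proof -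
    obtain p where p: "continuous_seminorm ?T p" "\<And>x. x \<in> E (Suc j) \<Longrightarrow> p x < 1 \<Longrightarrow> x \<in> U i"
      using gauge_seminorm[OF lc, of "Suc j" "U i"] U by blast
    obtain e where "e \<in> E j" "p (w - e) < 1" using near[OF p(1)] by blast
    then show ?thesis using p(2)[of "w - e"] subspace_diff[OF subspace_E w(1)] ascending by blast
  qed
  then obtain e where e: "\<And>i. e i \<in> E j" "\<And>i. w - e i \<in> U i" by metis
  have e': "e i \<in> E (Suc j)" for i using e(1) ascending by blast
  have small: "\<exists>J. \<forall>i\<ge>J. s (w - e i) < d" if s: "continuous_seminorm ?T s" and d: "d > 0" for s d
  proof -
    have "openin ?T {x \<in> E (Suc j). s x < d}" by (rule open_seminorm_ball_0[OF lc s])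
    moreover have "0 \<in> {x \<in> E (Suc j). s x < d}"
      using zero_E d seminorm_on_zero[OF continuous_seminormD(1)[OF lc s]] by simp
    ultimately obtain J where "\<forall>i\<ge>J. U i \<subseteq> {x \<in> E (Suc j). s x < d}" using U by blast
    then have "\<forall>i\<ge>J. s (w - e i) < d" using e(2) by blast
    then show ?thesis by blast
  qed
  obtain d where d: "Metric_space (E j) d" "Metric_space.mtopology (E j) d = T j"
    "Metric_space.mcomplete (E j) d"
    "\<forall>x\<in>E j. \<forall>y\<in>E j. \<forall>z\<in>E j. d (x + z) (y + z) = d x y"
    using fr unfolding frechet_space_def by blast
  interpret M: Metric_space "E j" d by (rule d(1))
  have "M.MCauchy e"
    unfolding M.MCauchy_def
  proof (intro conjI allI impI)
    show "range e \<subseteq> E j" using e(1) by blast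
    fix r :: real assume r: "r > 0"
    have op: "openin (T j) (M.mball 0 r)" using M.openin_mball[of 0 r] unfolding d(2) .
    obtain O' where O: "openin ?T O'" "M.mball 0 r = O' \<inter> E j"
      by (rule openin_E_trace[OF _ op, of "Suc j"]) simp
    have "0 \<in> O'" using O(2) r zero_E[of j] M.centre_in_mball_iff[of 0 r] by blast
    then obtain s where s: "continuous_seminorm ?T s" "\<And>x. x \<in> E (Suc j) \<Longrightarrow> s x < 1 \<Longrightarrow> x \<in> O'"
      using gauge_seminorm[OF lc O(1)] by blast
    note ss = continuous_seminormD(1)[OF lc s(1)]
    obtain J where J: "\<forall>i\<ge>J. s (w - e i) < 1/2" using small[OF s(1), of "1/2"] by auto
    have "d (e k) (e l) < r" if "k \<ge> J" "l \<ge> J" for k l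
    proof -
      have "s (e k - e l) = s ((w - e l) - (w - e k))" by simp
      also have "\<dots> \<le> s (w - e l) + s (w - e k)"
        by (intro seminorm_on_triangle_minus(1)[OF ss] subspace_diff[OF subspace_E] w(1) e')
      also have "\<dots> < 1/2 + 1/2" using J that by (intro add_strict_mono) auto
      finally have "e k - e l \<in> O' \<inter> E j"
        using s(2) subspace_diff[OF subspace_E e' e', of k l] subspace_diff[OF subspace_E e(1) e(1), of k l] by simp
      then have "e k - e l \<in> M.mball 0 r" using O(2) by blast
      then have "d 0 (e k - e l) < r" by simp
      moreover have "d (0 + e l) ((e k - e l) + e l) = d 0 (e k - e l)"
        using d(4) zero_E e(1) subspace_diff[OF subspace_E e(1) e(1)] by blast
      ultimately show ?thesis using M.commute[of "e k" "e l"] by simp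
    qed
    then show "\<exists>N. \<forall>n n'. N \<le> n \<longrightarrow> N \<le> n' \<longrightarrow> d (e n) (e n') < r" by blast
  qed
  then obtain y where y: "limitin (T j) e y sequentially"
    using d(3) unfolding M.mcomplete_def d(2) by blast
  have yE: "y \<in> E j" using y by (rule limitin_topspace)
  have "w - y \<in> E (Suc j)" using subspace_diff[OF subspace_E w(1)] yE ascending by blast
  moreover have "w - y \<noteq> 0" using w(2) yE by auto
  ultimately obtain s where s: "continuous_seminorm ?T s" "s (w - y) > 0"
    by (rule hausdorff_lcs_separating_seminorm[OF lcs]) (rule that)
  note ss = continuous_seminormD(1)[OF lc s(1)]
  have sj: "continuous_seminorm (T j) s" by (rule continuous_seminorm_mono_source[OF incl s(1)]) simp
  let ?d = "s (w - y) / 2"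
  obtain J where J: "\<forall>i\<ge>J. s (w - e i) < ?d" using small[OF s(1), of ?d] s(2) by auto
  have "openin (T j) {z \<in> E j. s (z - y) < ?d}" by (rule open_seminorm_ball[OF lc sj yE])
  moreover have "y \<in> {z \<in> E j. s (z - y) < ?d}" using yE s(2) seminorm_on_zero[OF ss] by simp
  ultimately have "eventually (\<lambda>i. e i \<in> {z \<in> E j. s (z - y) < ?d}) sequentially"
    using y unfolding limitin_def by blast
  then obtain K where K: "\<forall>i\<ge>K. s (e i - y) < ?d" unfolding eventually_sequentially by auto
  let ?i = "max J K"
  have yE': "y \<in> E (Suc j)" using yE ascending by blast
  have "s (w - y) = s ((w - e ?i) + (e ?i - y))" by simp
  also have "\<dots> \<le> s (w - e ?i) + s (e ?i - y)"
    by (intro seminorm_onD(2)[OF ss] subspace_diff[OF subspace_E] w(1) e' yE')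
  also have "\<dots> < ?d + ?d" using J K by (intro add_strict_mono) auto
  finally show False by simp
qed

end

section \<open>Hilbertian seminorms and symmetric bilinear forms\<close>

text \<open>The function \<open>g t = f t - t f 1\<close> is additive and vanishes at the integers, so it is periodic and therefore
  bounded on the whole line; but \<open>g (n t) = n g t\<close>.\<close>

lemma additive_bounded_imp_linear:
  fixes f :: "real \<Rightarrow> real"
  assumes add: "\<And>s t. f (s + t) = f s + f t" and bdd: "\<And>t. 0 \<le> t \<Longrightarrow> t \<le> 1 \<Longrightarrow> \<bar>f t\<bar> \<le> M"
  shows "f t = t * f 1"
proof -
  define g where "g = (\<lambda>t. f t - t * f 1)"
  have gadd: "g (s + t) = g s + g t" for s t by (simp add: g_def add algebra_simps)
  have g0: "g 0 = 0" using gadd[of 0 0] by simp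
  have gneg: "g (- t) = - g t" for t using gadd[of t "-t"] g0 by simp
  have gn: "g (real n * t) = real n * g t" for n t
    by (induction n) (simp_all add: g0 gadd distrib_right)
  have g1: "g 1 = 0" by (simp add: g_def)
  have gi: "g (real_of_int k) = 0" for k
    using gn[of "nat k" 1] gn[of "nat (- k)" 1] gneg[of "real_of_int k"] g1 by (cases "0 \<le> k") auto
  have bound: "\<bar>g t\<bar> \<le> M + \<bar>f 1\<bar>" for t
  proof -
    have fr: "0 \<le> frac t" "frac t \<le> 1" using frac_lt_1[of t] by auto
    have "g t = g (real_of_int \<lfloor>t\<rfloor> + frac t)" by (simp add: frac_def)
    then have "g t = g (frac t)" by (simp add: gadd gi)
    also have "\<bar>\<dots>\<bar> \<le> \<bar>f (frac t)\<bar> + \<bar>frac t * f 1\<bar>" unfolding g_def by (rule abs_triangle_ineq4)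
    also have "\<dots> \<le> M + 1 * \<bar>f 1\<bar>"
      unfolding abs_mult using bdd[OF fr] fr by (intro add_mono mult_right_mono) auto
    finally show ?thesis by simp
  qed
  have "g t = 0"
  proof (rule ccontr)
    assume "g t \<noteq> 0"
    then have "\<bar>g t\<bar> > 0" by simp
    then obtain n where "M + \<bar>f 1\<bar> < real n * \<bar>g t\<bar>" using reals_Archimedean3 by blast
    then show False using bound[of "real n * t"] by (simp add: gn abs_mult)
  qed
  then show ?thesis by (simp add: g_def)
qed

definition sym_form :: "'a::real_vector topology \<Rightarrow> ('a \<Rightarrow> 'a \<Rightarrow> real) \<Rightarrow> bool" where
  "sym_form T b \<longleftrightarrow>
     (\<forall>x\<in>topspace T. \<forall>y\<in>topspace T. b x y = b y x) \<and>
     (\<forall>x\<in>topspace T. \<forall>y\<in>topspace T. \<forall>z\<in>topspace T. b (x + z) y = b x y + b z y) \<and>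
     (\<forall>c. \<forall>x\<in>topspace T. \<forall>y\<in>topspace T. b (c *\<^sub>R x) y = c * b x y) \<and>
     continuous_map (prod_topology T T) euclideanreal (\<lambda>(x, y). b x y)"

text \<open>The Jordan--von Neumann theorem: polarization, with additivity obtained from two instances of the
  parallelogram law, and homogeneity from additivity and boundedness on lines.\<close>

lemma hilbertian_polarization:
  assumes T: "lc_space T" and q: "continuous_seminorm T q" and h: "hilbertian (topspace T) q"
  obtains b where "sym_form T b" "\<And>x. x \<in> topspace T \<Longrightarrow> b x x = (q x)\<^sup>2"
proof -
  let ?X = "topspace T"
  note sq = hilbertianD(1)[OF h]
  note X = seminorm_onD(1)[OF sq]
  define Q where "Q = (\<lambda>x. (q x)\<^sup>2)"
  define b where "b = (\<lambda>x y. (Q (x + y) - Q (x - y)) / 4)"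
  have par: "Q (x + y) + Q (x - y) = 2 * Q x + 2 * Q y" if "x \<in> ?X" "y \<in> ?X" for x y
    using hilbertianD(2)[OF h that] by (simp add: Q_def)
  have Qm: "Q (- x) = Q x" if "x \<in> ?X" for x using seminorm_on_minus[OF sq that] by (simp add: Q_def)
  have Qc: "Q (x - y) = Q (y - x)" if "x \<in> ?X" "y \<in> ?X" for x y
    using seminorm_on_triangle_minus(3)[OF sq that] by (simp add: Q_def)
  have comm: "b x y = b y x" if "x \<in> ?X" "y \<in> ?X" for x y
    using Qc[OF that] by (simp add: b_def add.commute)
  have b0: "b 0 y = 0" if "y \<in> ?X" for y using Qm[OF that] by (simp add: b_def)
  have sum_diff: "b (x + z) y + b (x - z) y = 2 * b x y" if "x \<in> ?X" "y \<in> ?X" "z \<in> ?X" for x y z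
  proof -
    have pm: "x + y \<in> ?X" "x - y \<in> ?X" using that X by (auto intro: subspace_add subspace_diff)
    have eq: "(x + y) + z = (x + z) + y" "(x + y) - z = (x - z) + y"
      "(x - y) + z = (x + z) - y" "(x - y) - z = (x - z) - y" by (simp_all add: algebra_simps)
    have "(A1 - A2) / 4 + (A3 - A4) / 4 = 2 * ((B1 - B2) / 4)"
      if "A1 + A3 = 2 * B1 + 2 * C" "A2 + A4 = 2 * B2 + 2 * C" for A1 A2 A3 A4 B1 B2 C :: real
      using that by (simp add: field_simps)
    from this[OF par[OF pm(1) that(3), unfolded eq] par[OF pm(2) that(3), unfolded eq]]
    show ?thesis unfolding b_def .
  qed
  have dbl: "b (x + x) y = 2 * b x y" if "x \<in> ?X" "y \<in> ?X" for x y
    using sum_diff[OF that that(1)] b0[OF that(2)] by simp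
  have add: "b (x + z) y = b x y + b z y" if "x \<in> ?X" "y \<in> ?X" "z \<in> ?X" for x y z
  proof -
    let ?s = "(1/2) *\<^sub>R (x + z)" and ?d = "(1/2) *\<^sub>R (x - z)"
    have s: "?s \<in> ?X" "?d \<in> ?X" using that X by (auto intro!: subspace_scale subspace_add subspace_diff)
    have "?s + ?d = (1/2) *\<^sub>R ((x + z) + (x - z))" "?s - ?d = (1/2) *\<^sub>R ((x + z) - (x - z))"
      "?s + ?s = (1/2) *\<^sub>R ((x + z) + (x + z))"
      by (simp_all only: scaleR_add_right scaleR_diff_right)
    moreover have "(x + z) + (x - z) = x + x" "(x + z) - (x - z) = z + z" by simp_all
    ultimately have e: "?s + ?d = x" "?s - ?d = z" "?s + ?s = x + z" by (simp_all only: scaleR_half_double)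
    show ?thesis using sum_diff[OF s(1) that(2) s(2)] dbl[OF s(1) that(2)] unfolding e by simp
  qed
  have hom: "b (c *\<^sub>R x) y = c * b x y" if x: "x \<in> ?X" and y: "y \<in> ?X" for c x y
  proof -
    have "b (t *\<^sub>R x) y = t * b (1 *\<^sub>R x) y" for t
    proof (rule additive_bounded_imp_linear[of "\<lambda>t. b (t *\<^sub>R x) y" "(q x + q y)\<^sup>2 + (q x + q y)\<^sup>2"])
      show "b ((s + t) *\<^sub>R x) y = b (s *\<^sub>R x) y + b (t *\<^sub>R x) y" for s t
        unfolding scaleR_add_left by (rule add[OF subspace_scale[OF X x] y subspace_scale[OF X x]])
      fix t :: real assume t: "0 \<le> t" "t \<le> 1"
      have m: "t *\<^sub>R x \<in> ?X" by (rule subspace_scale[OF X x])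
      have "q (t *\<^sub>R x) \<le> q x"
        using seminorm_onD(3)[OF sq x, of t] t seminorm_on_nonneg[OF sq x] by (simp add: mult_left_le_one_le)
      then have "q (t *\<^sub>R x + y) \<le> q x + q y" "q (t *\<^sub>R x - y) \<le> q x + q y"
        using seminorm_onD(2)[OF sq m y] seminorm_on_triangle_minus(1)[OF sq m y] by linarith+
      then have "Q (t *\<^sub>R x + y) \<le> (q x + q y)\<^sup>2" "Q (t *\<^sub>R x - y) \<le> (q x + q y)\<^sup>2"
        unfolding Q_def using seminorm_on_nonneg[OF sq] subspace_add[OF X m y] subspace_diff[OF X m y]
        by (auto intro: power_mono)
      moreover have "0 \<le> Q (t *\<^sub>R x + y)" "0 \<le> Q (t *\<^sub>R x - y)" by (simp_all add: Q_def)
      ultimately show "\<bar>b (t *\<^sub>R x) y\<bar> \<le> (q x + q y)\<^sup>2 + (q x + q y)\<^sup>2" unfolding b_def by (simp add: abs_le_iff)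
    qed
    then show ?thesis by simp
  qed
  have cont: "continuous_map (prod_topology T T) euclideanreal (\<lambda>(x, y). b x y)"
  proof -
    have m: "continuous_map (prod_topology T T) T (\<lambda>z. fst z + c *\<^sub>R snd z)" for c
      by (intro lc_add_continuous[OF T] lc_scaleR_continuous[OF T] continuous_map_fst continuous_map_snd) simp
    have "continuous_map (prod_topology T T) euclideanreal (\<lambda>z. q (fst z + c *\<^sub>R snd z))" for c
      using continuous_map_compose[OF m continuous_seminormD(2)[OF T q]] by (simp add: o_def)
    from this[of 1] this[of "-1"]
    have "continuous_map (prod_topology T T) euclideanreal
        (\<lambda>z. ((q (fst z + 1 *\<^sub>R snd z))\<^sup>2 - (q (fst z + (-1) *\<^sub>R snd z))\<^sup>2) * (1/4))"
      unfolding power2_eq_square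
      by (intro continuous_map_real_mult continuous_map_diff continuous_map_const[THEN iffD2]) auto
    then show ?thesis by (simp add: b_def Q_def case_prod_unfold)
  qed
  show ?thesis
  proof (rule that)
    show "sym_form T b" unfolding sym_form_def using comm add hom cont by blast
    fix x assume x: "x \<in> ?X"
    have "Q (x + x) = 4 * Q x" using seminorm_onD(3)[OF sq x, of 2] by (simp add: Q_def scaleR_2)
    then show "b x x = (q x)\<^sup>2" using seminorm_on_zero[OF sq] by (simp add: b_def Q_def)
  qed
qed

section \<open>Smooth functions built from symmetric bilinear forms\<close>

text \<open>All derivatives of \<open>exp (-1/t)\<close>, extended by \<open>0\<close> to \<open>t \<le> 0\<close>, have this form. The family is closed under
  differentiation, so that it can be used as one of the building blocks of the functions below.\<close>

definition flat :: "real poly \<Rightarrow> real \<Rightarrow> real" where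
  "flat P t = (if t > 0 then poly P (1 / t) * exp (- (1 / t)) else 0)"

lemma poly_exp_decay: "((\<lambda>u. poly P u * exp (- u)) \<longlongrightarrow> (0::real)) at_top"
proof -
  have "((\<lambda>u. \<Sum>i\<le>degree P. coeff P i * (u ^ i / exp u)) \<longlongrightarrow> (\<Sum>i\<le>degree P. coeff P i * 0)) at_top"
    by (intro tendsto_intros tendsto_power_div_exp_0)
  moreover have "(\<lambda>u. \<Sum>i\<le>degree P. coeff P i * (u ^ i / exp u)) = (\<lambda>u. poly P u * exp (- u))"
    by (rule ext) (simp add: poly_altdef sum_distrib_right exp_minus divide_inverse mult.assoc)
  ultimately show ?thesis by simp
qed

lemma flat_limit_0: "(flat P \<longlongrightarrow> 0) (at 0)"
proof -
  have "((\<lambda>t. poly P (inverse t) * exp (- inverse t)) \<longlongrightarrow> 0) (at_right 0)"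
    by (rule filterlim_compose[OF poly_exp_decay filterlim_inverse_at_top_right])
  moreover have "eventually (\<lambda>t. poly P (inverse t) * exp (- inverse t) = flat P t) (at_right 0)"
    unfolding eventually_at_right_field by (intro exI[of _ 1]) (simp add: flat_def inverse_eq_divide)
  ultimately have r: "(flat P \<longlongrightarrow> 0) (at_right 0)" using tendsto_cong by fast
  have "eventually (\<lambda>t. flat P t = 0) (at_left 0)"
    unfolding eventually_at_left_field by (intro exI[of _ "-1"]) (simp add: flat_def)
  then have "(flat P \<longlongrightarrow> 0) (at_left 0)" by (rule tendsto_eventually)
  then show ?thesis using r by (simp add: filterlim_at_split)
qed

text \<open>For \<open>u = 1/t\<close> the derivative of \<open>P(u) exp (-u)\<close> with respect to \<open>t\<close> is \<open>u\<^sup>2 (P(u) - P'(u)) exp (-u)\<close>.\<close>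

lemma flat_has_derivative:
  "(flat P has_real_derivative flat ([:0, 0, 1:] * (P - pderiv P)) t) (at t)"
proof -
  consider "t > 0" | "t < 0" | "t = 0" by linarith
  then show ?thesis
  proof cases
    case 1
    have "((\<lambda>t. poly P (1 / t) * exp (- (1 / t))) has_real_derivative
        flat ([:0, 0, 1:] * (P - pderiv P)) t) (at t)"
      using 1 by (auto intro!: derivative_eq_intros poly_DERIV[THEN DERIV_chain2]
          simp: flat_def field_simps power2_eq_square)
    moreover have "eventually (\<lambda>u. flat P u = poly P (1 / u) * exp (- (1 / u))) (nhds t)"
      using eventually_nhds_in_open[of "{0<..}" t] 1 by (auto elim!: eventually_mono simp: flat_def)
    ultimately show ?thesis by (simp add: DERIV_cong_ev)
  next
    case 2
    have "eventually (\<lambda>u. flat P u = 0) (nhds t)"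
      using eventually_nhds_in_open[of "{..<0}" t] 2 by (auto elim!: eventually_mono simp: flat_def)
    then have "(flat P has_real_derivative 0) (at t) \<longleftrightarrow> ((\<lambda>_. 0) has_real_derivative 0) (at t)"
      by (intro DERIV_cong_ev) auto
    then show ?thesis using 2 by (simp add: flat_def)
  next
    case 3
    have "(\<lambda>u. (flat P u - flat P 0) / (u - 0)) = flat ([:0, 1:] * P)"
      by (rule ext) (simp add: flat_def)
    then show ?thesis
      using flat_limit_0[of "[:0, 1:] * P"] 3 by (simp add: has_field_derivative_iff flat_def[of _ 0])
  qed
qed

lemma flat_continuous: "continuous_map euclideanreal euclideanreal (flat P)"
  using DERIV_isCont[OF flat_has_derivative] by (simp add: continuous_on_eq_continuous_at)

text \<open>A class of functions of a point \<open>x\<close> and \<open>k\<close> directions which contains the iterated directional derivatives of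
  its members with \<open>k = 0\<close>. The directions \<open>v 0, \<dots>, v (k - 1)\<close> are numbered in the order of
  differentiation, so that they keep their numbers when another derivative is taken.\<close>

inductive jet :: "'a::real_vector topology \<Rightarrow> nat \<Rightarrow> ((nat \<Rightarrow> 'a) \<Rightarrow> 'a \<Rightarrow> real) \<Rightarrow> bool" for T where
  const: "jet T k (\<lambda>v x. c)"
| base: "sym_form T b \<Longrightarrow> jet T k (\<lambda>v x. b x x)"
| mixed: "sym_form T b \<Longrightarrow> n < k \<Longrightarrow> jet T k (\<lambda>v x. b x (v n))"
| directions: "sym_form T b \<Longrightarrow> m < k \<Longrightarrow> n < k \<Longrightarrow> jet T k (\<lambda>v x. b (v m) (v n))"
| add: "jet T k G \<Longrightarrow> jet T k H \<Longrightarrow> jet T k (\<lambda>v x. G v x + H v x)"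
| mult: "jet T k G \<Longrightarrow> jet T k H \<Longrightarrow> jet T k (\<lambda>v x. G v x * H v x)"
| flat: "jet T k G \<Longrightarrow> jet T k (\<lambda>v x. flat P (G v x))"

lemma jet_cong:
  assumes "jet T k G" "\<And>n. n < k \<Longrightarrow> v n = w n"
  shows "G v x = G w x"
  using assms by (induction rule: jet.induct) auto

lemma jet_Suc: "jet T k G \<Longrightarrow> jet T (Suc k) G"
  by (induction rule: jet.induct) (auto intro: jet.intros)

lemma sym_formD:
  assumes "sym_form T b" "x \<in> topspace T" "y \<in> topspace T"
  shows "b x y = b y x" "z \<in> topspace T \<Longrightarrow> b (x + z) y = b x y + b z y" "b (c *\<^sub>R x) y = c * b x y"
  using assms unfolding sym_form_def by blast+

lemma sym_form_continuous:
  assumes "sym_form T b" "continuous_map Z T f" "continuous_map Z T g"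
  shows "continuous_map Z euclideanreal (\<lambda>z. b (f z) (g z))"
proof -
  have "continuous_map (prod_topology T T) euclideanreal (\<lambda>(x, y). b x y)"
    using assms(1) by (simp add: sym_form_def)
  from continuous_map_compose[OF continuous_map_pairedI[OF assms(2,3)] this]
  show ?thesis by (simp add: o_def)
qed

lemma sym_form_line:
  assumes b: "sym_form T b" and X: "subspace (topspace T)"
    and x: "x \<in> topspace T" and y: "y \<in> topspace T" and z: "z \<in> topspace T"
  shows "b (x + t *\<^sub>R y) z = b x z + t * b y z"
    "b (x + t *\<^sub>R y) (x + t *\<^sub>R y) = b x x + t * (2 * b x y) + t\<^sup>2 * b y y"
proof -
  have ty: "t *\<^sub>R y \<in> topspace T" by (rule subspace_scale[OF X y])
  have line: "b (x + t *\<^sub>R y) z = b x z + t * b y z" if "z \<in> topspace T" for z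
    using sym_formD(2)[OF b x that ty] sym_formD(3)[OF b y that] by simp
  show "b (x + t *\<^sub>R y) z = b x z + t * b y z" by (rule line[OF z])
  have m: "x + t *\<^sub>R y \<in> topspace T" by (rule subspace_add[OF X x ty])
  have "b (x + t *\<^sub>R y) (x + t *\<^sub>R y) = b (x + t *\<^sub>R y) x + t * b (x + t *\<^sub>R y) y"
    using line[OF m] sym_formD(1)[OF b x m] sym_formD(1)[OF b y m] by simp
  then show "b (x + t *\<^sub>R y) (x + t *\<^sub>R y) = b x x + t * (2 * b x y) + t\<^sup>2 * b y y"
    using line[OF x] line[OF y] sym_formD(1)[OF b y x] by (simp add: algebra_simps power2_eq_square)
qed

lemma jet_has_derivative:
  assumes "jet T k G" and X: "subspace (topspace T)"
  shows "\<exists>G'. jet T (Suc k) G' \<and> (\<forall>v. \<forall>x\<in>topspace T. (\<forall>n\<le>k. v n \<in> topspace T) \<longrightarrow>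
    ((\<lambda>t. G v (x + t *\<^sub>R v k)) has_real_derivative G' v x) (at 0))"
  using assms(1)
proof (induction rule: jet.induct)
  case (const k c)
  show ?case by (rule exI[of _ "\<lambda>v x. 0"]) (auto intro: jet.intros)
next
  case (base b k)
  have "jet T (Suc k) (\<lambda>v x. 2 * b x (v k))" by (intro jet.intros base) simp
  moreover have "((\<lambda>t. b (x + t *\<^sub>R v k) (x + t *\<^sub>R v k)) has_real_derivative 2 * b x (v k)) (at 0)"
    if "x \<in> topspace T" "\<forall>n\<le>k. v n \<in> topspace T" for v x
    using that by (auto simp: sym_form_line(2)[OF base X] intro!: derivative_eq_intros)
  ultimately show ?case by (intro exI[of _ "\<lambda>v x. 2 * b x (v k)"]) auto
next
  case (mixed b n k)
  have "jet T (Suc k) (\<lambda>v x. b (v k) (v n))" using mixed by (intro jet.intros) auto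
  moreover have "((\<lambda>t. b (x + t *\<^sub>R v k) (v n)) has_real_derivative b (v k) (v n)) (at 0)"
    if "x \<in> topspace T" "\<forall>n\<le>k. v n \<in> topspace T" for v x
    using that mixed(2) by (auto simp: sym_form_line(1)[OF mixed(1) X] intro!: derivative_eq_intros)
  ultimately show ?case by (intro exI[of _ "\<lambda>v x. b (v k) (v n)"]) auto
next
  case (directions b m k n)
  show ?case by (rule exI[of _ "\<lambda>v x. 0"]) (auto intro: jet.intros)
next
  case (add k G H)
  then obtain G' H' where d: "jet T (Suc k) G'" "jet T (Suc k) H'"
    "\<forall>v. \<forall>x\<in>topspace T. (\<forall>n\<le>k. v n \<in> topspace T) \<longrightarrow>
      ((\<lambda>t. G v (x + t *\<^sub>R v k)) has_real_derivative G' v x) (at 0)"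
    "\<forall>v. \<forall>x\<in>topspace T. (\<forall>n\<le>k. v n \<in> topspace T) \<longrightarrow>
      ((\<lambda>t. H v (x + t *\<^sub>R v k)) has_real_derivative H' v x) (at 0)" by auto
  show ?case
  proof (intro exI[of _ "\<lambda>v x. G' v x + H' v x"] conjI allI ballI impI)
    show "jet T (Suc k) (\<lambda>v x. G' v x + H' v x)" using d by (intro jet.intros)
    fix v x assume "x \<in> topspace T" "\<forall>n\<le>k. v n \<in> topspace T"
    then show "((\<lambda>t. G v (x + t *\<^sub>R v k) + H v (x + t *\<^sub>R v k)) has_real_derivative G' v x + H' v x) (at 0)"
      using d by (intro DERIV_add) auto
  qed
next
  case (mult k G H)
  then obtain G' H' where d: "jet T (Suc k) G'" "jet T (Suc k) H'"
    "\<forall>v. \<forall>x\<in>topspace T. (\<forall>n\<le>k. v n \<in> topspace T) \<longrightarrow>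
      ((\<lambda>t. G v (x + t *\<^sub>R v k)) has_real_derivative G' v x) (at 0)"
    "\<forall>v. \<forall>x\<in>topspace T. (\<forall>n\<le>k. v n \<in> topspace T) \<longrightarrow>
      ((\<lambda>t. H v (x + t *\<^sub>R v k)) has_real_derivative H' v x) (at 0)" by auto
  show ?case
  proof (intro exI[of _ "\<lambda>v x. G' v x * H v x + H' v x * G v x"] conjI allI ballI impI)
    show "jet T (Suc k) (\<lambda>v x. G' v x * H v x + H' v x * G v x)"
      using d jet_Suc mult.hyps by (intro jet.intros) auto
    fix v x assume "x \<in> topspace T" "\<forall>n\<le>k. v n \<in> topspace T"
    then show "((\<lambda>t. G v (x + t *\<^sub>R v k) * H v (x + t *\<^sub>R v k)) has_real_derivative
        G' v x * H v x + H' v x * G v x) (at 0)"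
      using d DERIV_mult[of "\<lambda>t. G v (x + t *\<^sub>R v k)" "G' v x" 0 UNIV "\<lambda>t. H v (x + t *\<^sub>R v k)" "H' v x"]
      by auto
  qed
next
  case (flat k G P)
  then obtain G' where d: "jet T (Suc k) G'"
    "\<forall>v. \<forall>x\<in>topspace T. (\<forall>n\<le>k. v n \<in> topspace T) \<longrightarrow>
      ((\<lambda>t. G v (x + t *\<^sub>R v k)) has_real_derivative G' v x) (at 0)" by auto
  let ?P = "[:0, 0, 1:] * (P - pderiv P)"
  show ?case
  proof (intro exI[of _ "\<lambda>v x. flat ?P (G v x) * G' v x"] conjI allI ballI impI)
    show "jet T (Suc k) (\<lambda>v x. flat ?P (G v x) * G' v x)"
      using d jet_Suc flat.hyps by (intro jet.intros) auto
    fix v x assume "x \<in> topspace T" "\<forall>n\<le>k. v n \<in> topspace T"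
    then have "((\<lambda>t. G v (x + t *\<^sub>R v k)) has_real_derivative G' v x) (at 0)" using d by blast
    from DERIV_chain2[OF flat_has_derivative[of P "G v (x + 0 *\<^sub>R v k)"] this]
    show "((\<lambda>t. flat P (G v (x + t *\<^sub>R v k))) has_real_derivative flat ?P (G v x) * G' v x) (at 0)" by simp
  qed
qed

lemma jet_continuous:
  assumes "jet T k G" "continuous_map Z T f" "\<And>n. n < k \<Longrightarrow> continuous_map Z T (g n)"
  shows "continuous_map Z euclideanreal (\<lambda>z. G (\<lambda>n. g n z) (f z))"
  using assms
proof (induction rule: jet.induct)
  case (flat k G P)
  show ?case
    using continuous_map_compose[OF flat.IH[OF flat.prems] flat_continuous] by (simp add: o_def)
next
  case (base b k)
  show ?case by (rule sym_form_continuous[OF base(1,2,2)])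
next
  case (mixed b n k)
  show ?case by (rule sym_form_continuous[OF mixed(1,3) mixed(4)[OF mixed(2)]])
next
  case (directions b m k n)
  show ?case by (rule sym_form_continuous[OF directions(1) directions(5)[OF directions(2)] directions(5)[OF directions(3)]])
qed (auto intro!: continuous_map_add continuous_map_real_mult)

text \<open>A candidate \<open>F ys\<close> for each iterated derivative suffices: by uniqueness of limits it is the iterated derivative.\<close>

lemma Cr_map_from_derivatives:
  fixes f :: "'a::real_vector \<Rightarrow> 'b::real_vector"
  assumes X: "subspace (topspace T)" and H: "Hausdorff_space T2"
    and f: "\<And>x. x \<in> topspace T \<Longrightarrow> f x = F [] x" and cont0: "continuous_map T T2 (F [])"
    and der: "\<And>ys x y. set ys \<subseteq> topspace T \<Longrightarrow> x \<in> topspace T \<Longrightarrow> y \<in> topspace T \<Longrightarrow>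
      has_dir_deriv T2 (F ys) y x (F (y # ys) x)"
    and cont: "\<And>k. continuous_map (prod_topology T (product_topology (\<lambda>_. T) {..<k})) T2
      (\<lambda>(x, y). F (map y [0..<k]) x)"
  shows "Cr_map r T (topspace T) T2 f"
proof -
  let ?X = "topspace T"
  have same: "has_dir_deriv T2 g y x L \<longleftrightarrow> has_dir_deriv T2 h y x L"
    if "\<And>z. z \<in> ?X \<Longrightarrow> g z = h z" "x \<in> ?X" "y \<in> ?X" for g h y x L
  proof -
    have "x + t *\<^sub>R y \<in> ?X" for t by (rule subspace_add[OF X that(2) subspace_scale[OF X that(3)]])
    then have "(\<lambda>t. (1 / t) *\<^sub>R (g (x + t *\<^sub>R y) - g x)) = (\<lambda>t. (1 / t) *\<^sub>R (h (x + t *\<^sub>R y) - h x))"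
      using that by simp
    then show ?thesis by (simp add: has_dir_deriv_def)
  qed
  have iter: "iter_deriv T2 f ys x = F ys x" if "set ys \<subseteq> ?X" "x \<in> ?X" for ys x
    using that
  proof (induction ys arbitrary: x)
    case (Cons y ys)
    then have y: "y \<in> ?X" and ys: "set ys \<subseteq> ?X" by auto
    have D: "has_dir_deriv T2 (iter_deriv T2 f ys) y x L \<longleftrightarrow> has_dir_deriv T2 (F ys) y x L" for L
      by (rule same[OF Cons.IH[OF ys] Cons.prems(2) y])
    show ?case
      unfolding iter_deriv.simps dir_deriv_def D
    proof (rule the_equality)
      show "has_dir_deriv T2 (F ys) y x (F (y # ys) x)" by (rule der[OF ys Cons.prems(2) y])
      fix L assume "has_dir_deriv T2 (F ys) y x L"
      then show "L = F (y # ys) x"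
        using der[OF ys Cons.prems(2) y] limitin_Hausdorff_unique[OF _ _ _ H] unfolding has_dir_deriv_def
        by (metis trivial_limit_at)
    qed
  qed (simp add: f)
  show ?thesis
    unfolding Cr_map_def subtopology_topspace
  proof (intro conjI allI impI ballI)
    show "continuous_map T T2 f" by (rule continuous_map_eq[OF cont0]) (simp add: f)
    fix k :: nat and x y ys assume x: "x \<in> ?X" and y: "y \<in> ?X" and "set ys \<subseteq> ?X \<and> Suc (length ys) = k"
    then have ys: "set ys \<subseteq> ?X" by simp
    have "has_dir_deriv T2 (iter_deriv T2 f ys) y x L \<longleftrightarrow> has_dir_deriv T2 (F ys) y x L" for L
      by (rule same[OF iter[OF ys] x y])
    from this[THEN iffD2, OF der[OF ys x y]]
    show "\<exists>L. has_dir_deriv T2 (iter_deriv T2 f ys) y x L" by (rule exI)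
  next
    fix k :: nat
    show "continuous_map (prod_topology T (product_topology (\<lambda>_. T) {..<k})) T2
        (\<lambda>(x, y). iter_deriv T2 f (map y [0..<k]) x)"
    proof (rule continuous_map_eq[OF cont[of k]])
      fix z assume "z \<in> topspace (prod_topology T (product_topology (\<lambda>_. T) {..<k}))"
      then have z: "fst z \<in> ?X" "snd z \<in> {..<k} \<rightarrow>\<^sub>E ?X" by (simp_all add: mem_Times_iff)
      have "set (map (snd z) [0..<k]) \<subseteq> ?X"
      proof
        fix u assume "u \<in> set (map (snd z) [0..<k])"
        then obtain n where "n < k" "u = snd z n" by auto
        then show "u \<in> ?X" using PiE_mem[OF z(2), of n] by simp
      qed
      from iter[OF this z(1)] show "(\<lambda>(x, y). F (map y [0..<k]) x) z = (\<lambda>(x, y). iter_deriv T2 f (map y [0..<k]) x) z"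
        by (simp add: case_prod_unfold)
    qed
  qed
qed

text \<open>Values in the line spanned by \<open>v\<close> are allowed, which covers real functions by \<open>v = 1\<close> and, by some nonzero
  \<open>v\<close> in the direct limit, the test maps for the direct limit property.\<close>

lemma Cr_map_jet:
  fixes f :: "'a::real_vector \<Rightarrow> 'b::real_vector"
  assumes T: "lc_space T" and H: "Hausdorff_space T2" and G: "jet T 0 G"
    and v: "continuous_map euclideanreal T2 (\<lambda>c. c *\<^sub>R v)"
    and f: "\<And>x. x \<in> topspace T \<Longrightarrow> f x = G (\<lambda>_. 0) x *\<^sub>R v"
  shows "Cr_map r T (topspace T) T2 f"
proof -
  let ?X = "topspace T"
  note X = lc_spaceD(1)[OF T]
  have "\<exists>D. \<forall>k. (jet T k (D k) \<and> (k = 0 \<longrightarrow> D k = G)) \<and> (\<forall>v. \<forall>x\<in>?X. (\<forall>n\<le>k. v n \<in> ?X) \<longrightarrow>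
    ((\<lambda>t. D k v (x + t *\<^sub>R v k)) has_real_derivative D (Suc k) v x) (at 0))"
  proof (rule dependent_nat_choice)
    show "\<exists>D. jet T 0 D \<and> (0 = (0::nat) \<longrightarrow> D = G)" using G by blast
    fix D k assume "jet T k D \<and> (k = 0 \<longrightarrow> D = G)"
    then show "\<exists>D'. (jet T (Suc k) D' \<and> (Suc k = 0 \<longrightarrow> D' = G)) \<and> (\<forall>v. \<forall>x\<in>?X. (\<forall>n\<le>k. v n \<in> ?X) \<longrightarrow>
      ((\<lambda>t. D v (x + t *\<^sub>R v k)) has_real_derivative D' v x) (at 0))"
      using jet_has_derivative[OF _ X, of k D] by simp
  qed
  then obtain D where D: "\<And>k. jet T k (D k)" "D 0 = G"
    "\<And>k v x. x \<in> ?X \<Longrightarrow> \<forall>n\<le>k. v n \<in> ?X \<Longrightarrow>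
    ((\<lambda>t. D k v (x + t *\<^sub>R v k)) has_real_derivative D (Suc k) v x) (at 0)" by blast
  \<comment> \<open>The head of the list is the direction of the last derivative, hence the reversal.\<close>
  define F where "F = (\<lambda>ys x. D (length ys) (\<lambda>n. rev ys ! n) x *\<^sub>R v)"
  show ?thesis
  proof (rule Cr_map_from_derivatives[OF X H, of f F])
    fix x assume "x \<in> ?X"
    then show "f x = F [] x" using f jet_cong[OF D(1)[of 0]] by (simp add: F_def D(2))
  next
    have "continuous_map T euclideanreal (\<lambda>x. D 0 (\<lambda>n. rev [] ! n) x)"
      by (rule jet_continuous[OF D(1), where f = "\<lambda>x. x"]) simp_all
    from continuous_map_compose[OF this v] show "continuous_map T T2 (F [])" by (simp add: F_def o_def)
  next
    fix ys x y assume ys: "set ys \<subseteq> ?X" and x: "x \<in> ?X" and y: "y \<in> ?X"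
    let ?k = "length ys" let ?w = "\<lambda>n. rev (y # ys) ! n"
    have wk: "?w ?k = y" by (simp add: nth_append)
    have w: "\<forall>n\<le>?k. ?w n \<in> ?X"
    proof (intro allI impI)
      fix n assume "n \<le> ?k"
      then have "?w n \<in> set (rev (y # ys))" by (intro nth_mem) simp
      then show "?w n \<in> ?X" using ys y by auto
    qed
    have eq: "D ?k ?w z = D ?k (\<lambda>n. rev ys ! n) z" for z
      by (rule jet_cong[OF D(1)]) (simp add: nth_append)
    have "((\<lambda>t. D ?k (\<lambda>n. rev ys ! n) (x + t *\<^sub>R y)) has_real_derivative D (Suc ?k) ?w x) (at 0)"
      using D(3)[OF x w] unfolding wk eq .
    then have "((\<lambda>t. (D ?k (\<lambda>n. rev ys ! n) (x + t *\<^sub>R y) - D ?k (\<lambda>n. rev ys ! n) x) / t)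
        \<longlongrightarrow> D (Suc ?k) ?w x) (at 0)"
      by (simp add: has_field_derivative_iff)
    then have "limitin euclideanreal (\<lambda>t. (D ?k (\<lambda>n. rev ys ! n) (x + t *\<^sub>R y) - D ?k (\<lambda>n. rev ys ! n) x) / t)
        (D (Suc ?k) ?w x) (at 0)" by simp
    from continuous_map_limit[OF v this] show "has_dir_deriv T2 (F ys) y x (F (y # ys) x)"
      unfolding has_dir_deriv_def F_def by (simp add: o_def scaleR_diff_left[symmetric] divide_inverse mult.commute)
  next
    fix k :: nat
    let ?Z = "prod_topology T (product_topology (\<lambda>_. T) {..<k})"
    have "continuous_map ?Z euclideanreal (\<lambda>z. D k (\<lambda>n. rev (map (snd z) [0..<k]) ! n) (fst z))"
    proof (rule jet_continuous[OF D(1) continuous_map_fst])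
      fix n assume n: "n < k"
      have "continuous_map ?Z T (\<lambda>z. snd z (k - Suc n))"
        using continuous_map_compose[OF continuous_map_snd
            continuous_map_product_projection[of "k - Suc n" "{..<k}" "\<lambda>_. T"]] n by (simp add: o_def)
      then show "continuous_map ?Z T (\<lambda>z. rev (map (snd z) [0..<k]) ! n)" using n by (simp add: rev_nth)
    qed
    from continuous_map_compose[OF this v] show "continuous_map ?Z T2 (\<lambda>(x, y). F (map y [0..<k]) x)"
      by (simp add: F_def o_def case_prod_unfold)
  qed
qed

lemma Cr_map_id:
  assumes T: "lc_space T" and H: "Hausdorff_space T" and f: "\<And>x. x \<in> topspace T \<Longrightarrow> f x = x"
  shows "Cr_map r T (topspace T) T f"
proof -
  let ?X = "topspace T"
  note X = lc_spaceD(1)[OF T]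
  define F :: "'a list \<Rightarrow> 'a \<Rightarrow> 'a" where "F = (\<lambda>ys x. case ys of [] \<Rightarrow> x | [y] \<Rightarrow> y | _ \<Rightarrow> 0)"
  have ev: "eventually (\<lambda>t::real. (1 / t) *\<^sub>R (F ys (x + t *\<^sub>R y) - F ys x) = F (y # ys) x) (at 0)" for ys x y
    by (rule eventually_at_filter[THEN iffD2]) (simp add: F_def split: list.split)
  show ?thesis
  proof (rule Cr_map_from_derivatives[OF X H, of f F])
    show "continuous_map T T (F [])" by (simp add: F_def)
    fix ys x y assume "set ys \<subseteq> ?X" "x \<in> ?X" "y \<in> ?X"
    then have "F (y # ys) x \<in> ?X" using subspace_0[OF X] by (auto simp: F_def split: list.split)
    then show "has_dir_deriv T (F ys) y x (F (y # ys) x)"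
      unfolding has_dir_deriv_def limitin_def using ev[of ys x y] by (auto elim!: eventually_mono)
  next
    fix k :: nat
    let ?Z = "prod_topology T (product_topology (\<lambda>_. T) {..<k})"
    consider "k = 0" | "k = 1" | m :: nat where "k = Suc (Suc m)" by (metis One_nat_def not0_implies_Suc)
    then show "continuous_map ?Z T (\<lambda>(x, y). F (map y [0..<k]) x)"
    proof cases
      case 1
      then show ?thesis by (simp add: F_def case_prod_unfold continuous_map_fst)
    next
      case 2
      have "continuous_map ?Z T (\<lambda>z. snd z 0)"
        using continuous_map_compose[OF continuous_map_snd
            continuous_map_product_projection[of 0 "{..<k}" "\<lambda>_. T"]] 2 by (simp add: o_def)
      then show ?thesis using 2 by (simp add: F_def case_prod_unfold)
    next
      case 3
      have "F (map y [0..<k]) x = 0" for x y unfolding 3 by (simp add: F_def upt_rec)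
      then show ?thesis using subspace_0[OF X] by (simp add: case_prod_unfold)
    qed
  qed (simp add: f F_def)
qed

lemma Cr_manifold_mfd_of_lcs:
  assumes "hausdorff_lcs S"
  shows "Cr_manifold r (mfd_of_lcs S)"
proof -
  have S: "lc_space S" "Hausdorff_space S" using assms by (simp_all add: hausdorff_lcs_def)
  have "Cr_map r S (topspace S) S ((\<lambda>x. x) \<circ> inv_into (topspace S) (\<lambda>x. x))"
    by (rule Cr_map_id[OF S]) (simp add: inv_into_f_f[of "\<lambda>x. x", simplified])
  then show ?thesis
    using assms S(2) unfolding Cr_manifold_def mfd_of_lcs_def chart_def
    by (simp add: homeomorphic_map_id[unfolded id_def])
qed

lemma Cr_mfd_map_mfd_of_lcs:
  assumes "continuous_map T S f" "\<And>g. (\<And>x. x \<in> topspace T \<Longrightarrow> g x = f x) \<Longrightarrow> Cr_map r T (topspace T) S g"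
  shows "Cr_mfd_map r (mfd_of_lcs T) (mfd_of_lcs S) f"
proof -
  have "f ` topspace T \<subseteq> topspace S" using assms(1) by (rule continuous_map_image_subset_topspace)
  then have "topspace T \<inter> f -` topspace S = topspace T" by blast
  moreover have "Cr_map r T (topspace T) S ((\<lambda>x. x) \<circ> f \<circ> inv_into (topspace T) (\<lambda>x. x))"
    by (rule assms(2)) (simp add: inv_into_f_f[of "\<lambda>x. x", simplified])
  ultimately show ?thesis using assms(1) by (simp add: Cr_mfd_map_def mfd_of_lcs_def)
qed

lemma sym_form_restrict:
  assumes "continuous_map T S (\<lambda>x. x)" "sym_form S b"
  shows "sym_form T b"
proof -
  have sub: "topspace T \<subseteq> topspace S" using assms(1) by (auto simp: continuous_map_def)
  have "continuous_map (prod_topology T T) S fst" "continuous_map (prod_topology T T) S snd"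
    using continuous_map_compose[OF continuous_map_fst assms(1)]
      continuous_map_compose[OF continuous_map_snd assms(1)] by (simp_all add: o_def)
  then have "continuous_map (prod_topology T T) euclideanreal (\<lambda>(x, y). b x y)"
    using sym_form_continuous[OF assms(2)] by (simp add: case_prod_unfold)
  then show ?thesis using assms(2) sub unfolding sym_form_def by (simp add: subset_iff)
qed

lemma jet_sum: "finite I \<Longrightarrow> (\<And>i. i \<in> I \<Longrightarrow> jet T k (G i)) \<Longrightarrow> jet T k (\<lambda>v x. \<Sum>i\<in>I. G i v x)"
  by (induction I rule: finite_induct) (auto intro: jet.intros)

text \<open>The bump function is a multiple of \<open>t \<mapsto> exp (-1/t)\<close>, taken at \<open>t = 1 - q(x)\<^sup>2\<close> for a Hilbertian seminorm
  \<open>q\<close> whose unit ball lies in the neighbourhood.\<close>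

lemma smoothly_regularI:
  assumes H: "hausdorff_lcs S"
    and dom: "\<And>g. continuous_seminorm S g \<Longrightarrow>
      \<exists>q. continuous_seminorm S q \<and> hilbertian (topspace S) q \<and> (\<forall>x\<in>topspace S. g x \<le> q x)"
  shows "smoothly_regular S"
  unfolding smoothly_regular_def
proof (intro conjI H allI impI)
  have lc: "lc_space S" using H by (simp add: hausdorff_lcs_def)
  fix U assume "U \<subseteq> topspace S \<and> (\<exists>W. openin S W \<and> 0 \<in> W \<and> W \<subseteq> U)"
  then obtain W where W: "openin S W" "0 \<in> W" "W \<subseteq> U" by blast
  obtain g where g: "continuous_seminorm S g" "\<And>x. x \<in> topspace S \<Longrightarrow> g x < 1 \<Longrightarrow> x \<in> W"
    using gauge_seminorm[OF lc W(1,2)] by blast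
  obtain q where q: "continuous_seminorm S q" "hilbertian (topspace S) q" "\<forall>x\<in>topspace S. g x \<le> q x"
    using dom[OF g(1)] by blast
  obtain b where b: "sym_form S b" "\<And>x. x \<in> topspace S \<Longrightarrow> b x x = (q x)\<^sup>2"
    by (rule hilbertian_polarization[OF lc q(1,2)]) (rule that)
  have q0: "q 0 = 0" by (rule seminorm_on_zero[OF hilbertianD(1)[OF q(2)]])
  have 0: "0 \<in> topspace S" by (rule subspace_0[OF lc_spaceD(1)[OF lc]])
  define f where "f = (\<lambda>x. exp 1 * flat [:1:] (1 + (-1) * b x x))"
  have jet: "jet S 0 (\<lambda>v x. exp 1 * flat [:1:] (1 + (-1) * b x x))" by (intro jet.intros b(1))
  have "Cr_map \<infinity> S (topspace S) euclideanreal f"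
    by (rule Cr_map_jet[OF lc _ jet, where v = 1]) (simp_all add: f_def)
  moreover have "f 0 = 1" by (simp add: f_def flat_def b(2)[OF 0] q0 exp_minus)
  moreover have "f x = 0" if x: "x \<in> topspace S - U" for x
  proof -
    have "1 \<le> g x" using g(2)[of x] x W(3) by force
    then have "1 \<le> q x" using q(3) x by force
    then have "1 \<le> b x x" using b(2)[of x] x by (simp add: one_le_power)
    then show ?thesis by (simp add: f_def flat_def)
  qed
  ultimately show "\<exists>f. Cr_map \<infinity> S (topspace S) euclideanreal f \<and> f 0 = 1 \<and> (\<forall>x\<in>topspace S - U. f x = 0)"
    by blast
qed

section \<open>The direct limit in manifolds, and smooth regularity\<close>

context strictly_ascending_lcs
begin

text \<open>The function is \<open>\<Sum>\<^sub>j r\<^sub>j\<^sup>2 q\<^sub>j\<^sup>2\<close> for Hilbertian seminorms \<open>r\<^sub>j\<close> unbounded on the \<open>j\<close>th member of a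
  neighbourhood base of \<open>E 0\<close>, and \<open>q\<^sub>j\<close> vanishing on \<open>E j\<close> and not on \<open>E (Suc j)\<close>. All terms are nonnegative,
  so that one of them being large at a point suffices.\<close>

lemma discontinuous_smooth_function:
  assumes inf: "infinite_dimensional (E 0)"
    and nuc: "\<And>n. nuclear_space (T n)" and fre: "\<And>n. frechet_space (T n)"
  obtains f :: "'a \<Rightarrow> real" and J where "\<And>n. jet (T n) 0 (J n)" "\<And>n x. x \<in> E n \<Longrightarrow> J n (\<lambda>_. 0) x = f x"
    "f 0 = 0" "\<And>W. openin S W \<Longrightarrow> 0 \<in> W \<Longrightarrow> \<exists>x\<in>W. 1 \<le> f x"
proof -
  have metr: "metrizable_space (T n)" for n
    using fre[of n] unfolding frechet_space_def metrizable_space_def by metis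
  obtain U :: "nat \<Rightarrow> 'a set" where U: "(\<forall>j. openin (T 0) (U j) \<and> 0 \<in> U j) \<and>
    (\<forall>W. openin (T 0) W \<and> 0 \<in> W \<longrightarrow> (\<exists>J. \<forall>j\<ge>J. U j \<subseteq> W))"
    using metrizable_neighbourhood_base[OF metr zero_E] by blast
  have U0: "u \<in> E 0" if "u \<in> U j" for u j using U openin_subset that by blast
  have "\<exists>r b. continuous_seminorm S r \<and> sym_form S b \<and> (\<forall>x\<in>topspace S. b x x = (r x)\<^sup>2) \<and>
      (\<forall>K. \<exists>u\<in>U j. K < r u)" for j
  proof -
    obtain p where p: "continuous_seminorm (T 0) p" "\<forall>K. \<exists>u\<in>U j. K < p u"
      using nuclear_unbounded_seminorm[OF nuc inf, of "U j"] U by blast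
    obtain r where r: "continuous_seminorm S r" "hilbertian (topspace S) r" "\<And>x. x \<in> E 0 \<Longrightarrow> p x \<le> r x"
      by (rule hilbertian_seminorm_above[OF nuc p(1)]) (rule that)
    obtain b where b: "sym_form S b" "\<And>x. x \<in> topspace S \<Longrightarrow> b x x = (r x)\<^sup>2"
      by (rule hilbertian_polarization[OF lc_S r(1,2)]) (rule that)
    have "\<exists>u\<in>U j. K < r u" for K using p(2) r(3) U0 less_le_trans by meson
    then show ?thesis using r(1) b by blast
  qed
  then obtain r a where r: "\<And>j. continuous_seminorm S (r j)" "\<And>j. sym_form S (a j)"
    "\<And>j x. x \<in> topspace S \<Longrightarrow> a j x x = (r j x)\<^sup>2" "\<And>j K. \<exists>u\<in>U j. K < r j u" by metis
  have "\<exists>q b w. continuous_seminorm S q \<and> sym_form S b \<and> (\<forall>x\<in>topspace S. b x x = (q x)\<^sup>2) \<and>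
      (\<forall>x\<in>E j. q x = 0) \<and> w \<in> E (Suc j) \<and> (E j \<noteq> E (Suc j) \<longrightarrow> 1 \<le> q w)" for j
  proof (cases "E j = E (Suc j)")
    case True
    have "continuous_seminorm S (\<lambda>_. 0)" "sym_form S (\<lambda>_ _. 0)"
      by (simp_all add: continuous_seminorm_def sym_form_def case_prod_unfold)
    then show ?thesis using True zero_E[of "Suc j"] by (intro exI[of _ "\<lambda>_. 0"] exI[of _ "\<lambda>_ _. 0"] exI[of _ 0]) simp
  next
    case False
    then obtain w where w: "w \<in> E (Suc j)" "w \<notin> E j" using ascending[of j] by blast
    obtain p where p: "continuous_seminorm (T (Suc j)) p" "\<forall>e\<in>E j. 1 \<le> p (w - e)"
      using complete_step_separated[OF fre metr w] by blast
    obtain q where q: "continuous_seminorm S q" "hilbertian (topspace S) q"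
      "\<And>x. x \<in> E j \<Longrightarrow> q x = 0" "1 \<le> q w"
      by (rule hilbertian_seminorm_vanishing[OF nuc p(1) w(1) p(2)[rule_format]]) (assumption, rule that)
    obtain b where b: "sym_form S b" "\<And>x. x \<in> topspace S \<Longrightarrow> b x x = (q x)\<^sup>2"
      by (rule hilbertian_polarization[OF lc_S q(1,2)]) (rule that)
    show ?thesis using q(1,3,4) b w(1) by blast
  qed
  then obtain q b w where q: "\<And>j. continuous_seminorm S (q j)" "\<And>j. sym_form S (b j)"
    "\<And>j x. x \<in> topspace S \<Longrightarrow> b j x x = (q j x)\<^sup>2" "\<And>j x. x \<in> E j \<Longrightarrow> q j x = 0"
    "\<And>j. w j \<in> E (Suc j)" "\<And>j. E j \<noteq> E (Suc j) \<Longrightarrow> 1 \<le> q j (w j)" by metis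
  \<comment> \<open>On \<open>E n\<close> the terms with \<open>j \<ge> n\<close> vanish, so the infinite sum is \<open>F n\<close> there.\<close>
  define F where "F = (\<lambda>n x. \<Sum>j<n. a j x x * b j x x)"
  define f where "f = (\<lambda>x. F (LEAST n. x \<in> E n) x)"
  have F_stable: "F n x = F m x" if x: "x \<in> E m" and "m \<le> n" for x m n
  proof -
    have "b j x x = 0" if "j \<in> {..<n} - {..<m}" for j
    proof -
      have "x \<in> E j" using x E_mono[of m j] that by auto
      then show ?thesis using q(3)[of x j] q(4)[of x j] E_subset_S by auto
    qed
    then show ?thesis unfolding F_def
      by (intro sum.mono_neutral_right) (use \<open>m \<le> n\<close> in auto)
  qed
  have fF: "F n x = f x" if "x \<in> E n" for n x
    unfolding f_def by (rule F_stable) (use that in \<open>auto intro: LeastI Least_le\<close>)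
  show ?thesis
  proof (rule that[of "\<lambda>n v x. F n x" f])
    fix n
    show "jet (T n) 0 (\<lambda>v x. F n x)" unfolding F_def
      by (intro jet_sum jet.intros sym_form_restrict[OF incl_S] r(2) q(2)) simp
    show "F n x = f x" if "x \<in> E n" for x by (rule fF[OF that])
  next
    show "f 0 = 0" using fF[OF zero_E, of 0] by (simp add: F_def)
  next
    fix W assume W: "openin S W" "0 \<in> W"
    obtain s where s: "continuous_seminorm S s" "\<And>x. x \<in> topspace S \<Longrightarrow> s x < 1 \<Longrightarrow> x \<in> W"
      using gauge_seminorm[OF lc_S W] by blast
    note ss = continuous_seminormD(1)[OF lc_S s(1)]
    have "openin (T 0) {x \<in> E 0. s x < 1/2}" by (rule open_seminorm_ball_0[OF lc seminorm_S_restrict[OF s(1)]])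
    moreover have "0 \<in> {x \<in> E 0. s x < 1/2}" using zero_E seminorm_on_zero[OF ss] by simp
    ultimately obtain N where N: "\<forall>j\<ge>N. U j \<subseteq> {x \<in> E 0. s x < 1/2}" using U by blast
    obtain j where j: "j \<ge> N" "E j \<noteq> E (Suc j)" using jump_above[of N] by blast
    note sr = continuous_seminormD(1)[OF lc_S r(1)[of j]] and sq = continuous_seminormD(1)[OF lc_S q(1)[of j]]
    have wS: "w j \<in> topspace S" using q(5) E_subset_S by blast
    obtain k where k: "s (w j) / real (Suc k) < 1/2" using eventually_small_quotient[of "1/2" "s (w j)"] by auto
    define e where "e = 1 / real (Suc k)"
    have e: "0 < e" by (simp add: e_def)
    have eS: "e *\<^sub>R w j \<in> topspace S" by (rule subspace_scale[OF subspace_S wS])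
    \<comment> \<open>Large enough for \<open>r j (u + e w\<^sub>j) \<ge> 1/e\<close>, which compensates the small factor \<open>q j (u + e w\<^sub>j) \<ge> e\<close>.\<close>
    obtain u where u: "u \<in> U j" "e * r j (w j) + 1 / e < r j u" using r(4) by blast
    have uE: "u \<in> E 0" "u \<in> topspace S" using U0[OF u(1)] E_subset_S by blast+
    define x where "x = u + e *\<^sub>R w j"
    have xS: "x \<in> topspace S" unfolding x_def by (rule subspace_add[OF subspace_S uE(2) eS])
    have "s x \<le> s u + s (w j) / real (Suc k)"
      using seminorm_onD(2)[OF ss uE(2) eS] seminorm_onD(3)[OF ss wS, of e] by (simp add: x_def e_def)
    also have "s u < 1/2" using N j(1) u(1) by blast
    also note k
    finally have "s x < 1" by simp
    then have "x \<in> W" using s(2)[OF xS] by blast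
    moreover have "1 \<le> f x"
    proof -
      have "u \<in> E j" "u \<in> E (Suc j)" using uE(1) E_mono[of 0 j] E_mono[of 0 "Suc j"] by auto
      then have xE: "x \<in> E (Suc j)" unfolding x_def
        by (intro subspace_add[OF subspace_E] subspace_scale[OF subspace_E] q(5))
      have "1 / e \<le> r j x"
        using seminorm_on_triangle_minus(4)[OF sr uE(2) eS] seminorm_onD(3)[OF sr wS, of e] u(2) e
        by (simp add: x_def)
      moreover have "e \<le> q j x"
      proof -
        have "e * 1 \<le> e * q j (w j)" using q(6)[OF j(2)] e by (intro mult_left_mono) auto
        also have "\<dots> = q j (e *\<^sub>R w j)" using seminorm_onD(3)[OF sq wS, of e] e by simp
        also have "\<dots> \<le> q j (e *\<^sub>R w j + u)"
          using seminorm_on_triangle_minus(4)[OF sq eS uE(2)] q(4)[OF \<open>u \<in> E j\<close>] by simp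
        finally show ?thesis by (simp add: x_def add.commute)
      qed
      ultimately have "(1 / e) * e \<le> r j x * q j x"
        using e by (intro mult_mono) (auto intro: order_trans[of 0 "1/e"])
      then have "1 \<le> r j x * q j x" using e by simp
      then have "1 \<le> (r j x * q j x)\<^sup>2" by (rule one_le_power)
      also have "\<dots> = a j x x * b j x x" by (simp add: r(3)[OF xS] q(3)[OF xS] power_mult_distrib)
      also have "\<dots> \<le> F (Suc j) x" unfolding F_def
        by (rule member_le_sum) (auto simp: r(3)[OF xS] q(3)[OF xS])
      finally show ?thesis using fF[OF xE] by simp
    qed
    ultimately show "\<exists>x\<in>W. 1 \<le> f x" by blast
  qed
qed

text \<open>The test object is \<open>E\<close> itself: a fixed vector \<open>v \<noteq> 0\<close> turns the discontinuous function into a map to \<open>E\<close>,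
  and a seminorm with \<open>s v > 0\<close> detects the discontinuity.\<close>

lemma not_manifold_limit:
  assumes inf: "infinite_dimensional (E 0)"
    and nuc: "\<And>n. nuclear_space (T n)" and fre: "\<And>n. frechet_space (T n)"
  shows "\<not> mfd_direct_limit r (\<lambda>n. mfd_of_lcs (T n)) (mfd_of_lcs S)"
proof
  assume lim: "mfd_direct_limit r (\<lambda>n. mfd_of_lcs (T n)) (mfd_of_lcs S)"
  obtain f :: "'a \<Rightarrow> real" and J where f: "\<And>n. jet (T n) 0 (J n)" "\<And>n x. x \<in> E n \<Longrightarrow> J n (\<lambda>_. 0) x = f x"
    "f 0 = 0" "\<And>W. openin S W \<Longrightarrow> 0 \<in> W \<Longrightarrow> \<exists>x\<in>W. 1 \<le> f x"
    by (rule discontinuous_smooth_function[OF inf nuc fre]) (rule that)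
  have H: "Hausdorff_space S" using hausdorff_S[OF nuc] by (simp add: hausdorff_lcs_def)
  obtain v where v: "v \<in> E 0" "v \<noteq> 0"
    using inf unfolding infinite_dimensional_def by (metis finite.emptyI singletonI span_empty subsetI)
  have vS: "v \<in> topspace S" using v(1) E_subset_S by blast
  obtain s where s: "continuous_seminorm S s" "s v > 0"
    by (rule hausdorff_lcs_separating_seminorm[OF hausdorff_S[OF nuc] vS v(2)]) (rule that)
  note ss = continuous_seminormD(1)[OF lc_S s(1)]
  have line: "continuous_map euclideanreal S (\<lambda>c. c *\<^sub>R v)"
    using vS by (intro lc_scaleR_continuous[OF lc_S]) auto
  define F where "F = (\<lambda>x. f x *\<^sub>R v)"
  have "Cr_mfd_map r (mfd_of_lcs (T n)) (mfd_of_lcs S) F" for n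
  proof (rule Cr_mfd_map_mfd_of_lcs)
    show cr: "Cr_map r (T n) (E n) S g" if "\<And>x. x \<in> E n \<Longrightarrow> g x = F x" for g
      by (rule Cr_map_jet[OF lc H f(1) line]) (simp add: that F_def f(2))
    show "continuous_map (T n) S F" using cr[of F] by (simp add: Cr_map_def)
  qed
  moreover have "Cr_manifold r (mfd_of_lcs S)" by (rule Cr_manifold_mfd_of_lcs[OF hausdorff_S[OF nuc]])
  ultimately obtain g where g: "Cr_mfd_map r (mfd_of_lcs S) (mfd_of_lcs S) g"
    "\<And>n x. x \<in> E n \<Longrightarrow> g x = F x"
    using direct_limit_cone_factor[OF lim[unfolded mfd_direct_limit_def], of "mfd_of_lcs S" F]
    by (auto simp: mfd_of_lcs_def)
  have "continuous_map S S g" using g(1) by (simp add: Cr_mfd_map_def mfd_of_lcs_def)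
  then have "continuous_map S euclideanreal (s \<circ> g)"
    by (rule continuous_map_compose[OF _ continuous_seminormD(2)[OF lc_S s(1)]])
  then have "openin S {x \<in> topspace S. (s \<circ> g) x \<in> {..<s v}}" by (rule openin_continuous_map_preimage) auto
  moreover have gF: "g x = F x" if "x \<in> topspace S" for x using that g(2) unfolding topspace_S by blast
  have "0 \<in> {x \<in> topspace S. (s \<circ> g) x \<in> {..<s v}}"
    using zero_S s(2) gF[OF zero_S] seminorm_on_zero[OF ss] by (simp add: F_def f(3))
  ultimately obtain x where x: "x \<in> topspace S" "s (g x) < s v" "1 \<le> f x" using f(4) by fastforce
  have "s (g x) = \<bar>f x\<bar> * s v" using gF[OF x(1)] seminorm_onD(3)[OF ss vS] by (simp add: F_def)
  also have "\<dots> \<ge> 1 * s v" using x(3) s(2) by (intro mult_right_mono) auto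
  finally show False using x(2) by simp
qed

lemma smoothly_regular_S:
  assumes nuc: "\<And>n. nuclear_space (T n)"
  shows "smoothly_regular S"
proof (rule smoothly_regularI[OF hausdorff_S[OF nuc]])
  fix g assume "continuous_seminorm S g"
  from hilbertian_seminorm_dominating[OF nuc this]
  show "\<exists>q. continuous_seminorm S q \<and> hilbertian (topspace S) q \<and> (\<forall>x\<in>topspace S. g x \<le> q x)" by metis
qed

end

theorem lemma3p5:
  fixes T :: "nat \<Rightarrow> 'a::real_vector topology" and S :: "'a topology"
  assumes lcs: "\<And>n. hausdorff_lcs (T n)"
    and ascending: "\<And>n. topspace (T n) \<subseteq> topspace (T (Suc n))"
    and induced: "\<And>n. subtopology (T (Suc n)) (topspace (T n)) = T n"
    and not_stationary: "\<not> (\<exists>N. \<forall>n\<ge>N. topspace (T n) = topspace (T N))"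
    and limit_topology: "lc_direct_limit_topology T S"
  shows
    "((\<forall>n. infinite_dimensional (topspace (T n)) \<and> metrizable_space (T n)) \<longrightarrow>
        \<not> top_direct_limit T S) \<and>
     ((\<forall>n. infinite_dimensional (topspace (T n)) \<and> nuclear_space (T n) \<and> frechet_space (T n)) \<longrightarrow>
        (\<forall>r::enat. \<not> mfd_direct_limit r (\<lambda>n. mfd_of_lcs (T n)) (mfd_of_lcs S)) \<and>
        smoothly_regular S)"
proof -
  interpret strictly_ascending_lcs T S
    by unfold_locales (fact lcs ascending induced limit_topology not_stationary)+
  show ?thesis
    using not_topological_limit not_manifold_limit smoothly_regular_S by blast
qed

end
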